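(* Let $(H,\mu_H,\Delta_H,\alpha_H)$ be a Hom-bialgebra such that $\alpha_H$ is bijective. Then ${}_H^H\mathcal{YD}$ is a quasi-braided pre-tensor category, with the following structure, for objects $(M,\alpha_M)$, $(N,\alpha_N)$, $(P,\alpha_P)$: - the tensor product $M\hat\otimes N$ is $(M\otimes N,\alpha_M\otimes\alpha_N)$ with action $h\cdot(m\otimes n)=h_1\cdot m\otimes h_2\cdot n$ and coaction $m\otimes n\mapsto\alpha_H^{-2}(m_{(-1)}n_{(-1)})\otimes(m_{(0)}\otimes n_{(0)})$; - the associativity constraints are $a_{M,N,P}:(M\hat\otimes N)\hat\otimes P\to M\hat\otimes(N\hat\otimes P)$, $a_{M,N,P}((m\otimes n)\otimes p)=\alpha_M^{-1}(m)\otimes(n\otimes\alpha_P(p))$; - the quasi-braiding is $c_{M,N}:M\hat\otimes N\to N\hat\otimes M$, $c_{M,N}(m\otimes n)=\alpha_N^{-1}(\alpha_H^{-1}(m_{(-1)})\cdot n)\otimes\alpha_M^{-1}(m_{(0)})$.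
   Context: Everything is over a field $k$, $\otimes=\otimes_k$; (co)algebras are not assumed (co)unital. Sweedler notation: $\Delta(h)=h_1\otimes h_2$; multiplications are written by juxtaposition. A Hom-bialgebra is $(H,\mu,\Delta,\alpha)$ with $\mu:H\otimes H\to H$, $\Delta:H\to H\otimes H$, $\alpha:H\to H$ linear such that for all $h,h',h''$: $\alpha(hh')=\alpha(h)\alpha(h')$; $\alpha(h)(h'h'')=(hh')\alpha(h'')$; $\Delta(h_1)\otimes\alpha(h_2)=\alpha(h_1)\otimes\Delta(h_2)$; $\Delta(hh')=h_1h'_1\otimes h_2h'_2$; $\Delta(\alpha(h))=\alpha(h_1)\otimes\alpha(h_2)$. Let $(H,\mu_H,\Delta_H,\alpha_H)$ be a Hom-bialgebra, $M$ a linear space, $\alpha_M:M\to M$ linear. $(M,\alpha_M)$ is a left $H$-module if there is a linear map $H\otimes M\to M$, $h\otimes m\mapsto h\cdot m$, with $\alpha_M(h\cdot m)=\alpha_H(h)\cdot\alpha_M(m)$ and $\alpha_H(h)\cdot(h'\cdot m)=(hh')\cdot\alpha_M(m)$. It is a left $H$-comodule if there is a linear map $\lambda_M:M\to H\otimes M$, $\lambda_M(m)=m_{(-1)}\otimes m_{(0)}$, with $(\alpha_H\otimes\alpha_M)\circ\lambda_M=\lambda_M\circ\alpha_M$ and $(\Delta_H\otimes\alpha_M)\circ\lambda_M=(\alpha_H\otimes\lambda_M)\circ\lambda_M$. A morphism $f:M\to N$ of left $H$-modules is a linear map with $\alpha_N\circ f=f\circ\alpha_M$ and $f(h\cdot m)=h\cdot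 f(m)$; a morphism of left $H$-comodules is a linear map with $\alpha_N\circ f=f\circ\alpha_M$ and $(id_H\otimes f)\circ\lambda_M=\lambda_N\circ f$. $(M,\alpha_M)$ is a (left-left) Yetter-Drinfeld module over $H$ if it is both a left $H$-module and a left $H$-comodule and, for all $h\in H$, $m\in M$, $$(h_1\cdot m)_{(-1)}\alpha_H^2(h_2)\otimes(h_1\cdot m)_{(0)}=\alpha_H^2(h_1)\alpha_H(m_{(-1)})\otimes\alpha_H(h_2)\cdot m_{(0)}.$$ For $\alpha_H$ bijective, ${}_H^H\mathcal{YD}$ is the category whose objects are Yetter-Drinfeld modules $(M,\alpha_M)$ over $H$ with $\alpha_M$ bijective, and whose morphisms are the maps that are morphisms of both left $H$-modules and left $H$-comodules. A pre-tensor category $(\mathcal C,\otimes,a)$ satisfies all the axioms of a tensor (monoidal) category except that no unit object or unit constraints are required: $\otimes$ is a bifunctor and $a_{U,V,W}:(U\otimes V)\otimes W\to U\otimes(V\otimes W)$ is a natural isomorphism satisfying the pentagon axiom. A quasi-braiding is a family of natural morphisms $c_{V,W}:V\otimes W\to W\otimes V$ (not required to be isomorphisms) satisfying the two hexagon axioms $a_{V,W,U}\circ c_{U,V\otimes W}\circ a_{U,V,W}=(id_V\otimes c_{U,W})\circ a_{V,U,W}\circ(c_{U,V}\otimes id_W)$ and $a_{W,U,V}^{-1}\circ c_{U\otimes V,W}\circ a_{U,V,W}^{-1}=(c_{U,W}\otimes id_V)\circ a_{U,W,V}^{-1}\circ(id_U\otimes c_{V,W})$. Then $(\mathcal C,\otimes,a,c)$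 is a quasi-braided pre-tensor category. *)

theory Defs
  imports "HOL-Algebra.Module" "HOL-Library.FuncSet"
begin

section \<open>Quasi-braided pre-tensor categories\<close>

locale category =
  fixes Ob :: "'o set"
    and Hom :: "'o \<Rightarrow> 'o \<Rightarrow> 'm set"
    and comp :: "'m \<Rightarrow> 'm \<Rightarrow> 'm"  (infixr \<open>\<cdot>\<close> 70)
    and ident :: "'o \<Rightarrow> 'm"
  assumes Hom_disjoint:
      "\<lbrakk>A \<in> Ob; B \<in> Ob; A' \<in> Ob; B' \<in> Ob; f \<in> Hom A B; f \<in> Hom A' B'\<rbrakk> \<Longrightarrow> A = A' \<and> B = B'"
    and comp_in_Hom:
      "\<lbrakk>A \<in> Ob; B \<in> Ob; C \<in> Ob; f \<in> Hom A B; g \<in> Hom B C\<rbrakk> \<Longrightarrow> g \<cdot> f \<in> Hom A C"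
    and ident_in_Hom: "A \<in> Ob \<Longrightarrow> ident A \<in> Hom A A"
    and comp_assoc:
      "\<lbrakk>A \<in> Ob; B \<in> Ob; C \<in> Ob; D \<in> Ob; f \<in> Hom A B; g \<in> Hom B C; h \<in> Hom C D\<rbrakk>
        \<Longrightarrow> (h \<cdot> g) \<cdot> f = h \<cdot> (g \<cdot> f)"
    and comp_ident: "\<lbrakk>A \<in> Ob; B \<in> Ob; f \<in> Hom A B\<rbrakk> \<Longrightarrow> f \<cdot> ident A = f"
    and ident_comp: "\<lbrakk>A \<in> Ob; B \<in> Ob; f \<in> Hom A B\<rbrakk> \<Longrightarrow> ident B \<cdot> f = f"
begin

definition inverse_arrows :: "'o \<Rightarrow> 'o \<Rightarrow> 'm \<Rightarrow> 'm \<Rightarrow> bool" where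
  "inverse_arrows A B f g \<longleftrightarrow>
     f \<in> Hom A B \<and> g \<in> Hom B A \<and> g \<cdot> f = ident A \<and> f \<cdot> g = ident B"

definition isomorphism :: "'o \<Rightarrow> 'o \<Rightarrow> 'm \<Rightarrow> bool" where
  "isomorphism A B f \<longleftrightarrow> (\<exists>g. inverse_arrows A B f g)"

definition inverse_arrow :: "'m \<Rightarrow> 'm" where
  "inverse_arrow f = (THE g. \<exists>A\<in>Ob. \<exists>B\<in>Ob. inverse_arrows A B f g)"

end

locale pre_tensor_category = category Ob Hom comp ident
  for Ob :: "'o set"
    and Hom :: "'o \<Rightarrow> 'o \<Rightarrow> 'm set"
    and comp :: "'m \<Rightarrow> 'm \<Rightarrow> 'm"  (infixr \<open>\<cdot>\<close> 70)
    and ident :: "'o \<Rightarrow> 'm" +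
  fixes T :: "'o \<Rightarrow> 'o \<Rightarrow> 'o"  (infixr \<open>\<boxtimes>\<close> 75)
    and Tm :: "'m \<Rightarrow> 'm \<Rightarrow> 'm"  (infixr \<open>\<boxtimes>\<^sub>m\<close> 75)
    and a :: "'o \<Rightarrow> 'o \<Rightarrow> 'o \<Rightarrow> 'm"
  assumes tensor_in_Ob: "\<lbrakk>U \<in> Ob; V \<in> Ob\<rbrakk> \<Longrightarrow> U \<boxtimes> V \<in> Ob"
    and tensor_in_Hom:
      "\<lbrakk>U \<in> Ob; V \<in> Ob; U' \<in> Ob; V' \<in> Ob; f \<in> Hom U U'; g \<in> Hom V V'\<rbrakk>
        \<Longrightarrow> f \<boxtimes>\<^sub>m g \<in> Hom (U \<boxtimes> V) (U' \<boxtimes> V')"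
    and tensor_ident: "\<lbrakk>U \<in> Ob; V \<in> Ob\<rbrakk> \<Longrightarrow> ident U \<boxtimes>\<^sub>m ident V = ident (U \<boxtimes> V)"
    and tensor_comp:
      "\<lbrakk>U \<in> Ob; U' \<in> Ob; U'' \<in> Ob; V \<in> Ob; V' \<in> Ob; V'' \<in> Ob;
        f \<in> Hom U U'; f' \<in> Hom U' U''; g \<in> Hom V V'; g' \<in> Hom V' V''\<rbrakk>
        \<Longrightarrow> (f' \<cdot> f) \<boxtimes>\<^sub>m (g' \<cdot> g) = (f' \<boxtimes>\<^sub>m g') \<cdot> (f \<boxtimes>\<^sub>m g)"
    and assoc_iso:
      "\<lbrakk>U \<in> Ob; V \<in> Ob; W \<in> Ob\<rbrakk>
        \<Longrightarrow> isomorphism ((U \<boxtimes> V) \<boxtimes> W) (U \<boxtimes> (V \<boxtimes> W)) (a U V W)"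
    and assoc_natural:
      "\<lbrakk>U \<in> Ob; V \<in> Ob; W \<in> Ob; U' \<in> Ob; V' \<in> Ob; W' \<in> Ob;
        f \<in> Hom U U'; g \<in> Hom V V'; h \<in> Hom W W'\<rbrakk>
        \<Longrightarrow> a U' V' W' \<cdot> ((f \<boxtimes>\<^sub>m g) \<boxtimes>\<^sub>m h) = (f \<boxtimes>\<^sub>m (g \<boxtimes>\<^sub>m h)) \<cdot> a U V W"
    and pentagon:
      "\<lbrakk>U \<in> Ob; V \<in> Ob; W \<in> Ob; X \<in> Ob\<rbrakk>
        \<Longrightarrow> a U V (W \<boxtimes> X) \<cdot> a (U \<boxtimes> V) W X =
            (ident U \<boxtimes>\<^sub>m a V W X) \<cdot> a U (V \<boxtimes> W) X \<cdot> (a U V W \<boxtimes>\<^sub>m ident X)"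

locale quasi_braided_pre_tensor_category = pre_tensor_category Ob Hom comp ident T Tm a
  for Ob :: "'o set"
    and Hom :: "'o \<Rightarrow> 'o \<Rightarrow> 'm set"
    and comp :: "'m \<Rightarrow> 'm \<Rightarrow> 'm"  (infixr \<open>\<cdot>\<close> 70)
    and ident :: "'o \<Rightarrow> 'm"
    and T :: "'o \<Rightarrow> 'o \<Rightarrow> 'o"  (infixr \<open>\<boxtimes>\<close> 75)
    and Tm :: "'m \<Rightarrow> 'm \<Rightarrow> 'm"  (infixr \<open>\<boxtimes>\<^sub>m\<close> 75)
    and a :: "'o \<Rightarrow> 'o \<Rightarrow> 'o \<Rightarrow> 'm" +
  fixes c :: "'o \<Rightarrow> 'o \<Rightarrow> 'm"
  assumes braid_in_Hom: "\<lbrakk>V \<in> Ob; W \<in> Ob\<rbrakk> \<Longrightarrow> c V W \<in> Hom (V \<boxtimes> W) (W \<boxtimes> V)"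
    and braid_natural:
      "\<lbrakk>V \<in> Ob; W \<in> Ob; V' \<in> Ob; W' \<in> Ob; f \<in> Hom V V'; g \<in> Hom W W'\<rbrakk>
        \<Longrightarrow> c V' W' \<cdot> (f \<boxtimes>\<^sub>m g) = (g \<boxtimes>\<^sub>m f) \<cdot> c V W"
    and hexagon1:
      "\<lbrakk>U \<in> Ob; V \<in> Ob; W \<in> Ob\<rbrakk>
        \<Longrightarrow> a V W U \<cdot> c U (V \<boxtimes> W) \<cdot> a U V W =
            (ident V \<boxtimes>\<^sub>m c U W) \<cdot> a V U W \<cdot> (c U V \<boxtimes>\<^sub>m ident W)"
    and hexagon2:
      "\<lbrakk>U \<in> Ob; V \<in> Ob; W \<in> Ob\<rbrakk>
        \<Longrightarrow> inverse_arrow (a W U V) \<cdot> c (U \<boxtimes> V) W \<cdot> inverse_arrow (a U V W) =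
            (c U W \<boxtimes>\<^sub>m ident V) \<cdot> inverse_arrow (a U W V) \<cdot> (ident U \<boxtimes>\<^sub>m c V W)"


section \<open>Linear maps and tensor products\<close>

text \<open>
  The objects of a category have to live in one type, and that type has to be closed
  under tensor products. The carriers of all vector spaces are therefore subsets of the
  type \<open>'a univ\<close>, in which formal sums of pairs of elements are again elements.
  Since \<open>'a\<close> is arbitrary and embeds by \<open>Atom\<close>, every vector space has an isomorphic
  copy of this form.
\<close>

datatype 'a univ = Atom 'a | Formal_sum "('a univ \<times> 'a univ) list"

primrec summands :: "'a univ \<Rightarrow> ('a univ \<times> 'a univ) list" where
  "summands (Formal_sum ts) = ts"
| "summands (Atom x) = []"

text \<open>Linear maps are extensional: they take a fixed default value off the carrier of
  their domain, so that equality of linear maps is equality of functions.\<close>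

definition linear_maps ::
  "('k, 'r) ring_scheme \<Rightarrow> ('k, 'v, 's) module_scheme \<Rightarrow> ('k, 'w, 't) module_scheme \<Rightarrow> ('v \<Rightarrow> 'w) set"
  where
  "linear_maps K V W =
     {f \<in> carrier V \<rightarrow>\<^sub>E carrier W.
        (\<forall>x\<in>carrier V. \<forall>y\<in>carrier V. f (x \<oplus>\<^bsub>V\<^esub> y) = f x \<oplus>\<^bsub>W\<^esub> f y) \<and>
        (\<forall>r\<in>carrier K. \<forall>x\<in>carrier V. f (r \<odot>\<^bsub>V\<^esub> x) = r \<odot>\<^bsub>W\<^esub> f x)}"

text \<open>\<open>V \<otimes> W\<close> is the set of formal sums \<open>[(x\<^sub>1, y\<^sub>1), \<dots>, (x\<^sub>n, y\<^sub>n)]\<close>, with concatenation as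
  addition, modulo the congruence generated by commutativity, biadditivity and
  \<open>K\<close>-balancedness. The remaining rule \<open>zero\<close> makes this quotient a group: together with
  biadditivity it gives \<open>(- x, y)\<close> as the inverse of \<open>(x, y)\<close>.\<close>

inductive tensor_rel ::
  "('k, 'r) ring_scheme \<Rightarrow> ('k, 'v, 's) module_scheme \<Rightarrow> ('k, 'w, 't) module_scheme
    \<Rightarrow> ('v \<times> 'w) list \<Rightarrow> ('v \<times> 'w) list \<Rightarrow> bool"
  for K :: "('k, 'r) ring_scheme"
    and V :: "('k, 'v, 's) module_scheme" and W :: "('k, 'w, 't) module_scheme"
  where
  refl: "s \<in> lists (carrier V \<times> carrier W) \<Longrightarrow> tensor_rel K V W s s"
| sym: "tensor_rel K V W s t \<Longrightarrow> tensor_rel K V W t s"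
| trans: "\<lbrakk>tensor_rel K V W s t; tensor_rel K V W t u\<rbrakk> \<Longrightarrow> tensor_rel K V W s u"
| append: "\<lbrakk>tensor_rel K V W s s'; tensor_rel K V W t t'\<rbrakk> \<Longrightarrow> tensor_rel K V W (s @ t) (s' @ t')"
| commute: "\<lbrakk>s \<in> lists (carrier V \<times> carrier W); t \<in> lists (carrier V \<times> carrier W)\<rbrakk>
    \<Longrightarrow> tensor_rel K V W (s @ t) (t @ s)"
| zero: "y \<in> carrier W \<Longrightarrow> tensor_rel K V W [(\<zero>\<^bsub>V\<^esub>, y)] []"
| add_left: "\<lbrakk>x \<in> carrier V; x' \<in> carrier V; y \<in> carrier W\<rbrakk>
    \<Longrightarrow> tensor_rel K V W [(x \<oplus>\<^bsub>V\<^esub> x', y)] [(x, y), (x', y)]"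
| add_right: "\<lbrakk>x \<in> carrier V; y \<in> carrier W; y' \<in> carrier W\<rbrakk>
    \<Longrightarrow> tensor_rel K V W [(x, y \<oplus>\<^bsub>W\<^esub> y')] [(x, y), (x, y')]"
| balanced: "\<lbrakk>r \<in> carrier K; x \<in> carrier V; y \<in> carrier W\<rbrakk>
    \<Longrightarrow> tensor_rel K V W [(r \<odot>\<^bsub>V\<^esub> x, y)] [(x, r \<odot>\<^bsub>W\<^esub> y)]"

text \<open>The class of a formal sum is represented by a chosen element rather than by the
  set of its members, because a set of formal sums is not an element of \<open>'a univ\<close>.\<close>

definition tensor_class ::
  "('k, 'r) ring_scheme \<Rightarrow> ('k, 'a univ, 's) module_scheme \<Rightarrow> ('k, 'a univ, 't) module_scheme
    \<Rightarrow> ('a univ \<times> 'a univ) list \<Rightarrow> 'a univ" where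
  "tensor_class K V W s = Formal_sum (SOME t. tensor_rel K V W s t)"

definition pure ::
  "('k, 'r) ring_scheme \<Rightarrow> ('k, 'a univ, 's) module_scheme \<Rightarrow> ('k, 'a univ, 't) module_scheme
    \<Rightarrow> 'a univ \<Rightarrow> 'a univ \<Rightarrow> 'a univ" where
  "pure K V W x y = tensor_class K V W [(x, y)]"

text \<open>The fields \<open>mult\<close> and \<open>one\<close>, which a module record inherits from rings, play no role.\<close>

definition tensor ::
  "('k, 'r) ring_scheme \<Rightarrow> ('k, 'a univ, 's) module_scheme \<Rightarrow> ('k, 'a univ, 't) module_scheme
    \<Rightarrow> ('k, 'a univ) module" where
  "tensor K V W =
     \<lparr>carrier = tensor_class K V W ` lists (carrier V \<times> carrier W),
      mult = undefined, one = undefined,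
      zero = tensor_class K V W [],
      add = (\<lambda>s t. tensor_class K V W (summands s @ summands t)),
      smult = (\<lambda>r s. tensor_class K V W (map (\<lambda>(x, y). (r \<odot>\<^bsub>V\<^esub> x, y)) (summands s)))\<rparr>"

definition tensor_map ::
  "('k, 'r) ring_scheme \<Rightarrow> ('k, 'a univ, 's) module_scheme \<Rightarrow> ('k, 'a univ, 't) module_scheme
    \<Rightarrow> ('k, 'a univ, 's2) module_scheme \<Rightarrow> ('k, 'a univ, 't2) module_scheme
    \<Rightarrow> ('a univ \<Rightarrow> 'a univ) \<Rightarrow> ('a univ \<Rightarrow> 'a univ) \<Rightarrow> 'a univ \<Rightarrow> 'a univ" where
  "tensor_map K V W V' W' f g =
     (\<lambda>s\<in>carrier (tensor K V W). tensor_class K V' W' (map (map_prod f g) (summands s)))"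

text \<open>Sweedler notation: if \<open>t = \<Sum>\<^sub>i x\<^sub>i \<otimes> y\<^sub>i\<close>, then \<open>sweedler X t (\<lambda>x y. \<beta> x y)\<close> is the element
  \<open>\<Sum>\<^sub>i \<beta> x\<^sub>i y\<^sub>i\<close> of \<open>X\<close>. It is independent of the formal sum representing \<open>t\<close> when \<open>\<beta>\<close> is
  bilinear, which is the case throughout.\<close>

definition sweedler ::
  "('k, 'b, 's) module_scheme \<Rightarrow> 'a univ \<Rightarrow> ('a univ \<Rightarrow> 'a univ \<Rightarrow> 'b) \<Rightarrow> 'b" where
  "sweedler X t \<beta> = foldr (\<lambda>(x, y) s. \<beta> x y \<oplus>\<^bsub>X\<^esub> s) (summands t) \<zero>\<^bsub>X\<^esub>"

text \<open>The linear map \<open>V \<otimes> W \<rightarrow> X\<close> with \<open>x \<otimes> y \<mapsto> \<beta> x y\<close>, for \<open>\<beta>\<close> bilinear.\<close>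

definition lin_ext ::
  "('k, 'r) ring_scheme \<Rightarrow> ('k, 'a univ, 's) module_scheme \<Rightarrow> ('k, 'a univ, 't) module_scheme
    \<Rightarrow> ('k, 'b, 'u) module_scheme \<Rightarrow> ('a univ \<Rightarrow> 'a univ \<Rightarrow> 'b) \<Rightarrow> 'a univ \<Rightarrow> 'b" where
  "lin_ext K V W X \<beta> = (\<lambda>t\<in>carrier (tensor K V W). sweedler X t \<beta>)"

text \<open>The canonical identification \<open>(U \<otimes> V) \<otimes> W \<rightarrow> U \<otimes> (V \<otimes> W)\<close>, needed to compare elements of the two
  threefold tensor products in Hom-coassociativity.\<close>

definition reassoc ::
  "('k, 'r) ring_scheme \<Rightarrow> ('k, 'a univ, 's) module_scheme \<Rightarrow> ('k, 'a univ, 't) module_scheme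
    \<Rightarrow> ('k, 'a univ, 'u) module_scheme \<Rightarrow> 'a univ \<Rightarrow> 'a univ" where
  "reassoc K U V W =
     (let X = tensor K U (tensor K V W) in
      lin_ext K (tensor K U V) W X
        (\<lambda>s w. sweedler X s (\<lambda>u v. pure K U (tensor K V W) u (pure K V W v w))))"


section \<open>Hom-bialgebras and Yetter-Drinfeld modules\<close>

record ('k, 'a) hom_space = "('k, 'a univ) module" +
  twist :: "'a univ \<Rightarrow> 'a univ"  (\<open>\<alpha>\<index>\<close>)

record ('k, 'a) hom_bialg = "('k, 'a) hom_space" +
  multiplication :: "'a univ \<Rightarrow> 'a univ"
  comult :: "'a univ \<Rightarrow> 'a univ"  (\<open>\<Delta>\<index>\<close>)

record ('k, 'a) yd = "('k, 'a) hom_space" +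
  action :: "'a univ \<Rightarrow> 'a univ"
  coaction :: "'a univ \<Rightarrow> 'a univ"  (\<open>\<lambda>c\<index>\<close>)

definition hmul ::
  "('k, 'r) ring_scheme \<Rightarrow> ('k, 'a) hom_bialg \<Rightarrow> 'a univ \<Rightarrow> 'a univ \<Rightarrow> 'a univ" where
  "hmul K H x y = multiplication H (pure K H H x y)"

definition act ::
  "('k, 'r) ring_scheme \<Rightarrow> ('k, 'a) hom_bialg \<Rightarrow> ('k, 'a) yd \<Rightarrow> 'a univ \<Rightarrow> 'a univ \<Rightarrow> 'a univ"
  where "act K H M h m = action M (pure K H M h m)"

definition hom_bialgebra :: "('k, 'r) ring_scheme \<Rightarrow> ('k, 'a) hom_bialg \<Rightarrow> bool" where
  "hom_bialgebra K H \<longleftrightarrow>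
     module K H \<and>
     multiplication H \<in> linear_maps K (tensor K H H) H \<and>
     \<Delta>\<^bsub>H\<^esub> \<in> linear_maps K H (tensor K H H) \<and>
     \<alpha>\<^bsub>H\<^esub> \<in> linear_maps K H H \<and>
     (\<forall>x\<in>carrier H. \<forall>y\<in>carrier H. \<alpha>\<^bsub>H\<^esub> (hmul K H x y) = hmul K H (\<alpha>\<^bsub>H\<^esub> x) (\<alpha>\<^bsub>H\<^esub> y)) \<and>
     (\<forall>x\<in>carrier H. \<forall>y\<in>carrier H. \<forall>z\<in>carrier H.
        hmul K H (\<alpha>\<^bsub>H\<^esub> x) (hmul K H y z) = hmul K H (hmul K H x y) (\<alpha>\<^bsub>H\<^esub> z)) \<and>
     (\<forall>x\<in>carrier H.
        reassoc K H H H (tensor_map K H H (tensor K H H) H \<Delta>\<^bsub>H\<^esub> \<alpha>\<^bsub>H\<^esub> (\<Delta>\<^bsub>H\<^esub> x)) =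
        tensor_map K H H H (tensor K H H) \<alpha>\<^bsub>H\<^esub> \<Delta>\<^bsub>H\<^esub> (\<Delta>\<^bsub>H\<^esub> x)) \<and>
     (\<forall>x\<in>carrier H. \<forall>y\<in>carrier H.
        \<Delta>\<^bsub>H\<^esub> (hmul K H x y) =
        sweedler (tensor K H H) (\<Delta>\<^bsub>H\<^esub> x) (\<lambda>x1 x2.
          sweedler (tensor K H H) (\<Delta>\<^bsub>H\<^esub> y) (\<lambda>y1 y2.
            pure K H H (hmul K H x1 y1) (hmul K H x2 y2)))) \<and>
     (\<forall>x\<in>carrier H. \<Delta>\<^bsub>H\<^esub> (\<alpha>\<^bsub>H\<^esub> x) = tensor_map K H H H H \<alpha>\<^bsub>H\<^esub> \<alpha>\<^bsub>H\<^esub> (\<Delta>\<^bsub>H\<^esub> x))"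

definition left_module ::
  "('k, 'r) ring_scheme \<Rightarrow> ('k, 'a) hom_bialg \<Rightarrow> ('k, 'a) yd \<Rightarrow> bool" where
  "left_module K H M \<longleftrightarrow>
     module K M \<and> \<alpha>\<^bsub>M\<^esub> \<in> linear_maps K M M \<and>
     action M \<in> linear_maps K (tensor K H M) M \<and>
     (\<forall>h\<in>carrier H. \<forall>m\<in>carrier M. \<alpha>\<^bsub>M\<^esub> (act K H M h m) = act K H M (\<alpha>\<^bsub>H\<^esub> h) (\<alpha>\<^bsub>M\<^esub> m)) \<and>
     (\<forall>h\<in>carrier H. \<forall>h'\<in>carrier H. \<forall>m\<in>carrier M.
        act K H M (\<alpha>\<^bsub>H\<^esub> h) (act K H M h' m) = act K H M (hmul K H h h') (\<alpha>\<^bsub>M\<^esub> m))"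

definition left_comodule ::
  "('k, 'r) ring_scheme \<Rightarrow> ('k, 'a) hom_bialg \<Rightarrow> ('k, 'a) yd \<Rightarrow> bool" where
  "left_comodule K H M \<longleftrightarrow>
     module K M \<and> \<alpha>\<^bsub>M\<^esub> \<in> linear_maps K M M \<and>
     \<lambda>c\<^bsub>M\<^esub> \<in> linear_maps K M (tensor K H M) \<and>
     (\<forall>m\<in>carrier M. tensor_map K H M H M \<alpha>\<^bsub>H\<^esub> \<alpha>\<^bsub>M\<^esub> (\<lambda>c\<^bsub>M\<^esub> m) = \<lambda>c\<^bsub>M\<^esub> (\<alpha>\<^bsub>M\<^esub> m)) \<and>
     (\<forall>m\<in>carrier M.
        reassoc K H H M (tensor_map K H M (tensor K H H) M \<Delta>\<^bsub>H\<^esub> \<alpha>\<^bsub>M\<^esub> (\<lambda>c\<^bsub>M\<^esub> m)) =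
        tensor_map K H M H (tensor K H M) \<alpha>\<^bsub>H\<^esub> \<lambda>c\<^bsub>M\<^esub> (\<lambda>c\<^bsub>M\<^esub> m))"

definition yetter_drinfeld_module ::
  "('k, 'r) ring_scheme \<Rightarrow> ('k, 'a) hom_bialg \<Rightarrow> ('k, 'a) yd \<Rightarrow> bool" where
  "yetter_drinfeld_module K H M \<longleftrightarrow>
     left_module K H M \<and> left_comodule K H M \<and>
     (\<forall>h\<in>carrier H. \<forall>m\<in>carrier M.
        sweedler (tensor K H M) (\<Delta>\<^bsub>H\<^esub> h) (\<lambda>h1 h2.
          sweedler (tensor K H M) (\<lambda>c\<^bsub>M\<^esub> (act K H M h1 m)) (\<lambda>n' n0.
            pure K H M (hmul K H n' (\<alpha>\<^bsub>H\<^esub> (\<alpha>\<^bsub>H\<^esub> h2))) n0)) =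
        sweedler (tensor K H M) (\<Delta>\<^bsub>H\<^esub> h) (\<lambda>h1 h2.
          sweedler (tensor K H M) (\<lambda>c\<^bsub>M\<^esub> m) (\<lambda>m' m0.
            pure K H M (hmul K H (\<alpha>\<^bsub>H\<^esub> (\<alpha>\<^bsub>H\<^esub> h1)) (\<alpha>\<^bsub>H\<^esub> m')) (act K H M (\<alpha>\<^bsub>H\<^esub> h2) m0))))"

definition module_morphism ::
  "('k, 'r) ring_scheme \<Rightarrow> ('k, 'a) hom_bialg \<Rightarrow> ('k, 'a) yd \<Rightarrow> ('k, 'a) yd
    \<Rightarrow> ('a univ \<Rightarrow> 'a univ) \<Rightarrow> bool" where
  "module_morphism K H M N f \<longleftrightarrow>
     f \<in> linear_maps K M N \<and>
     (\<forall>m\<in>carrier M. \<alpha>\<^bsub>N\<^esub> (f m) = f (\<alpha>\<^bsub>M\<^esub> m)) \<and>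
     (\<forall>h\<in>carrier H. \<forall>m\<in>carrier M. f (act K H M h m) = act K H N h (f m))"

definition comodule_morphism ::
  "('k, 'r) ring_scheme \<Rightarrow> ('k, 'a) hom_bialg \<Rightarrow> ('k, 'a) yd \<Rightarrow> ('k, 'a) yd
    \<Rightarrow> ('a univ \<Rightarrow> 'a univ) \<Rightarrow> bool" where
  "comodule_morphism K H M N f \<longleftrightarrow>
     f \<in> linear_maps K M N \<and>
     (\<forall>m\<in>carrier M. \<alpha>\<^bsub>N\<^esub> (f m) = f (\<alpha>\<^bsub>M\<^esub> m)) \<and>
     (\<forall>m\<in>carrier M. tensor_map K H M H N id f (\<lambda>c\<^bsub>M\<^esub> m) = \<lambda>c\<^bsub>N\<^esub> (f m))"


section \<open>The category of Yetter-Drinfeld modules and its structure\<close>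

datatype ('o, 'f) arrow = Arrow (src: 'o) (fn: 'f) (tgt: 'o)

type_synonym ('k, 'a) yd_arrow = "(('k, 'a) yd, 'a univ \<Rightarrow> 'a univ) arrow"

definition yd_Ob :: "('k, 'r) ring_scheme \<Rightarrow> ('k, 'a) hom_bialg \<Rightarrow> ('k, 'a) yd set" where
  "yd_Ob K H = {M. yetter_drinfeld_module K H M \<and> bij_betw \<alpha>\<^bsub>M\<^esub> (carrier M) (carrier M)}"

definition yd_Hom ::
  "('k, 'r) ring_scheme \<Rightarrow> ('k, 'a) hom_bialg \<Rightarrow> ('k, 'a) yd \<Rightarrow> ('k, 'a) yd
    \<Rightarrow> ('k, 'a) yd_arrow set" where
  "yd_Hom K H M N = {Arrow M f N |f. module_morphism K H M N f \<and> comodule_morphism K H M N f}"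

definition yd_comp :: "('k, 'a) yd_arrow \<Rightarrow> ('k, 'a) yd_arrow \<Rightarrow> ('k, 'a) yd_arrow" where
  "yd_comp g f = Arrow (src f) (compose (carrier (src f)) (fn g) (fn f)) (tgt g)"

definition yd_id :: "('k, 'a) yd \<Rightarrow> ('k, 'a) yd_arrow" where
  "yd_id M = Arrow M (\<lambda>m\<in>carrier M. m) M"

abbreviation twist_inv :: "('k, 'a, 's) hom_space_scheme \<Rightarrow> 'a univ \<Rightarrow> 'a univ"
  (\<open>\<alpha>inv\<index>\<close>) where
  "twist_inv M \<equiv> inv_into (carrier M) (twist M)"

definition yd_tensor ::
  "('k, 'r) ring_scheme \<Rightarrow> ('k, 'a) hom_bialg \<Rightarrow> ('k, 'a) yd \<Rightarrow> ('k, 'a) yd \<Rightarrow> ('k, 'a) yd" where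
  "yd_tensor K H M N =
     (let MN = tensor K M N; HMN = tensor K H MN in
      \<lparr>carrier = carrier MN, mult = mult MN, one = one MN,
         zero = zero MN, add = add MN, smult = smult MN,
         twist = tensor_map K M N M N \<alpha>\<^bsub>M\<^esub> \<alpha>\<^bsub>N\<^esub>,
         action = lin_ext K H MN MN (\<lambda>h t.
           sweedler MN t (\<lambda>m n.
             sweedler MN (\<Delta>\<^bsub>H\<^esub> h) (\<lambda>h1 h2.
               pure K M N (act K H M h1 m) (act K H N h2 n)))),
         coaction = lin_ext K M N HMN (\<lambda>m n.
           sweedler HMN (\<lambda>c\<^bsub>M\<^esub> m) (\<lambda>m' m0.
             sweedler HMN (\<lambda>c\<^bsub>N\<^esub> n) (\<lambda>n' n0.
               pure K H MN (\<alpha>inv\<^bsub>H\<^esub> (\<alpha>inv\<^bsub>H\<^esub> (hmul K H m' n'))) (pure K M N m0 n0))))\<rparr>)"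

definition yd_tensor_arrow ::
  "('k, 'r) ring_scheme \<Rightarrow> ('k, 'a) hom_bialg
    \<Rightarrow> ('k, 'a) yd_arrow \<Rightarrow> ('k, 'a) yd_arrow \<Rightarrow> ('k, 'a) yd_arrow" where
  "yd_tensor_arrow K H f g =
     Arrow (yd_tensor K H (src f) (src g))
       (tensor_map K (src f) (src g) (tgt f) (tgt g) (fn f) (fn g))
       (yd_tensor K H (tgt f) (tgt g))"

definition yd_assoc ::
  "('k, 'r) ring_scheme \<Rightarrow> ('k, 'a) hom_bialg \<Rightarrow> ('k, 'a) yd \<Rightarrow> ('k, 'a) yd \<Rightarrow> ('k, 'a) yd
    \<Rightarrow> ('k, 'a) yd_arrow" where
  "yd_assoc K H M N P =
     (let MN = yd_tensor K H M N; NP = yd_tensor K H N P; X = yd_tensor K H M NP in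
      Arrow (yd_tensor K H MN P)
        (lin_ext K MN P X (\<lambda>t p. sweedler X t (\<lambda>m n.
           pure K M NP (\<alpha>inv\<^bsub>M\<^esub> m) (pure K N P n (\<alpha>\<^bsub>P\<^esub> p)))))
        X)"

definition yd_braid ::
  "('k, 'r) ring_scheme \<Rightarrow> ('k, 'a) hom_bialg \<Rightarrow> ('k, 'a) yd \<Rightarrow> ('k, 'a) yd
    \<Rightarrow> ('k, 'a) yd_arrow" where
  "yd_braid K H M N =
     (let NM = yd_tensor K H N M in
      Arrow (yd_tensor K H M N)
        (lin_ext K M N NM (\<lambda>m n. sweedler NM (\<lambda>c\<^bsub>M\<^esub> m) (\<lambda>m' m0.
           pure K N M (\<alpha>inv\<^bsub>N\<^esub> (act K H N (\<alpha>inv\<^bsub>H\<^esub> m') n)) (\<alpha>inv\<^bsub>M\<^esub> m0))))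
        NM)"

end

(*
  Since the twist of H is bijective, one twist can be stripped from each structure map: with
    x * y = \<alpha>^-1(xy),  D(x) = \<Delta>(\<alpha>^-1(x)),  h . m = \<alpha>^-1(h \<cdot> m),  L(m) = \<lambda>(\<alpha>^-1(m))
  H becomes an ordinary bialgebra with automorphism \<alpha>, and a Hom-Yetter-Drinfeld module becomes an
  ordinary Yetter-Drinfeld module with an equivariant automorphism.  In these terms h acts on
  m (x) n as \<alpha>(h_1) . m (x) \<alpha>(h_2) . n, the coaction multiplies \<alpha>^-1(m_(-1)) and \<alpha>^-1(n_(-1)), and the
  quasi-braiding is the classical m (x) n |-> m_(-1) . n (x) m_(0).  All axioms then reduce to the
  classical computations, in which the twists cancel by equivariance.
*)

theory Submission
  imports Defs
begin

section \<open>Tensor products of modules\<close>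

text \<open>One twist per structure map is the right amount because each Hom-axiom is homogeneous in
  \<alpha>: after the substitution both sides carry the same power of \<alpha> on corresponding
  factors, and bijectivity cancels it. The tensor product does not become classical in this way,
  since a nested product puts different powers of \<alpha> on its factors for the two bracketings;
  the associativity constraint makes up for exactly this difference. The formal obstacle is Sweedler
  notation. A tensor is a chosen formal sum, and a sum over it is meaningful only for bilinear
  summands, so every rewriting of a sum has linearity premises. The sums \<open>tsum\<close>
  therefore record the two factors, their congruence rule supplies membership of the bound legs, and
  the linearity rules have a form that the simplifier can apply by descending through a term. Longer
  calculations remain only where sums trade places or where coassociativity or the Yetter-Drinfeld
  condition has to be placed.\<close>

locale scalars =
  fixes K :: "('k, 'r) ring_scheme"
begin

abbreviation tensor_space (infixr \<open>\<boxtimes>\<close> 75) where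
  "V \<boxtimes> W \<equiv> tensor K V W"

abbreviation formal_sums where
  "formal_sums V W \<equiv> lists (carrier V \<times> carrier W)"

abbreviation scale_left where
  "scale_left V r \<equiv> map (\<lambda>(x, y). (r \<odot>\<^bsub>V\<^esub> x, y))"

section \<open>Formal sums, their classes and the operations on classes\<close>

lemma tensor_rel_formal_sums:
  assumes "module K V" "module K W" "tensor_rel K V W s t"
  shows "s \<in> formal_sums V W \<and> t \<in> formal_sums V W"
proof -
  interpret V: module K V by fact
  interpret W: module K W by fact
  show ?thesis using assms(3)
    by (induction rule: tensor_rel.induct) auto
qed

text \<open>Related sums have the same set of related sums, by symmetry and transitivity, and a
  class is the choice made from that set.\<close>

lemma tensor_class_cong:
  assumes "tensor_rel K V W s t"
  shows "tensor_class K V W s = tensor_class K V W t"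
proof -
  have "tensor_rel K V W s = tensor_rel K V W t"
    using assms by (auto intro!: ext intro: tensor_rel.sym tensor_rel.trans)
  then show ?thesis
    by (simp add: tensor_class_def)
qed

text \<open>Reflexivity provides the witness for the choice. Through this fact an operation defined
  on chosen representatives can be computed on any representative.\<close>

lemma tensor_rel_summands:
  assumes "s \<in> formal_sums V W"
  shows "tensor_rel K V W s (summands (tensor_class K V W s))"
  unfolding tensor_class_def summands.simps
  by (rule someI) (rule tensor_rel.refl[OF assms])

lemma tensor_class_summands:
  assumes "t \<in> carrier (V \<boxtimes> W)"
  shows "tensor_class K V W (summands t) = t"
  using assms by (auto simp: tensor_def intro: tensor_class_cong tensor_rel_summands tensor_rel.sym)

lemma summands_formal_sums:
  assumes "module K V" "module K W" "t \<in> carrier (V \<boxtimes> W)"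
  shows "summands t \<in> formal_sums V W"
  using assms tensor_rel_formal_sums[OF assms(1,2) tensor_rel_summands]
  by (auto simp: tensor_def)

lemma tensor_class_closed [simp]:
  "s \<in> formal_sums V W \<Longrightarrow> tensor_class K V W s \<in> carrier (V \<boxtimes> W)"
  by (simp add: tensor_def)

lemma tensor_cases:
  assumes "module K V" "module K W" "t \<in> carrier (V \<boxtimes> W)"
  obtains s where "s \<in> formal_sums V W" "t = tensor_class K V W s"
  using assms summands_formal_sums tensor_class_summands by metis

lemma tensor_add_class:
  assumes "s \<in> formal_sums V W" "t \<in> formal_sums V W"
  shows "tensor_class K V W s \<oplus>\<^bsub>V \<boxtimes> W\<^esub> tensor_class K V W t = tensor_class K V W (s @ t)"
  using assms
  by (auto simp: tensor_def intro!: tensor_class_cong tensor_rel.append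
      intro: tensor_rel.sym tensor_rel_summands)

lemma scale_left_formal_sums:
  assumes "module K V" "s \<in> formal_sums V W" "r \<in> carrier K"
  shows "scale_left V r s \<in> formal_sums V W"
  using assms by (fastforce simp: module.smult_closed)

text \<open>Induction over the generating rules of the congruence. The one rule with a second scalar
  is \<open>balanced\<close>, where commutativity of \<open>K\<close> lets the two scalars trade
  places.\<close>

lemma tensor_rel_scale_left:
  assumes "module K V" "module K W" "r \<in> carrier K" "tensor_rel K V W s t"
  shows "tensor_rel K V W (scale_left V r s) (scale_left V r t)"
proof -
  interpret V: module K V by fact
  interpret W: module K W by fact
  show ?thesis using assms(4)
  proof (induction rule: tensor_rel.induct)
    case (refl s)
    show ?case
      by (rule tensor_rel.refl) (rule scale_left_formal_sums[OF assms(1) refl assms(3)])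
  next
    case (sym s t)
    then show ?case by (rule_tac tensor_rel.sym)
  next
    case (trans s t u)
    then show ?case by (rule_tac tensor_rel.trans)
  next
    case (append s s' t t')
    then show ?case by (simp add: tensor_rel.append)
  next
    case (commute s t)
    then show ?case
      unfolding map_append
      by (intro tensor_rel.commute scale_left_formal_sums[OF assms(1) _ assms(3)])
  next
    case (zero y)
    then show ?case using assms(3) by (simp add: tensor_rel.zero)
  next
    case (add_left x x' y)
    then show ?case using assms(3) by (simp add: V.smult_r_distr tensor_rel.add_left)
  next
    case (add_right x y y')
    then show ?case using assms(3) by (simp add: tensor_rel.add_right)
  next
    case (balanced q x y)
    have "r \<odot>\<^bsub>V\<^esub> (q \<odot>\<^bsub>V\<^esub> x) = q \<odot>\<^bsub>V\<^esub> (r \<odot>\<^bsub>V\<^esub> x)"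
      using balanced assms(3) by (simp add: V.smult_assoc1[symmetric] V.R.m_comm)
    then show ?case using balanced assms(3) by (simp add: tensor_rel.balanced)
  qed
qed

lemma tensor_smult_class:
  assumes "module K V" "module K W" "r \<in> carrier K" "s \<in> formal_sums V W"
  shows "r \<odot>\<^bsub>V \<boxtimes> W\<^esub> tensor_class K V W s = tensor_class K V W (scale_left V r s)"
  using assms
  by (auto simp: tensor_def intro!: tensor_class_cong tensor_rel_scale_left
      intro: tensor_rel.sym tensor_rel_summands)

lemma tensor_zero: "\<zero>\<^bsub>V \<boxtimes> W\<^esub> = tensor_class K V W []"
  by (simp add: tensor_def)

section \<open>Vector space axioms for the tensor product\<close>

lemma tensor_rel_scale_left_add:
  assumes "module K V" "module K W" "p \<in> carrier K" "q \<in> carrier K" "s \<in> formal_sums V W"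
  shows "tensor_rel K V W (scale_left V (p \<oplus>\<^bsub>K\<^esub> q) s) (scale_left V p s @ scale_left V q s)"
proof -
  interpret V: module K V by fact
  interpret W: module K W by fact
  show ?thesis using assms(5)
  proof (induction s)
    case Nil
    then show ?case by (simp add: tensor_rel.refl)
  next
    case (Cons a s)
    obtain x y where a: "a = (x, y)" by force
    have xy: "x \<in> carrier V" "y \<in> carrier W" and s: "s \<in> formal_sums V W"
      using Cons.hyps by (auto simp: a)
    let ?p = "scale_left V p s" and ?q = "scale_left V q s"
    have ps: "?p \<in> formal_sums V W" and qs: "?q \<in> formal_sums V W"
      using scale_left_formal_sums assms s by blast+
    have "tensor_rel K V W [((p \<oplus>\<^bsub>K\<^esub> q) \<odot>\<^bsub>V\<^esub> x, y)] [(p \<odot>\<^bsub>V\<^esub> x, y), (q \<odot>\<^bsub>V\<^esub> x, y)]"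
      using xy assms by (simp add: V.smult_l_distr tensor_rel.add_left)
    then have "tensor_rel K V W ([((p \<oplus>\<^bsub>K\<^esub> q) \<odot>\<^bsub>V\<^esub> x, y)] @ scale_left V (p \<oplus>\<^bsub>K\<^esub> q) s)
        ([(p \<odot>\<^bsub>V\<^esub> x, y), (q \<odot>\<^bsub>V\<^esub> x, y)] @ (?p @ ?q))"
      using Cons s by (blast intro: tensor_rel.append)
    \<comment> \<open>The head contributes its two terms side by side, while the goal has one in
      front of each block; \<open>commute\<close> carries the second past the block scaled by
      \<open>p\<close>.\<close>
    moreover have "tensor_rel K V W ([(p \<odot>\<^bsub>V\<^esub> x, y)] @ ([(q \<odot>\<^bsub>V\<^esub> x, y)] @ ?p) @ ?q)
        ([(p \<odot>\<^bsub>V\<^esub> x, y)] @ (?p @ [(q \<odot>\<^bsub>V\<^esub> x, y)]) @ ?q)"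
      by (intro tensor_rel.append tensor_rel.commute tensor_rel.refl)
        (use xy assms s ps qs in \<open>auto simp del: in_lists_conv_set\<close>)
    ultimately show ?case
      by (simp add: a) (blast intro: tensor_rel.trans)
  qed
qed

lemma module_tensor [simp]:
  assumes "module K V" "module K W"
  shows "module K (V \<boxtimes> W)"
proof (rule moduleI)
  interpret V: module K V by fact
  interpret W: module K W by fact
  note * = tensor_add_class tensor_smult_class[OF assms] tensor_zero
    scale_left_formal_sums[OF assms(1)]
  show "cring K" by (rule V.R.is_cring)
  show "abelian_group (V \<boxtimes> W)"
  proof (rule abelian_groupI)
    show "\<zero>\<^bsub>V \<boxtimes> W\<^esub> \<in> carrier (V \<boxtimes> W)" by (simp add: tensor_zero)
    fix a assume "a \<in> carrier (V \<boxtimes> W)"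
    then obtain s where s: "s \<in> formal_sums V W" "a = tensor_class K V W s"
      by (rule tensor_cases[OF assms])
    show "\<zero>\<^bsub>V \<boxtimes> W\<^esub> \<oplus>\<^bsub>V \<boxtimes> W\<^esub> a = a" using s by (simp add: *)
    show "\<exists>b\<in>carrier (V \<boxtimes> W). b \<oplus>\<^bsub>V \<boxtimes> W\<^esub> a = \<zero>\<^bsub>V \<boxtimes> W\<^esub>"
    proof (rule bexI)
      \<comment> \<open>Scaling by -1 gives the opposite class: added to the original it is scaling
        by -1 + 1 = 0, after which every left entry is zero and the terms vanish by the rule
        \<open>zero\<close>.\<close>
      let ?m = "\<ominus>\<^bsub>K\<^esub> \<one>\<^bsub>K\<^esub>"
      have zero: "tensor_rel K V W (scale_left V \<zero>\<^bsub>K\<^esub> l) []" if "l \<in> formal_sums V W" for l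
        using that
      proof (induction l)
        case (Cons a l)
        obtain x y where a: "a = (x, y)" by force
        have "tensor_rel K V W ([(\<zero>\<^bsub>V\<^esub>, y)] @ scale_left V \<zero>\<^bsub>K\<^esub> l) ([] @ [])"
          using Cons by (intro tensor_rel.append tensor_rel.zero) (auto simp: a)
        then show ?case using Cons by (simp add: a)
      qed (simp add: tensor_rel.refl)
      have id: "scale_left V \<one>\<^bsub>K\<^esub> l = l" if "l \<in> formal_sums V W" for l
        using that by (induction l) auto
      have "tensor_rel K V W (scale_left V (?m \<oplus>\<^bsub>K\<^esub> \<one>\<^bsub>K\<^esub>) s) (scale_left V ?m s @ scale_left V \<one>\<^bsub>K\<^esub> s)"
        by (rule tensor_rel_scale_left_add) (use assms s in auto)
      then have "tensor_rel K V W (scale_left V ?m s @ s) []"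
        using s by (simp add: id V.R.l_neg) (blast intro: tensor_rel.trans tensor_rel.sym zero)
      then show "tensor_class K V W (scale_left V ?m s) \<oplus>\<^bsub>V \<boxtimes> W\<^esub> a = \<zero>\<^bsub>V \<boxtimes> W\<^esub>"
        unfolding s tensor_zero
        by (subst tensor_add_class)
          (use s scale_left_formal_sums[OF assms(1) s(1)] in \<open>auto simp del: in_lists_conv_set intro: tensor_class_cong\<close>)
      show "tensor_class K V W (scale_left V ?m s) \<in> carrier (V \<boxtimes> W)"
        by (rule tensor_class_closed) (use scale_left_formal_sums[OF assms(1) s(1)] in auto)
    qed
    fix b assume "b \<in> carrier (V \<boxtimes> W)"
    then obtain t where t: "t \<in> formal_sums V W" "b = tensor_class K V W t"
      by (rule tensor_cases[OF assms])
    show "a \<oplus>\<^bsub>V \<boxtimes> W\<^esub> b \<in> carrier (V \<boxtimes> W)"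
      unfolding s t using s t by (subst tensor_add_class) auto
    show "a \<oplus>\<^bsub>V \<boxtimes> W\<^esub> b = b \<oplus>\<^bsub>V \<boxtimes> W\<^esub> a"
      using s t by (auto simp: tensor_add_class intro: tensor_class_cong tensor_rel.commute)
    fix c assume "c \<in> carrier (V \<boxtimes> W)"
    then obtain u where u: "u \<in> formal_sums V W" "c = tensor_class K V W u"
      by (rule tensor_cases[OF assms])
    show "(a \<oplus>\<^bsub>V \<boxtimes> W\<^esub> b) \<oplus>\<^bsub>V \<boxtimes> W\<^esub> c = a \<oplus>\<^bsub>V \<boxtimes> W\<^esub> (b \<oplus>\<^bsub>V \<boxtimes> W\<^esub> c)"
      using s t u by (simp add: tensor_add_class)
  qed
  show "\<one>\<^bsub>K\<^esub> \<odot>\<^bsub>V \<boxtimes> W\<^esub> x = x" if x: "x \<in> carrier (V \<boxtimes> W)" for x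
  proof -
    obtain s where s: "s \<in> formal_sums V W" "x = tensor_class K V W s"
      by (rule tensor_cases[OF assms x])
    have "scale_left V \<one>\<^bsub>K\<^esub> s = s" using s(1) by (induction s) auto
    then show ?thesis using s by (simp add: tensor_smult_class[OF assms])
  qed
  fix p x assume p: "p \<in> carrier K" and "x \<in> carrier (V \<boxtimes> W)"
  then obtain s where s: "s \<in> formal_sums V W" "x = tensor_class K V W s"
    by (metis tensor_cases[OF assms])
  have ps: "scale_left V r s \<in> formal_sums V W" if "r \<in> carrier K" for r
    using scale_left_formal_sums[OF assms(1) s(1) that] .
  show "p \<odot>\<^bsub>V \<boxtimes> W\<^esub> x \<in> carrier (V \<boxtimes> W)"
    using s p ps by (simp only: tensor_smult_class[OF assms] tensor_class_closed)
  {
    fix q assume q: "q \<in> carrier K"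
    show "(p \<oplus>\<^bsub>K\<^esub> q) \<odot>\<^bsub>V \<boxtimes> W\<^esub> x = p \<odot>\<^bsub>V \<boxtimes> W\<^esub> x \<oplus>\<^bsub>V \<boxtimes> W\<^esub> q \<odot>\<^bsub>V \<boxtimes> W\<^esub> x"
      using p q s ps V.R.add.m_closed[OF p q]
      by (simp only: tensor_smult_class[OF assms] tensor_add_class)
        (intro tensor_class_cong tensor_rel_scale_left_add assms)
    have "scale_left V (p \<otimes>\<^bsub>K\<^esub> q) s = scale_left V p (scale_left V q s)"
      using s(1) p q by (induction s) (auto simp: V.smult_assoc1)
    then show "(p \<otimes>\<^bsub>K\<^esub> q) \<odot>\<^bsub>V \<boxtimes> W\<^esub> x = p \<odot>\<^bsub>V \<boxtimes> W\<^esub> (q \<odot>\<^bsub>V \<boxtimes> W\<^esub> x)"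
      using p q s ps by (simp only: tensor_smult_class[OF assms] V.R.m_closed)
  }
  fix y assume "y \<in> carrier (V \<boxtimes> W)"
  then obtain t where t: "t \<in> formal_sums V W" "y = tensor_class K V W t"
    by (metis tensor_cases[OF assms])
  show "p \<odot>\<^bsub>V \<boxtimes> W\<^esub> (x \<oplus>\<^bsub>V \<boxtimes> W\<^esub> y) = p \<odot>\<^bsub>V \<boxtimes> W\<^esub> x \<oplus>\<^bsub>V \<boxtimes> W\<^esub> p \<odot>\<^bsub>V \<boxtimes> W\<^esub> y"
    using p s t ps scale_left_formal_sums[OF assms(1) t(1) p]
    by (simp only: tensor_smult_class[OF assms] tensor_add_class append_in_lists_conv map_append)
qed

end

section \<open>Linear maps and sums over tensors\<close>

declare in_listsD [rule del] in_listsI [rule del] in_lists_conv_set [simp del] foldr_append [simp del]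

context scalars
begin

text \<open>Unlike \<open>linear_maps\<close> it asks for no extensionality, so that it applies to
  functions given by lambda terms. The module conditions are included so that a linearity fact also
  supplies them.\<close>

definition lin :: "('k, 'v, 's) module_scheme \<Rightarrow> ('k, 'w, 't) module_scheme \<Rightarrow> ('v \<Rightarrow> 'w) \<Rightarrow> bool" where
  "lin V W f \<longleftrightarrow> module K V \<and> module K W \<and>
     (\<forall>x\<in>carrier V. f x \<in> carrier W) \<and>
     (\<forall>x\<in>carrier V. \<forall>y\<in>carrier V. f (x \<oplus>\<^bsub>V\<^esub> y) = f x \<oplus>\<^bsub>W\<^esub> f y) \<and>
     (\<forall>r\<in>carrier K. \<forall>x\<in>carrier V. f (r \<odot>\<^bsub>V\<^esub> x) = r \<odot>\<^bsub>W\<^esub> f x)"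

definition bilin :: "('k, 'u, 's) module_scheme \<Rightarrow> ('k, 'v, 't) module_scheme \<Rightarrow> ('k, 'w, 'x) module_scheme
    \<Rightarrow> ('u \<Rightarrow> 'v \<Rightarrow> 'w) \<Rightarrow> bool" where
  "bilin U V W \<beta> \<longleftrightarrow> module K U \<and> module K V \<and> module K W \<and>
     (\<forall>y\<in>carrier V. lin U W (\<lambda>x. \<beta> x y)) \<and> (\<forall>x\<in>carrier U. lin V W (\<beta> x))"

definition trilin :: "('k, 'u, 's) module_scheme \<Rightarrow> ('k, 'v, 't) module_scheme \<Rightarrow> ('k, 'w, 'x) module_scheme
    \<Rightarrow> ('k, 'z, 'y) module_scheme \<Rightarrow> ('u \<Rightarrow> 'v \<Rightarrow> 'w \<Rightarrow> 'z) \<Rightarrow> bool" where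
  "trilin U V W X \<beta> \<longleftrightarrow> module K U \<and> module K V \<and> module K W \<and> module K X \<and>
     (\<forall>y\<in>carrier V. \<forall>z\<in>carrier W. lin U X (\<lambda>x. \<beta> x y z)) \<and>
     (\<forall>x\<in>carrier U. \<forall>z\<in>carrier W. lin V X (\<lambda>y. \<beta> x y z)) \<and>
     (\<forall>x\<in>carrier U. \<forall>y\<in>carrier V. lin W X (\<beta> x y))"

text \<open>Off the tensor product \<open>tsum\<close> is zero, so that its congruence rule, its linearity in
  \<open>\<beta>\<close> and the exchange of two sums need no side condition on \<open>t\<close>.\<close>

definition tsum :: "('k, 'a univ, 's) module_scheme \<Rightarrow> ('k, 'a univ, 't) module_scheme
    \<Rightarrow> ('k, 'b, 'x) module_scheme \<Rightarrow> 'a univ \<Rightarrow> ('a univ \<Rightarrow> 'a univ \<Rightarrow> 'b) \<Rightarrow> 'b" where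
  "tsum V W X t \<beta> = (if module K V \<and> module K W \<and> t \<in> carrier (V \<boxtimes> W) then sweedler X t \<beta> else \<zero>\<^bsub>X\<^esub>)"

abbreviation fsum :: "('k, 'b, 'x) module_scheme \<Rightarrow> ('u \<Rightarrow> 'v \<Rightarrow> 'b) \<Rightarrow> ('u \<times> 'v) list \<Rightarrow> 'b" where
  "fsum X \<beta> s \<equiv> foldr (\<lambda>(x, y) z. \<beta> x y \<oplus>\<^bsub>X\<^esub> z) s \<zero>\<^bsub>X\<^esub>"

lemma lin_cong [cong]:
  assumes "\<And>x. x \<in> carrier V \<Longrightarrow> f x = g x"
  shows "lin V W f = lin V W g"
proof (cases "module K V")
  case True
  then interpret V: module K V .
  show ?thesis using assms by (auto simp: lin_def)
qed (simp add: lin_def)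

lemma lin_module: "lin V W f \<Longrightarrow> module K V" "lin V W f \<Longrightarrow> module K W"
  by (simp_all add: lin_def)

lemma lin_closed: "lin V W f \<Longrightarrow> x \<in> carrier V \<Longrightarrow> f x \<in> carrier W"
  by (simp add: lin_def)

lemma lin_add: "lin V W f \<Longrightarrow> x \<in> carrier V \<Longrightarrow> y \<in> carrier V \<Longrightarrow> f (x \<oplus>\<^bsub>V\<^esub> y) = f x \<oplus>\<^bsub>W\<^esub> f y"
  by (simp add: lin_def)

lemma lin_smult: "lin V W f \<Longrightarrow> r \<in> carrier K \<Longrightarrow> x \<in> carrier V \<Longrightarrow> f (r \<odot>\<^bsub>V\<^esub> x) = r \<odot>\<^bsub>W\<^esub> f x"
  by (simp add: lin_def)

lemma lin_zero:
  assumes "lin V W f"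
  shows "f \<zero>\<^bsub>V\<^esub> = \<zero>\<^bsub>W\<^esub>"
proof -
  interpret V: module K V using assms by (rule lin_module)
  interpret W: module K W using assms by (rule lin_module)
  have "f (\<zero>\<^bsub>K\<^esub> \<odot>\<^bsub>V\<^esub> \<zero>\<^bsub>V\<^esub>) = \<zero>\<^bsub>K\<^esub> \<odot>\<^bsub>W\<^esub> f \<zero>\<^bsub>V\<^esub>"
    by (rule lin_smult[OF assms]) auto
  then show ?thesis using lin_closed[OF assms] by simp
qed

lemma lin_compose: "lin V W f \<Longrightarrow> lin U V g \<Longrightarrow> lin U W (\<lambda>x. f (g x))"
  by (simp add: lin_def)

lemma lin_id [simp]: "module K V \<Longrightarrow> lin V V (\<lambda>x. x)"
  by (simp add: lin_def)

lemma bilinI [simp]: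
  assumes "module K U" "module K V" "module K W"
    "\<And>y. y \<in> carrier V \<Longrightarrow> lin U W (\<lambda>x. \<beta> x y)" "\<And>x. x \<in> carrier U \<Longrightarrow> lin V W (\<beta> x)"
  shows "bilin U V W \<beta>"
  using assms by (simp add: bilin_def)

lemma trilinI [simp]:
  assumes "module K U" "module K V" "module K W" "module K X"
    "\<And>y z. y \<in> carrier V \<Longrightarrow> z \<in> carrier W \<Longrightarrow> lin U X (\<lambda>x. \<beta> x y z)"
    "\<And>x z. x \<in> carrier U \<Longrightarrow> z \<in> carrier W \<Longrightarrow> lin V X (\<lambda>y. \<beta> x y z)"
    "\<And>x y. x \<in> carrier U \<Longrightarrow> y \<in> carrier V \<Longrightarrow> lin W X (\<beta> x y)"
  shows "trilin U V W X \<beta>"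
  using assms by (simp add: trilin_def)

lemma bilin_left: "bilin U V W \<beta> \<Longrightarrow> y \<in> carrier V \<Longrightarrow> lin U W (\<lambda>x. \<beta> x y)"
  by (simp add: bilin_def)

lemma bilin_right: "bilin U V W \<beta> \<Longrightarrow> x \<in> carrier U \<Longrightarrow> lin V W (\<beta> x)"
  by (simp add: bilin_def)

lemma bilin_closed: "bilin U V W \<beta> \<Longrightarrow> x \<in> carrier U \<Longrightarrow> y \<in> carrier V \<Longrightarrow> \<beta> x y \<in> carrier W"
  by (rule lin_closed[OF bilin_right])

section \<open>Sums along formal sums and along tensors\<close>

lemma fsum_closed:
  assumes "module K X" "s \<in> formal_sums V W"
    "\<And>x y. x \<in> carrier V \<Longrightarrow> y \<in> carrier W \<Longrightarrow> \<beta> x y \<in> carrier X"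
  shows "fsum X \<beta> s \<in> carrier X"
proof -
  interpret X: module K X by fact
  show ?thesis using assms(2) by induction (auto intro: assms(3))
qed

lemma fsum_append:
  assumes "module K X" "s \<in> formal_sums V W" "t \<in> formal_sums V W"
    "\<And>x y. x \<in> carrier V \<Longrightarrow> y \<in> carrier W \<Longrightarrow> \<beta> x y \<in> carrier X"
  shows "fsum X \<beta> (s @ t) = fsum X \<beta> s \<oplus>\<^bsub>X\<^esub> fsum X \<beta> t"
proof -
  interpret X: module K X by fact
  note closed = fsum_closed[where \<beta>=\<beta>, OF assms(1) _ assms(4)]
  show ?thesis using assms(2)
    by induction (auto simp: closed[OF assms(3)] X.add.m_assoc assms(4) closed)
qed

text \<open>The universal property of the tensor product: each generating relation turns into an
  identity satisfied by a bilinear \<open>\<beta>\<close>, so the sum depends only on the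
  class.\<close>

lemma fsum_rel:
  assumes "bilin V W X \<beta>" "tensor_rel K V W s t"
  shows "fsum X \<beta> s = fsum X \<beta> t"
proof -
  have mods: "module K V" "module K W" "module K X"
    using assms(1) by (simp_all add: bilin_def)
  interpret V: module K V by fact
  interpret W: module K W by fact
  interpret X: module K X by fact
  note closed = bilin_closed[OF assms(1)]
  note fs = tensor_rel_formal_sums[OF mods(1,2)]
  note app = fsum_append[where V=V and W=W and \<beta>=\<beta>, OF mods(3) _ _ closed]
  note l = bilin_left[OF assms(1)] and r = bilin_right[OF assms(1)]
  show ?thesis using assms(2)
  proof induction
    case (append s s' t t')
    then show ?case using fs[OF append.hyps(1)] fs[OF append.hyps(2)]
      by (simp add: app)
  next
    case (commute s t)
    then show ?case
      by (simp add: app X.add.m_comm fsum_closed[where V=V and W=W and \<beta>=\<beta>, OF mods(3) _ closed])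
  next
    case (zero y)
    then show ?case using lin_zero[OF l] by simp
  next
    case (add_left x x' y)
    then show ?case using lin_add[OF l] closed by (simp add: X.add.m_assoc)
  next
    case (add_right x y y')
    then show ?case using lin_add[OF r] closed by (simp add: X.add.m_assoc)
  next
    case (balanced a x y)
    then show ?case using lin_smult[OF l] lin_smult[OF r] closed by simp
  qed simp_all
qed

text \<open>Makes Sweedler calculations a matter of rewriting: under the binder the simplifier may
  use that the legs lie in the two factors, and so discharge the premises of the rules for the
  structure maps. The reason is that the chosen representative consists of such pairs.\<close>

lemma tsum_cong [cong]:
  assumes "t = t'" "\<And>x y. x \<in> carrier V \<Longrightarrow> y \<in> carrier W \<Longrightarrow> \<beta> x y = \<gamma> x y"
  shows "tsum V W X t \<beta> = tsum V W X t' \<gamma>"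
proof (cases "module K V \<and> module K W \<and> t \<in> carrier (V \<boxtimes> W)")
  case True
  then have "summands t \<in> formal_sums V W" by (simp add: summands_formal_sums)
  then have "fsum X \<beta> (summands t) = fsum X \<gamma> (summands t)"
    by induction (auto simp: assms(2))
  then show ?thesis using assms(1) by (simp add: tsum_def sweedler_def)
qed (use assms in \<open>auto simp: tsum_def\<close>)

text \<open>The bridge from the definitions to sums with recorded factors. The factors cannot be
  read off the left-hand side and are therefore often given explicitly where the rule is
  used.\<close>

lemma sweedler_eq_tsum:
  assumes "module K V" "module K W" "t \<in> carrier (V \<boxtimes> W)"
  shows "sweedler X t \<beta> = tsum V W X t \<beta>"
  using assms by (simp add: tsum_def)

lemma tsum_closed [simp]:
  assumes "module K X" "\<And>x y. x \<in> carrier V \<Longrightarrow> y \<in> carrier W \<Longrightarrow> \<beta> x y \<in> carrier X"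
  shows "tsum V W X t \<beta> \<in> carrier X"
proof -
  interpret X: module K X by fact
  show ?thesis
    using fsum_closed[where \<beta>=\<beta>, OF assms(1) summands_formal_sums assms(2)]
    by (auto simp: tsum_def sweedler_def)
qed

lemma tsum_class:
  assumes "bilin V W X \<beta>" "s \<in> formal_sums V W"
  shows "tsum V W X (tensor_class K V W s) \<beta> = fsum X \<beta> s"
  using assms fsum_rel[OF assms(1) tensor_rel_summands[OF assms(2)]]
  by (simp add: tsum_def sweedler_def bilin_def)

section \<open>Pure tensors and the linearity rules\<close>

lemma pure_closed [simp]:
  "x \<in> carrier V \<Longrightarrow> y \<in> carrier W \<Longrightarrow> pure K V W x y \<in> carrier (V \<boxtimes> W)"
  by (simp add: pure_def)

lemma tsum_pure [simp]:
  assumes "x \<in> carrier V" "y \<in> carrier W" "bilin V W X \<beta>"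
  shows "tsum V W X (pure K V W x y) \<beta> = \<beta> x y"
proof -
  interpret X: module K X using assms(3) by (simp add: bilin_def)
  show ?thesis
    using assms bilin_closed[OF assms(3)] by (simp add: pure_def tsum_class)
qed

text \<open>The inner map \<open>f\<close> makes the rule recursive: linearity of a nested
  expression is proved by descending to the position of the variable. The linearity rules for the
  structure maps have the same shape for this reason.\<close>

lemma lin_pure_left [simp]:
  assumes "lin U V f" "y \<in> carrier W" "module K W"
  shows "lin U (V \<boxtimes> W) (\<lambda>x. pure K V W (f x) y)"
proof -
  have V: "module K V" using assms(1) by (rule lin_module)
  then interpret V: module K V .
  have "lin V (V \<boxtimes> W) (\<lambda>x. pure K V W x y)"
    using assms(2,3) V unfolding lin_def
    by (auto simp: pure_def tensor_add_class tensor_smult_class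
        intro!: tensor_class_cong tensor_rel.add_left)
  then show ?thesis using assms(1) by (rule lin_compose)
qed

text \<open>Scalars act on the left entries of a formal sum, so homogeneity in the right entry comes
  from the rule \<open>balanced\<close>.\<close>

lemma lin_pure_right [simp]:
  assumes "lin U W f" "x \<in> carrier V" "module K V"
  shows "lin U (V \<boxtimes> W) (\<lambda>y. pure K V W x (f y))"
proof -
  have W: "module K W" using assms(1) by (rule lin_module)
  then interpret W: module K W .
  have "lin W (V \<boxtimes> W) (\<lambda>y. pure K V W x y)"
    using assms(2,3) W unfolding lin_def
    by (auto simp: pure_def tensor_add_class tensor_smult_class
        intro!: tensor_class_cong intro: tensor_rel.add_right tensor_rel.sym tensor_rel.balanced)
  then show ?thesis using assms(1) by (rule lin_compose)
qed

lemma lin_fsum: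
  assumes "lin X Y f" "s \<in> formal_sums V W"
    "\<And>x y. x \<in> carrier V \<Longrightarrow> y \<in> carrier W \<Longrightarrow> \<beta> x y \<in> carrier X"
  shows "f (fsum X \<beta> s) = fsum Y (\<lambda>x y. f (\<beta> x y)) s"
  using assms(2)
proof induction
  case Nil
  then show ?case by (simp add: lin_zero[OF assms(1)])
next
  case (Cons a s)
  then show ?case
    using lin_add[OF assms(1)] fsum_closed[where V=V and W=W and \<beta>=\<beta>, OF lin_module(1)[OF assms(1)] _ assms(3)]
    by (auto simp: assms(3))
qed

lemma lin_tsum:
  assumes "lin X Y f" "\<And>x y. x \<in> carrier V \<Longrightarrow> y \<in> carrier W \<Longrightarrow> \<beta> x y \<in> carrier X"
  shows "f (tsum V W X t \<beta>) = tsum V W Y t (\<lambda>x y. f (\<beta> x y))"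
  using assms lin_zero[OF assms(1)] lin_fsum[where \<beta>=\<beta>, OF assms(1) summands_formal_sums assms(2)]
  by (auto simp: tsum_def sweedler_def)

text \<open>Linearity in the tensor that is summed over: addition of classes is concatenation of
  sums, and scaling acts on the left entries, in which \<open>\<beta>\<close> is
  homogeneous.\<close>

lemma lin_tsum_arg [simp]:
  assumes "lin U (V \<boxtimes> W) f" "bilin V W X \<beta>"
  shows "lin U X (\<lambda>x. tsum V W X (f x) \<beta>)"
proof -
  have mods: "module K V" "module K W" "module K X" "module K (V \<boxtimes> W)"
    using assms(2) by (simp_all add: bilin_def)
  interpret X: module K X by fact
  note closed = bilin_closed[OF assms(2)]
  have "lin (V \<boxtimes> W) X (\<lambda>t. tsum V W X t \<beta>)"
    unfolding lin_def
  proof (intro conjI ballI mods)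
    fix t assume "t \<in> carrier (V \<boxtimes> W)"
    then obtain s where s: "s \<in> formal_sums V W" "t = tensor_class K V W s"
      by (rule tensor_cases[OF mods(1,2)])
    show "tsum V W X t \<beta> \<in> carrier X" by (simp add: mods closed)
    {
      fix u assume "u \<in> carrier (V \<boxtimes> W)"
      then obtain r where r: "r \<in> formal_sums V W" "u = tensor_class K V W r"
        by (rule tensor_cases[OF mods(1,2)])
      show "tsum V W X (t \<oplus>\<^bsub>V \<boxtimes> W\<^esub> u) \<beta> = tsum V W X t \<beta> \<oplus>\<^bsub>X\<^esub> tsum V W X u \<beta>"
        using s r fsum_append[where V=V and W=W and \<beta>=\<beta>, OF mods(3) s(1) r(1) closed]
        by (simp add: tensor_add_class tsum_class[OF assms(2)])
    }
  next
    fix a t assume a: "a \<in> carrier K" and "t \<in> carrier (V \<boxtimes> W)"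
    then obtain s where s: "s \<in> formal_sums V W" "t = tensor_class K V W s"
      by (blast intro: tensor_cases[OF mods(1,2)])
    have "fsum X \<beta> (scale_left V a s) = a \<odot>\<^bsub>X\<^esub> fsum X \<beta> s"
      using s(1)
    proof induction
      case (Cons p s)
      then show ?case
        using a lin_smult[OF bilin_left[OF assms(2)]] fsum_closed[where V=V and W=W and \<beta>=\<beta>, OF mods(3) _ closed, of s]
        by (auto simp: X.smult_r_distr closed)
    qed (simp add: a)
    then show "tsum V W X (a \<odot>\<^bsub>V \<boxtimes> W\<^esub> t) \<beta> = a \<odot>\<^bsub>X\<^esub> tsum V W X t \<beta>"
      using a s scale_left_formal_sums[OF mods(1) s(1) a]
      by (simp add: tensor_smult_class[OF mods(1,2)] tsum_class[OF assms(2)])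
  qed
  then show ?thesis using assms(1) by (rule lin_compose)
qed

lemma lin_fsum_body:
  assumes "s \<in> formal_sums V W" "module K U" "module K X"
    "\<And>x y. x \<in> carrier V \<Longrightarrow> y \<in> carrier W \<Longrightarrow> lin U X (\<lambda>u. \<beta> u x y)"
  shows "lin U X (\<lambda>u. fsum X (\<beta> u) s)"
  using assms(1)
proof induction
  interpret U: module K U by fact
  interpret X: module K X by fact
  {
    case Nil
    then show ?case by (simp add: lin_def assms(2,3))
  next
    case (Cons p s)
    obtain x y where p: "p = (x, y)" "x \<in> carrier V" "y \<in> carrier W" using Cons by auto
    have "lin U X (\<lambda>u. \<beta> u x y \<oplus>\<^bsub>X\<^esub> fsum X (\<beta> u) s)"
      using assms(4)[OF p(2,3)] Cons.IH
      by (auto simp: lin_def X.smult_r_distr X.add.m_ac)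
    then show ?case by (simp add: p)
  }
qed

text \<open>Complements \<open>lin_tsum_arg\<close>: here the variable sits in the summand and the
  tensor is fixed. If \<open>t\<close> is no tensor, the map is constantly zero.\<close>

lemma lin_tsum_body [simp]:
  assumes "module K U" "module K X"
    "\<And>x y. x \<in> carrier V \<Longrightarrow> y \<in> carrier W \<Longrightarrow> lin U X (\<lambda>u. \<beta> u x y)"
  shows "lin U X (\<lambda>u. tsum V W X t (\<beta> u))"
proof (cases "module K V \<and> module K W \<and> t \<in> carrier (V \<boxtimes> W)")
  case True
  then show ?thesis
    unfolding tsum_def sweedler_def using lin_fsum_body[OF summands_formal_sums, of V W t U X \<beta>] assms
    by auto
next
  case False
  then show ?thesis
    using assms(1,2) module.axioms(2)[OF assms(2)] module.smult_r_null[OF assms(2)]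
    by (auto simp: tsum_def lin_def abelian_group_def abelian_monoid.zero_closed abelian_monoid.l_zero)
qed

section \<open>Nested sums and separation by pure tensors\<close>

lemma pure_tsum_left [simp]:
  assumes "module K A" "module K B" "b \<in> carrier B"
    "\<And>x y. x \<in> carrier V \<Longrightarrow> y \<in> carrier W \<Longrightarrow> \<beta> x y \<in> carrier A"
  shows "pure K A B (tsum V W A t \<beta>) b = tsum V W (A \<boxtimes> B) t (\<lambda>x y. pure K A B (\<beta> x y) b)"
  by (rule lin_tsum) (simp_all add: assms)

lemma pure_tsum_right [simp]:
  assumes "module K A" "module K B" "a \<in> carrier A"
    "\<And>x y. x \<in> carrier V \<Longrightarrow> y \<in> carrier W \<Longrightarrow> \<beta> x y \<in> carrier B"
  shows "pure K A B a (tsum V W B t \<beta>) = tsum V W (A \<boxtimes> B) t (\<lambda>x y. pure K A B a (\<beta> x y))"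
  by (rule lin_tsum) (simp_all add: assms)

text \<open>The outer sum is linear in its tensor, so a sum over a tensor that is itself given as a
  sum flattens into nested sums.\<close>

lemma tsum_tsum [simp]:
  assumes "bilin A B X \<gamma>"
    "\<And>x y. x \<in> carrier V \<Longrightarrow> y \<in> carrier W \<Longrightarrow> \<beta> x y \<in> carrier (A \<boxtimes> B)"
  shows "tsum A B X (tsum V W (A \<boxtimes> B) t \<beta>) \<gamma> = tsum V W X t (\<lambda>x y. tsum A B X (\<beta> x y) \<gamma>)"
proof -
  have "module K A" "module K B" using assms(1) by (simp_all add: bilin_def)
  then show ?thesis
    by (intro lin_tsum[where f="\<lambda>t. tsum A B X t \<gamma>"] assms(2) lin_tsum_arg assms(1) lin_id module_tensor)
qed

text \<open>Every tensor is the sum of its own pure tensors. Read from right to left, this turns a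
  bare tensor into a sum, to which the rules for sums apply.\<close>

lemma tsum_eta:
  assumes "module K V" "module K W" "t \<in> carrier (V \<boxtimes> W)"
  shows "tsum V W (V \<boxtimes> W) t (pure K V W) = t"
proof -
  obtain s where s: "s \<in> formal_sums V W" "t = tensor_class K V W s"
    using assms(3) by (rule tensor_cases[OF assms(1,2)])
  have "fsum (V \<boxtimes> W) (pure K V W) s = tensor_class K V W s"
    using s(1)
    by induction (auto simp: tensor_zero pure_def tensor_add_class)
  then show ?thesis
    using s assms(1,2) by (simp add: tsum_class)
qed

lemma fsum_swap:
  assumes "module K X" "s \<in> formal_sums V W" "t \<in> formal_sums A B"
    "\<And>v w a b. \<lbrakk>v \<in> carrier V; w \<in> carrier W; a \<in> carrier A; b \<in> carrier B\<rbrakk> \<Longrightarrow> \<beta> v w a b \<in> carrier X"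
  shows "fsum X (\<lambda>v w. fsum X (\<beta> v w) t) s = fsum X (\<lambda>a b. fsum X (\<lambda>v w. \<beta> v w a b) s) t"
proof -
  interpret X: module K X by fact
  \<comment> \<open>Needed for an empty outer sum, where the exchanged side is a sum of
    zeros.\<close>
  have zero: "foldr (\<lambda>_ z. \<zero>\<^bsub>X\<^esub> \<oplus>\<^bsub>X\<^esub> z) t \<zero>\<^bsub>X\<^esub> = \<zero>\<^bsub>X\<^esub>" by (induction t) auto
  have add: "fsum X (\<lambda>a b. f a b \<oplus>\<^bsub>X\<^esub> g a b) t = fsum X f t \<oplus>\<^bsub>X\<^esub> fsum X g t"
    if "\<And>a b. a \<in> carrier A \<Longrightarrow> b \<in> carrier B \<Longrightarrow> f a b \<in> carrier X"
      "\<And>a b. a \<in> carrier A \<Longrightarrow> b \<in> carrier B \<Longrightarrow> g a b \<in> carrier X" for f g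
    using assms(3)
  proof induction
    case (Cons p t)
    obtain a b where p: "p = (a, b)" "a \<in> carrier A" "b \<in> carrier B" using Cons by auto
    show ?case
      using Cons fsum_closed[OF assms(1) Cons.hyps(2), of f] that(1)
        fsum_closed[OF assms(1) Cons.hyps(2), of g] that(2) p that
      by (simp add: X.add.m_ac)
  qed simp
  show ?thesis using assms(2)
  proof induction
    case Nil
    show ?case by (simp add: zero)
  next
    case (Cons p s)
    obtain v w where p: "p = (v, w)" "v \<in> carrier V" "w \<in> carrier W" using Cons by auto
    have "fsum X (\<lambda>v w. \<beta> v w a b) s \<in> carrier X" if "a \<in> carrier A" "b \<in> carrier B" for a b
      by (rule fsum_closed[OF assms(1) Cons.hyps(2)]) (simp add: assms(4) that)
    then show ?case using Cons p by (simp add: add assms(4))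
  qed
qed

text \<open>Two finite sums in an abelian group trade places. If one of the tensors is out of range,
  one side is zero and the other is a sum of zeros.\<close>

lemma tsum_swap:
  assumes "module K X"
    "\<And>v w a b. \<lbrakk>v \<in> carrier V; w \<in> carrier W; a \<in> carrier A; b \<in> carrier B\<rbrakk> \<Longrightarrow> \<beta> v w a b \<in> carrier X"
  shows "tsum V W X s (\<lambda>v w. tsum A B X t (\<beta> v w)) = tsum A B X t (\<lambda>a b. tsum V W X s (\<lambda>v w. \<beta> v w a b))"
proof -
  interpret X: module K X by fact
  have zero: "fsum X (\<lambda>_ _. \<zero>\<^bsub>X\<^esub>) l = \<zero>\<^bsub>X\<^esub>" for l :: "('y \<times> 'z) list"
    by (induction l) (simp_all add: case_prod_unfold)
  show ?thesis
    using fsum_swap[where \<beta>=\<beta>, OF assms(1) summands_formal_sums[of V W] summands_formal_sums[of A B] assms(2)]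
    by (auto simp: tsum_def sweedler_def zero)
qed

text \<open>By \<open>tsum_eta\<close> and linearity both values are the same sum over pure tensors.
  The identities between structure maps on tensor products are reduced to pure tensors by this
  lemma.\<close>

lemma tensor_ext:
  assumes "lin (V \<boxtimes> W) X f" "lin (V \<boxtimes> W) X g" "module K V" "module K W"
    "\<And>x y. x \<in> carrier V \<Longrightarrow> y \<in> carrier W \<Longrightarrow> f (pure K V W x y) = g (pure K V W x y)"
    "t \<in> carrier (V \<boxtimes> W)"
  shows "f t = g t"
proof -
  have "f (tsum V W (V \<boxtimes> W) t (pure K V W)) = g (tsum V W (V \<boxtimes> W) t (pure K V W))"
    by (subst (1 2) lin_tsum) (use assms in auto)
  then show ?thesis by (simp add: tsum_eta assms)
qed

lemma tensor_map_eq_tsum: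
  assumes "module K V" "module K W" "module K V'" "module K W'" "t \<in> carrier (V \<boxtimes> W)"
    "\<And>x. x \<in> carrier V \<Longrightarrow> f x \<in> carrier V'" "\<And>y. y \<in> carrier W \<Longrightarrow> g y \<in> carrier W'"
  shows "tensor_map K V W V' W' f g t = tsum V W (V' \<boxtimes> W') t (\<lambda>x y. pure K V' W' (f x) (g y))"
proof -
  interpret T: module K "V' \<boxtimes> W'" using assms by simp
  have "tensor_class K V' W' (map (map_prod f g) s) = fsum (V' \<boxtimes> W') (\<lambda>x y. pure K V' W' (f x) (g y)) s"
    if "s \<in> formal_sums V W" for s
    using that
  proof induction
    case (Cons p s)
    obtain x y where p: "p = (x, y)" "x \<in> carrier V" "y \<in> carrier W" using Cons by auto
    have "map (map_prod f g) s \<in> formal_sums V' W'"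
      using Cons.hyps(2) by induction (auto simp: assms)
    then show ?case
      using Cons.IH p assms(6,7) tensor_add_class[of "[(f x, g y)]" V' W' "map (map_prod f g) s"]
      by (simp add: pure_def)
  qed (simp add: tensor_zero)
  then show ?thesis
    using summands_formal_sums[of V W t] assms
    by (simp add: tensor_map_def tsum_def sweedler_def)
qed

lemma linear_maps_iff:
  "module K V \<Longrightarrow> module K W \<Longrightarrow> f \<in> linear_maps K V W \<longleftrightarrow> lin V W f \<and> f \<in> extensional (carrier V)"
  by (auto simp: linear_maps_def lin_def PiE_def)

end

section \<open>Twists and the untwisted bialgebra\<close>

text \<open>The same map as \<open>twist_inv\<close>, but as an opaque constant: in an unfolded
  \<open>inv_into\<close> the carrier of a tensor product would be rewritten, and rules about the
  inverse twist would no longer match.\<close>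

definition untwist :: "('k, 'a, 's) hom_space_scheme \<Rightarrow> 'a univ \<Rightarrow> 'a univ" where
  "untwist M = inv_into (carrier M) (twist M)"

context scalars
begin

lemma lin_ext_eq_tsum:
  assumes "module K V" "module K W" "t \<in> carrier (V \<boxtimes> W)"
  shows "lin_ext K V W X \<beta> t = tsum V W X t \<beta>"
  using assms by (simp add: lin_ext_def sweedler_eq_tsum)

lemma reassoc_eq_tsum:
  assumes "module K U" "module K V" "module K W" "t \<in> carrier ((U \<boxtimes> V) \<boxtimes> W)"
  shows "reassoc K U V W t = tsum (U \<boxtimes> V) W (U \<boxtimes> V \<boxtimes> W) t
    (\<lambda>s w. tsum U V (U \<boxtimes> V \<boxtimes> W) s (\<lambda>u v. pure K U (V \<boxtimes> W) u (pure K V W v w)))"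
  using assms by (simp add: reassoc_def Let_def lin_ext_eq_tsum sweedler_eq_tsum)

text \<open>With the trilinear versions below, these rules are handed to the simplifier inside
  proofs, so that an unspecified multilinear \<open>\<beta>\<close> can be treated like a concrete
  expression.\<close>

lemma bilin_lin_left: "bilin V W X \<beta> \<Longrightarrow> lin U V f \<Longrightarrow> y \<in> carrier W \<Longrightarrow> lin U X (\<lambda>x. \<beta> (f x) y)"
  using bilin_left lin_compose by fast

lemma bilin_lin_right: "bilin V W X \<beta> \<Longrightarrow> lin U W f \<Longrightarrow> x \<in> carrier V \<Longrightarrow> lin U X (\<lambda>y. \<beta> x (f y))"
  using bilin_right lin_compose by fast

lemma trilin_1:
  "trilin V W Z X \<beta> \<Longrightarrow> lin U V f \<Longrightarrow> y \<in> carrier W \<Longrightarrow> z \<in> carrier Z \<Longrightarrow> lin U X (\<lambda>x. \<beta> (f x) y z)"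
  by (rule lin_compose[of V X "\<lambda>x. \<beta> x y z"]) (simp_all add: trilin_def)

lemma trilin_2:
  "trilin V W Z X \<beta> \<Longrightarrow> lin U W f \<Longrightarrow> x \<in> carrier V \<Longrightarrow> z \<in> carrier Z \<Longrightarrow> lin U X (\<lambda>y. \<beta> x (f y) z)"
  by (rule lin_compose[of W X "\<lambda>y. \<beta> x y z"]) (simp_all add: trilin_def)

lemma trilin_3:
  "trilin V W Z X \<beta> \<Longrightarrow> lin U Z f \<Longrightarrow> x \<in> carrier V \<Longrightarrow> y \<in> carrier W \<Longrightarrow> lin U X (\<lambda>z. \<beta> x y (f z))"
  by (rule lin_compose[of Z X "\<lambda>z. \<beta> x y z"]) (simp_all add: trilin_def)

lemma trilin_closed:
  "trilin V W Z X \<beta> \<Longrightarrow> x \<in> carrier V \<Longrightarrow> y \<in> carrier W \<Longrightarrow> z \<in> carrier Z \<Longrightarrow> \<beta> x y z \<in> carrier X"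
  by (rule lin_closed[of Z X "\<beta> x y"]) (simp_all add: trilin_def)

lemmas bilin_rules = bilin_lin_left bilin_lin_right bilin_closed
lemmas trilin_rules = trilin_1 trilin_2 trilin_3 trilin_closed

section \<open>Spaces with a bijective twist\<close>

definition twisted :: "('k, 'a, 's) hom_space_scheme \<Rightarrow> bool" where
  "twisted M \<longleftrightarrow> module K M \<and> twist M \<in> linear_maps K M M \<and> bij_betw (twist M) (carrier M) (carrier M)"

lemma twisted_module: "twisted M \<Longrightarrow> module K M"
  by (simp add: twisted_def)

lemma lin_twist_aux: "twisted M \<Longrightarrow> lin M M (twist M)"
  by (auto simp: twisted_def linear_maps_iff)

lemma lin_twist [simp]: "twisted M \<Longrightarrow> lin U M f \<Longrightarrow> lin U M (\<lambda>x. twist M (f x))"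
  using lin_twist_aux lin_compose by fast

lemma twist_closed [simp]: "twisted M \<Longrightarrow> x \<in> carrier M \<Longrightarrow> twist M x \<in> carrier M"
  using lin_twist_aux lin_closed by fast

lemma untwist_closed [simp]: "twisted M \<Longrightarrow> x \<in> carrier M \<Longrightarrow> untwist M x \<in> carrier M"
  by (auto simp: twisted_def untwist_def bij_betw_def intro: inv_into_into)

lemma twist_untwist [simp]: "twisted M \<Longrightarrow> x \<in> carrier M \<Longrightarrow> twist M (untwist M x) = x"
  by (auto simp: twisted_def untwist_def bij_betw_def f_inv_into_f)

lemma untwist_twist [simp]: "twisted M \<Longrightarrow> x \<in> carrier M \<Longrightarrow> untwist M (twist M x) = x"
  by (auto simp: twisted_def untwist_def bij_betw_def)

lemma untwist_eqI: "twisted M \<Longrightarrow> y \<in> carrier M \<Longrightarrow> twist M y = x \<Longrightarrow> untwist M x = y"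
  by auto

lemma lin_untwist_aux:
  assumes "twisted M"
  shows "lin M M (untwist M)"
proof -
  interpret M: module K M using assms by (rule twisted_module)
  note l = lin_twist_aux[OF assms]
  show ?thesis
    unfolding lin_def
    using lin_add[OF l] lin_smult[OF l] assms twisted_module[OF assms]
    by (auto intro!: untwist_eqI[OF assms])
qed

lemma lin_untwist [simp]: "twisted M \<Longrightarrow> lin U M f \<Longrightarrow> lin U M (\<lambda>x. untwist M (f x))"
  using lin_untwist_aux lin_compose by fast

lemma twist_tsum [simp]:
  assumes "twisted M" "\<And>x y. x \<in> carrier V \<Longrightarrow> y \<in> carrier W \<Longrightarrow> \<beta> x y \<in> carrier M"
  shows "twist M (tsum V W M t \<beta>) = tsum V W M t (\<lambda>x y. twist M (\<beta> x y))"
  by (rule lin_tsum) (simp_all add: assms lin_twist_aux)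

lemma untwist_tsum [simp]:
  assumes "twisted M" "\<And>x y. x \<in> carrier V \<Longrightarrow> y \<in> carrier W \<Longrightarrow> \<beta> x y \<in> carrier M"
  shows "untwist M (tsum V W M t \<beta>) = tsum V W M t (\<lambda>x y. untwist M (\<beta> x y))"
  by (rule lin_tsum) (simp_all add: assms lin_untwist_aux)

end

section \<open>The bialgebra with its twist stripped off\<close>

locale bijective_hom_bialgebra = scalars K
  for K :: "('k, 'r) ring_scheme" +
  fixes H :: "('k, 'a) hom_bialg"
  assumes hom_bialgebra: "hom_bialgebra K H"
    and bij: "bij_betw \<alpha>\<^bsub>H\<^esub> (carrier H) (carrier H)"
begin

definition mul :: "'a univ \<Rightarrow> 'a univ \<Rightarrow> 'a univ" where
  "mul x y = untwist H (hmul K H x y)"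

definition comul :: "'a univ \<Rightarrow> 'a univ" where
  "comul x = \<Delta>\<^bsub>H\<^esub> (untwist H x)"

definition ac :: "('k, 'a) yd \<Rightarrow> 'a univ \<Rightarrow> 'a univ \<Rightarrow> 'a univ" where
  "ac M h m = untwist M (act K H M h m)"

definition co :: "('k, 'a) yd \<Rightarrow> 'a univ \<Rightarrow> 'a univ" where
  "co M m = \<lambda>c\<^bsub>M\<^esub> (untwist M m)"

lemma module_H [simp]: "module K H"
  using hom_bialgebra by (simp add: hom_bialgebra_def)

lemma twisted_H [simp]: "twisted H"
  using hom_bialgebra bij by (simp add: hom_bialgebra_def twisted_def)

lemma lin_multiplication: "lin (H \<boxtimes> H) H (multiplication H)"
  using hom_bialgebra by (simp add: hom_bialgebra_def linear_maps_iff)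

lemma lin_comult: "lin H (H \<boxtimes> H) \<Delta>\<^bsub>H\<^esub>"
  using hom_bialgebra by (simp add: hom_bialgebra_def linear_maps_iff)

lemma lin_mul_left [simp]: "lin U H f \<Longrightarrow> y \<in> carrier H \<Longrightarrow> lin U H (\<lambda>x. mul (f x) y)"
  unfolding mul_def hmul_def
  by (intro lin_untwist lin_compose[OF lin_multiplication] lin_pure_left) simp_all

lemma lin_mul_right [simp]: "lin U H f \<Longrightarrow> x \<in> carrier H \<Longrightarrow> lin U H (\<lambda>y. mul x (f y))"
  unfolding mul_def hmul_def
  by (intro lin_untwist lin_compose[OF lin_multiplication] lin_pure_right) simp_all

lemma mul_closed [simp]: "x \<in> carrier H \<Longrightarrow> y \<in> carrier H \<Longrightarrow> mul x y \<in> carrier H"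
  using lin_closed[OF lin_mul_left[of H "\<lambda>x. x"]] by simp

lemma hmul_closed: "x \<in> carrier H \<Longrightarrow> y \<in> carrier H \<Longrightarrow> hmul K H x y \<in> carrier H"
  unfolding hmul_def by (intro lin_closed[OF lin_multiplication]) simp

lemma hmul_eq: "x \<in> carrier H \<Longrightarrow> y \<in> carrier H \<Longrightarrow> hmul K H x y = twist H (mul x y)"
  by (simp add: mul_def hmul_closed)

lemma lin_comul [simp]: "lin U H f \<Longrightarrow> lin U (H \<boxtimes> H) (\<lambda>x. comul (f x))"
  unfolding comul_def by (intro lin_compose[OF lin_comult] lin_untwist) simp_all

lemma comul_closed [simp]: "x \<in> carrier H \<Longrightarrow> comul x \<in> carrier (H \<boxtimes> H)"
  using lin_closed[OF lin_comul[of H "\<lambda>x. x"]] by simp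

lemma comult_eq: "x \<in> carrier H \<Longrightarrow> \<Delta>\<^bsub>H\<^esub> x = comul (twist H x)"
  by (simp add: comul_def)

text \<open>Written with \<open>mul\<close>, both sides of multiplicativity of \<alpha> carry one
  additional outer twist, which injectivity removes.\<close>

lemma twist_mul [simp]:
  assumes "x \<in> carrier H" "y \<in> carrier H"
  shows "twist H (mul x y) = mul (twist H x) (twist H y)"
proof -
  have "twist H (hmul K H x y) = hmul K H (twist H x) (twist H y)"
    using assms hom_bialgebra by (simp add: hom_bialgebra_def)
  then have "twist H (twist H (mul x y)) = twist H (mul (twist H x) (twist H y))"
    using assms by (simp add: hmul_eq)
  then show ?thesis
    using assms by (metis mul_closed twist_closed twisted_H untwist_twist)
qed

lemma untwist_mul [simp]:
  assumes "x \<in> carrier H" "y \<in> carrier H"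
  shows "untwist H (mul x y) = mul (untwist H x) (untwist H y)"
  using assms by (auto intro: untwist_eqI)

lemma mul_assoc [simp]:
  assumes "x \<in> carrier H" "y \<in> carrier H" "z \<in> carrier H"
  shows "mul (mul x y) z = mul x (mul y z)"
proof -
  have "hmul K H (twist H x) (hmul K H y z) = hmul K H (hmul K H x y) (twist H z)"
    using assms hom_bialgebra by (simp add: hom_bialgebra_def)
  then have "twist H (twist H (mul x (mul y z))) = twist H (twist H (mul (mul x y) z))"
    using assms by (simp add: hmul_eq)
  then show ?thesis
    using assms by (metis mul_closed twist_closed twisted_H untwist_twist)
qed

lemma comul_twist:
  assumes "x \<in> carrier H"
  shows "comul (twist H x) = tsum H H (H \<boxtimes> H) (comul x) (\<lambda>a b. pure K H H (twist H a) (twist H b))"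
proof -
  have "\<Delta>\<^bsub>H\<^esub> (twist H (untwist H x)) = tensor_map K H H H H (twist H) (twist H) (\<Delta>\<^bsub>H\<^esub> (untwist H x))"
    using assms hom_bialgebra untwist_closed[OF twisted_H] unfolding hom_bialgebra_def by blast
  then show ?thesis
    using assms by (simp add: comult_eq tensor_map_eq_tsum)
qed

text \<open>The orientation matters: twists are always moved from the argument of
  \<open>comul\<close> onto its legs, where they meet the inverse twists that cancel them.\<close>

lemma tsum_comul_twist [simp]:
  assumes "x \<in> carrier H" "bilin H H X \<beta>"
  shows "tsum H H X (comul (twist H x)) \<beta> = tsum H H X (comul x) (\<lambda>a b. \<beta> (twist H a) (twist H b))"
  using assms by (simp add: comul_twist)

text \<open>The rule for \<open>twist\<close> at \<open>untwist H x\<close>, with a summand that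
  undoes the twist on both legs.\<close>

lemma tsum_comul_untwist [simp]:
  assumes "x \<in> carrier H" "bilin H H X \<beta>"
  shows "tsum H H X (comul (untwist H x)) \<beta> = tsum H H X (comul x) (\<lambda>a b. \<beta> (untwist H a) (untwist H b))"
proof -
  note [simp] = bilin_rules[OF assms(2)]
  have [simp]: "module K X" using assms(2) by (simp add: bilin_def)
  have "tsum H H X (comul (twist H (untwist H x))) (\<lambda>a b. \<beta> (untwist H a) (untwist H b)) = tsum H H X (comul (untwist H x)) \<beta>"
    using assms(1) by (subst tsum_comul_twist) simp_all
  then show ?thesis using assms(1) by simp
qed

lemma tsum_comul_mul [simp]:
  assumes "x \<in> carrier H" "y \<in> carrier H" "bilin H H X \<beta>"
  shows "tsum H H X (comul (mul x y)) \<beta> =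
    tsum H H X (comul x) (\<lambda>a b. tsum H H X (comul y) (\<lambda>p q. \<beta> (mul a p) (mul b q)))"
proof -
  note [simp] = bilin_rules[OF assms(3)]
  have [simp]: "module K X" using assms(3) by (simp add: bilin_def)
  \<comment> \<open>With untwisted arguments \<open>\<Delta>\<close> becomes \<open>comul\<close> at
    \<open>x\<close> and \<open>y\<close>. Each leg then keeps one twist from \<open>hmul\<close>,
    which the untwistings in the summand remove.\<close>
  let ?x = "untwist H x" and ?y = "untwist H y"
  have "\<Delta>\<^bsub>H\<^esub> (hmul K H ?x ?y) = sweedler (H \<boxtimes> H) (\<Delta>\<^bsub>H\<^esub> ?x) (\<lambda>a b.
      sweedler (H \<boxtimes> H) (\<Delta>\<^bsub>H\<^esub> ?y) (\<lambda>p q. pure K H H (hmul K H a p) (hmul K H b q)))"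
    using assms hom_bialgebra untwist_closed[OF twisted_H] unfolding hom_bialgebra_def by blast
  then have "tsum H H X (comul (twist H (twist H (mul ?x ?y)))) (\<lambda>a b. \<beta> (untwist H a) (untwist H b)) =
    tsum H H X (comul x) (\<lambda>a b. tsum H H X (comul y) (\<lambda>p q. \<beta> (mul a p) (mul b q)))"
    using assms(1,2) by (simp add: comult_eq hmul_eq sweedler_eq_tsum[of H H] del: tsum_comul_twist twist_mul)
  \<comment> \<open>Folding the product back into \<open>untwist H (mul x y)\<close> leaves a single
    twist inside \<open>comul\<close>, and the summand undoes it.\<close>
  then show ?thesis using assms(1,2) by (simp flip: untwist_mul del: twist_mul)
qed

text \<open>Summation of a trilinear \<open>\<beta>\<close> is indifferent to bracketing, so the
  identification \<open>reassoc\<close> disappears from the statement.\<close>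

lemma comul_coassoc:
  assumes "x \<in> carrier H" "trilin H H H X \<beta>"
  shows "tsum H H X (comul x) (\<lambda>a b. tsum H H X (comul a) (\<lambda>p q. \<beta> p q b)) =
    tsum H H X (comul x) (\<lambda>a b. tsum H H X (comul b) (\<lambda>p q. \<beta> a p q))"
proof -
  note [simp] = trilin_rules[OF assms(2)]
  have [simp]: "module K X" using assms(2) by (simp add: trilin_def)
  \<comment> \<open>The outer \<open>\<Delta>\<close> leaves one twist on each leg, and the second
    stage adds another, through the inner \<open>\<Delta>\<close> or through \<alpha>. Hence two
    untwistings per leg.\<close>
  let ?\<Gamma> = "\<lambda>t. tsum H (H \<boxtimes> H) X t (\<lambda>a s. tsum H H X s
    (\<lambda>b c. \<beta> (untwist H (untwist H a)) (untwist H (untwist H b)) (untwist H (untwist H c))))"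
  have "reassoc K H H H (tensor_map K H H (H \<boxtimes> H) H \<Delta>\<^bsub>H\<^esub> \<alpha>\<^bsub>H\<^esub> (\<Delta>\<^bsub>H\<^esub> x)) =
      tensor_map K H H H (H \<boxtimes> H) \<alpha>\<^bsub>H\<^esub> \<Delta>\<^bsub>H\<^esub> (\<Delta>\<^bsub>H\<^esub> x)"
    using assms(1) hom_bialgebra by (simp add: hom_bialgebra_def)
  then have "?\<Gamma> (reassoc K H H H (tensor_map K H H (H \<boxtimes> H) H \<Delta>\<^bsub>H\<^esub> \<alpha>\<^bsub>H\<^esub> (\<Delta>\<^bsub>H\<^esub> x))) =
    ?\<Gamma> (tensor_map K H H H (H \<boxtimes> H) \<alpha>\<^bsub>H\<^esub> \<Delta>\<^bsub>H\<^esub> (\<Delta>\<^bsub>H\<^esub> x))"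
    by simp
  then show ?thesis
    using assms(1) by (simp add: comult_eq tensor_map_eq_tsum reassoc_eq_tsum)
qed

section \<open>Yetter-Drinfeld modules\<close>

abbreviation (input) Ob :: "('k, 'a) yd set" where
  "Ob \<equiv> yd_Ob K H"

text \<open>Linear structure maps and a bijective twist, without the axioms relating them. Closure
  and linearity rules are thus available for a tensor product before it is known to be an
  object.\<close>

definition yd_data :: "('k, 'a) yd \<Rightarrow> bool" where
  "yd_data M \<longleftrightarrow> twisted M \<and> action M \<in> linear_maps K (H \<boxtimes> M) M \<and> \<lambda>c\<^bsub>M\<^esub> \<in> linear_maps K M (H \<boxtimes> M)"

lemma yd_data_twisted [simp]: "yd_data M \<Longrightarrow> twisted M"
  by (simp add: yd_data_def)

lemma yd_data_module [simp]: "yd_data M \<Longrightarrow> module K M"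
  by (simp add: twisted_module)

lemma yd_dataD:
  assumes "yd_data M"
  shows "twist M \<in> linear_maps K M M" "bij_betw (twist M) (carrier M) (carrier M)"
    "action M \<in> linear_maps K (H \<boxtimes> M) M" "\<lambda>c\<^bsub>M\<^esub> \<in> linear_maps K M (H \<boxtimes> M)"
  using assms by (simp_all add: yd_data_def twisted_def)

lemma yd_data_lin:
  assumes "yd_data M"
  shows "lin (H \<boxtimes> M) M (action M)" "lin M (H \<boxtimes> M) \<lambda>c\<^bsub>M\<^esub>"
  using yd_dataD[OF assms] assms by (simp_all add: linear_maps_iff)

lemma lin_ac_left [simp]:
  "yd_data M \<Longrightarrow> lin U H f \<Longrightarrow> m \<in> carrier M \<Longrightarrow> lin U M (\<lambda>x. ac M (f x) m)"
  unfolding ac_def act_def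
  by (intro lin_untwist lin_compose[OF yd_data_lin(1)] lin_pure_left) simp_all

lemma lin_ac_right [simp]:
  "yd_data M \<Longrightarrow> lin U M f \<Longrightarrow> h \<in> carrier H \<Longrightarrow> lin U M (\<lambda>x. ac M h (f x))"
  unfolding ac_def act_def
  by (intro lin_untwist lin_compose[OF yd_data_lin(1)] lin_pure_right) simp_all

lemma ac_closed [simp]:
  "yd_data M \<Longrightarrow> h \<in> carrier H \<Longrightarrow> m \<in> carrier M \<Longrightarrow> ac M h m \<in> carrier M"
  using lin_closed[OF lin_ac_left[of M H "\<lambda>x. x"]] by simp

lemma act_closed:
  "yd_data M \<Longrightarrow> h \<in> carrier H \<Longrightarrow> m \<in> carrier M \<Longrightarrow> act K H M h m \<in> carrier M"
  unfolding act_def by (intro lin_closed[OF yd_data_lin(1)]) simp_all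

lemma act_eq:
  "yd_data M \<Longrightarrow> h \<in> carrier H \<Longrightarrow> m \<in> carrier M \<Longrightarrow> act K H M h m = twist M (ac M h m)"
  by (simp add: ac_def act_closed)

lemma lin_co [simp]: "yd_data M \<Longrightarrow> lin U M f \<Longrightarrow> lin U (H \<boxtimes> M) (\<lambda>x. co M (f x))"
  unfolding co_def by (intro lin_compose[OF yd_data_lin(2)] lin_untwist) simp_all

lemma co_closed [simp]: "yd_data M \<Longrightarrow> m \<in> carrier M \<Longrightarrow> co M m \<in> carrier (H \<boxtimes> M)"
  using lin_closed[OF lin_co[of M M "\<lambda>x. x"]] by simp

lemma coaction_eq: "yd_data M \<Longrightarrow> m \<in> carrier M \<Longrightarrow> \<lambda>c\<^bsub>M\<^esub> m = co M (twist M m)"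
  by (simp add: co_def)

lemma ac_tsum_right [simp]:
  assumes "yd_data M" "h \<in> carrier H" "\<And>a b. a \<in> carrier V \<Longrightarrow> b \<in> carrier W \<Longrightarrow> \<beta> a b \<in> carrier M"
  shows "ac M h (tsum V W M t \<beta>) = tsum V W M t (\<lambda>a b. ac M h (\<beta> a b))"
  by (rule lin_tsum) (simp_all add: assms)

lemma co_tsum [simp]:
  assumes "yd_data M" "\<And>a b. a \<in> carrier V \<Longrightarrow> b \<in> carrier W \<Longrightarrow> \<beta> a b \<in> carrier M"
  shows "co M (tsum V W M t \<beta>) = tsum V W (H \<boxtimes> M) t (\<lambda>a b. co M (\<beta> a b))"
  by (rule lin_tsum) (simp_all add: assms)

lemma Ob_data [simp]: "M \<in> Ob \<Longrightarrow> yd_data M"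
  by (simp add: yd_Ob_def yd_data_def yetter_drinfeld_module_def left_module_def left_comodule_def twisted_def)

section \<open>Axioms of a Yetter-Drinfeld module in untwisted form\<close>

lemma twist_ac [simp]:
  assumes "M \<in> Ob" "h \<in> carrier H" "m \<in> carrier M"
  shows "twist M (ac M h m) = ac M (twist H h) (twist M m)"
proof -
  have "twist M (act K H M h m) = act K H M (twist H h) (twist M m)"
    using assms unfolding yd_Ob_def yetter_drinfeld_module_def left_module_def by blast
  then have "twist M (twist M (ac M h m)) = twist M (ac M (twist H h) (twist M m))"
    using assms by (simp add: act_eq)
  from arg_cong[OF this, of "\<lambda>x. untwist M (untwist M x)"] show ?thesis
    using assms by simp
qed

lemma untwist_ac [simp]:
  assumes "M \<in> Ob" "h \<in> carrier H" "m \<in> carrier M"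
  shows "untwist M (ac M h m) = ac M (untwist H h) (untwist M m)"
  using assms by (intro untwist_eqI) simp_all

lemma ac_ac [simp]:
  assumes "M \<in> Ob" "g \<in> carrier H" "h \<in> carrier H" "m \<in> carrier M"
  shows "ac M g (ac M h m) = ac M (mul g h) m"
proof -
  have "act K H M (twist H g) (act K H M h m) = act K H M (hmul K H g h) (twist M m)"
    using assms unfolding yd_Ob_def yetter_drinfeld_module_def left_module_def by blast
  then have "twist M (twist M (ac M g (ac M h m))) = twist M (twist M (ac M (mul g h) m))"
    using assms by (simp add: act_eq hmul_eq)
  from arg_cong[OF this, of "\<lambda>x. untwist M (untwist M x)"] show ?thesis
    using assms by (simp del: twist_ac)
qed

lemma tsum_co_twist [simp]:
  assumes "M \<in> Ob" "m \<in> carrier M" "bilin H M X \<beta>"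
  shows "tsum H M X (co M (twist M m)) \<beta> = tsum H M X (co M m) (\<lambda>a n. \<beta> (twist H a) (twist M n))"
proof -
  have "tensor_map K H M H M (twist H) (twist M) (\<lambda>c\<^bsub>M\<^esub> (untwist M m)) = \<lambda>c\<^bsub>M\<^esub> (twist M (untwist M m))"
    using assms untwist_closed[OF yd_data_twisted[OF Ob_data]]
    unfolding yd_Ob_def yetter_drinfeld_module_def left_comodule_def by blast
  then have "co M (twist M m) = tsum H M (H \<boxtimes> M) (co M m) (\<lambda>a n. pure K H M (twist H a) (twist M n))"
    using assms by (simp add: tensor_map_eq_tsum coaction_eq)
  then show ?thesis using assms by simp
qed

lemma tsum_co_untwist [simp]:
  assumes "M \<in> Ob" "m \<in> carrier M" "bilin H M X \<beta>"
  shows "tsum H M X (co M (untwist M m)) \<beta> = tsum H M X (co M m) (\<lambda>a n. \<beta> (untwist H a) (untwist M n))"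
proof -
  note [simp] = bilin_rules[OF assms(3)]
  have [simp]: "module K X" using assms(3) by (simp add: bilin_def)
  have "tsum H M X (co M (twist M (untwist M m))) (\<lambda>a n. \<beta> (untwist H a) (untwist M n)) =
      tsum H M X (co M (untwist M m)) \<beta>"
    using assms(1,2) by (subst tsum_co_twist) simp_all
  then show ?thesis using assms(1,2) by simp
qed

lemma co_coassoc:
  assumes "M \<in> Ob" "m \<in> carrier M" "trilin H H M X \<beta>"
  shows "tsum H M X (co M m) (\<lambda>a n. tsum H H X (comul a) (\<lambda>p q. \<beta> p q n)) =
    tsum H M X (co M m) (\<lambda>a n. tsum H M X (co M n) (\<lambda>p q. \<beta> a p q))"
proof -
  note [simp] = trilin_rules[OF assms(3)]
  have [simp]: "module K X" using assms(3) by (simp add: trilin_def)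
  \<comment> \<open>As in \<open>comul_coassoc\<close>, both sides carry two twists on each of the
    three legs.\<close>
  let ?\<Gamma> = "\<lambda>t. tsum H (H \<boxtimes> M) X t (\<lambda>a s. tsum H M X s
    (\<lambda>b n. \<beta> (untwist H (untwist H a)) (untwist H (untwist H b)) (untwist M (untwist M n))))"
  have "reassoc K H H M (tensor_map K H M (H \<boxtimes> H) M \<Delta>\<^bsub>H\<^esub> \<alpha>\<^bsub>M\<^esub> (\<lambda>c\<^bsub>M\<^esub> m)) =
      tensor_map K H M H (H \<boxtimes> M) \<alpha>\<^bsub>H\<^esub> \<lambda>c\<^bsub>M\<^esub> (\<lambda>c\<^bsub>M\<^esub> m)"
    using assms(1,2) unfolding yd_Ob_def yetter_drinfeld_module_def left_comodule_def by blast
  then have "?\<Gamma> (reassoc K H H M (tensor_map K H M (H \<boxtimes> H) M \<Delta>\<^bsub>H\<^esub> \<alpha>\<^bsub>M\<^esub> (\<lambda>c\<^bsub>M\<^esub> m))) =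
      ?\<Gamma> (tensor_map K H M H (H \<boxtimes> M) \<alpha>\<^bsub>H\<^esub> \<lambda>c\<^bsub>M\<^esub> (\<lambda>c\<^bsub>M\<^esub> m))"
    by simp
  then show ?thesis
    using assms(1,2) by (simp add: comult_eq coaction_eq tensor_map_eq_tsum reassoc_eq_tsum)
qed

text \<open>The classical Yetter-Drinfeld compatibility, composed with an arbitrary bilinear
  \<open>\<beta>\<close> so that it can be applied inside larger sums.\<close>

lemma yd_condition:
  assumes "M \<in> Ob" "h \<in> carrier H" "m \<in> carrier M" "bilin H M X \<beta>"
  shows "tsum H H X (comul h) (\<lambda>g k. tsum H M X (co M (ac M g m)) (\<lambda>a n. \<beta> (mul a k) n)) =
    tsum H H X (comul h) (\<lambda>g k. tsum H M X (co M m) (\<lambda>a n. \<beta> (mul g a) (ac M k n)))"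
proof -
  note [simp] = bilin_rules[OF assms(4)]
  have [simp]: "module K X" using assms(4) by (simp add: bilin_def)
  \<comment> \<open>On both sides the leg in \<open>H\<close> carries three twists, two on each
    factor and one from \<open>hmul\<close>, and the leg in \<open>M\<close> carries two.\<close>
  let ?\<Gamma> = "\<lambda>t. tsum H M X t (\<lambda>a n. \<beta> (untwist H (untwist H (untwist H a))) (untwist M (untwist M n)))"
  let ?h = "untwist H h"
  have "sweedler (H \<boxtimes> M) (\<Delta>\<^bsub>H\<^esub> ?h) (\<lambda>h1 h2.
      sweedler (H \<boxtimes> M) (\<lambda>c\<^bsub>M\<^esub> (act K H M h1 m)) (\<lambda>n' n0.
        pure K H M (hmul K H n' (\<alpha>\<^bsub>H\<^esub> (\<alpha>\<^bsub>H\<^esub> h2))) n0)) =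
    sweedler (H \<boxtimes> M) (\<Delta>\<^bsub>H\<^esub> ?h) (\<lambda>h1 h2.
      sweedler (H \<boxtimes> M) (\<lambda>c\<^bsub>M\<^esub> m) (\<lambda>m' m0.
        pure K H M (hmul K H (\<alpha>\<^bsub>H\<^esub> (\<alpha>\<^bsub>H\<^esub> h1)) (\<alpha>\<^bsub>H\<^esub> m')) (act K H M (\<alpha>\<^bsub>H\<^esub> h2) m0)))"
    using assms untwist_closed[OF twisted_H] unfolding yd_Ob_def yetter_drinfeld_module_def by blast
  then have "tsum H H (H \<boxtimes> M) (comul h) (\<lambda>h1 h2.
      tsum H M (H \<boxtimes> M) (co M (twist M (twist M (ac M h1 m)))) (\<lambda>n' n0.
        pure K H M (hmul K H n' (\<alpha>\<^bsub>H\<^esub> (\<alpha>\<^bsub>H\<^esub> h2))) n0)) =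
    tsum H H (H \<boxtimes> M) (comul h) (\<lambda>h1 h2.
      tsum H M (H \<boxtimes> M) (co M (twist M m)) (\<lambda>m' m0.
        pure K H M (hmul K H (\<alpha>\<^bsub>H\<^esub> (\<alpha>\<^bsub>H\<^esub> h1)) (\<alpha>\<^bsub>H\<^esub> m')) (act K H M (\<alpha>\<^bsub>H\<^esub> h2) m0)))"
    (is "?l = ?r")
    using assms(1-3)
    by (simp add: comult_eq coaction_eq act_eq sweedler_eq_tsum[of H H] sweedler_eq_tsum[of H M]
        del: twist_ac tsum_co_twist)
  then have "?\<Gamma> ?l = ?\<Gamma> ?r" by simp
  \<comment> \<open>\<open>twist_ac\<close> is withheld so that the twists of
    \<open>ac M g m\<close> pass through \<open>co\<close> onto its legs instead of moving to
    \<open>g\<close> and \<open>m\<close>.\<close>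
  moreover have "?\<Gamma> ?l = tsum H H X (comul h) (\<lambda>g k. tsum H M X (co M (ac M g m)) (\<lambda>a n. \<beta> (mul a k) n))"
    using assms(1-3) by (simp add: hmul_eq del: twist_ac)
  moreover have "?\<Gamma> ?r = tsum H H X (comul h) (\<lambda>g k. tsum H M X (co M m) (\<lambda>a n. \<beta> (mul g a) (ac M k n)))"
    using assms(1-3) by (simp add: hmul_eq act_eq)
  ultimately show ?thesis by simp
qed

text \<open>The translation back: the untwisted axioms give the Hom-axioms. The maps
  \<open>?\<Gamma>\<close> put back the powers of the twist that were removed in
  \<open>co_coassoc\<close> and \<open>yd_condition\<close>.\<close>

lemma ObI:
  assumes data [simp]: "yd_data M"
    and equiv [simp]: "\<And>h m. h \<in> carrier H \<Longrightarrow> m \<in> carrier M \<Longrightarrow> twist M (ac M h m) = ac M (twist H h) (twist M m)"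
    and assoc [simp]: "\<And>g h m. g \<in> carrier H \<Longrightarrow> h \<in> carrier H \<Longrightarrow> m \<in> carrier M \<Longrightarrow> ac M g (ac M h m) = ac M (mul g h) m"
    and co_equiv: "\<And>m. m \<in> carrier M \<Longrightarrow> co M (twist M m) =
        tsum H M (H \<boxtimes> M) (co M m) (\<lambda>a n. pure K H M (twist H a) (twist M n))"
    and coassoc: "\<And>m. m \<in> carrier M \<Longrightarrow>
        tsum H M (H \<boxtimes> H \<boxtimes> M) (co M m) (\<lambda>a n. tsum H H (H \<boxtimes> H \<boxtimes> M) (comul a) (\<lambda>p q.
          pure K H (H \<boxtimes> M) p (pure K H M q n))) =
        tsum H M (H \<boxtimes> H \<boxtimes> M) (co M m) (\<lambda>a n. tsum H M (H \<boxtimes> H \<boxtimes> M) (co M n) (\<lambda>p q.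
          pure K H (H \<boxtimes> M) a (pure K H M p q)))"
    and yd: "\<And>h m. h \<in> carrier H \<Longrightarrow> m \<in> carrier M \<Longrightarrow>
        tsum H H (H \<boxtimes> M) (comul h) (\<lambda>g k. tsum H M (H \<boxtimes> M) (co M (ac M g m)) (\<lambda>a n. pure K H M (mul a k) n)) =
        tsum H H (H \<boxtimes> M) (comul h) (\<lambda>g k. tsum H M (H \<boxtimes> M) (co M m) (\<lambda>a n. pure K H M (mul g a) (ac M k n)))"
  shows "M \<in> Ob"
proof -
  have co_twist: "tsum H M X (co M (twist M m)) \<beta> = tsum H M X (co M m) (\<lambda>a n. \<beta> (twist H a) (twist M n))"
    if "m \<in> carrier M" "bilin H M X \<beta>" for m X \<beta>
    using that by (simp add: co_equiv)
  have "left_module K H M"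
    by (simp add: left_module_def yd_dataD[OF data] act_eq hmul_eq)
  moreover have "left_comodule K H M"
  proof -
    let ?\<Gamma> = "\<lambda>t. tsum H (H \<boxtimes> M) (H \<boxtimes> H \<boxtimes> M) t (\<lambda>a s. tsum H M (H \<boxtimes> H \<boxtimes> M) s
      (\<lambda>b n. pure K H (H \<boxtimes> M) (twist H (twist H a)) (pure K H M (twist H (twist H b)) (twist M (twist M n)))))"
    have "reassoc K H H M (tensor_map K H M (H \<boxtimes> H) M \<Delta>\<^bsub>H\<^esub> \<alpha>\<^bsub>M\<^esub> (\<lambda>c\<^bsub>M\<^esub> m)) =
        tensor_map K H M H (H \<boxtimes> M) \<alpha>\<^bsub>H\<^esub> \<lambda>c\<^bsub>M\<^esub> (\<lambda>c\<^bsub>M\<^esub> m)" if m: "m \<in> carrier M" for m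
      using arg_cong[OF coassoc[OF m], of ?\<Gamma>] m
      by (simp add: comult_eq coaction_eq tensor_map_eq_tsum reassoc_eq_tsum co_equiv)
    moreover have "tensor_map K H M H M \<alpha>\<^bsub>H\<^esub> \<alpha>\<^bsub>M\<^esub> (\<lambda>c\<^bsub>M\<^esub> m) = \<lambda>c\<^bsub>M\<^esub> (\<alpha>\<^bsub>M\<^esub> m)"
      if "m \<in> carrier M" for m
      using that by (simp add: coaction_eq tensor_map_eq_tsum co_equiv)
    ultimately show ?thesis
      by (simp add: left_comodule_def yd_dataD[OF data])
  qed
  moreover have "sweedler (H \<boxtimes> M) (\<Delta>\<^bsub>H\<^esub> h) (\<lambda>h1 h2.
      sweedler (H \<boxtimes> M) (\<lambda>c\<^bsub>M\<^esub> (act K H M h1 m)) (\<lambda>n' n0.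
        pure K H M (hmul K H n' (\<alpha>\<^bsub>H\<^esub> (\<alpha>\<^bsub>H\<^esub> h2))) n0)) =
    sweedler (H \<boxtimes> M) (\<Delta>\<^bsub>H\<^esub> h) (\<lambda>h1 h2.
      sweedler (H \<boxtimes> M) (\<lambda>c\<^bsub>M\<^esub> m) (\<lambda>m' m0.
        pure K H M (hmul K H (\<alpha>\<^bsub>H\<^esub> (\<alpha>\<^bsub>H\<^esub> h1)) (\<alpha>\<^bsub>H\<^esub> m')) (act K H M (\<alpha>\<^bsub>H\<^esub> h2) m0)))"
    (is "?l = ?r") if hm: "h \<in> carrier H" "m \<in> carrier M" for h m
  proof -
    let ?\<Gamma> = "\<lambda>t. tsum H M (H \<boxtimes> M) t (\<lambda>a n. pure K H M (twist H (twist H (twist H a))) (twist M (twist M n)))"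
    have "?l = tsum H H (H \<boxtimes> M) (comul (twist H h)) (\<lambda>h1 h2.
      tsum H M (H \<boxtimes> M) (co M (twist M (twist M (ac M h1 m)))) (\<lambda>n' n0.
        pure K H M (hmul K H n' (\<alpha>\<^bsub>H\<^esub> (\<alpha>\<^bsub>H\<^esub> h2))) n0))"
      using hm
      by (simp add: comult_eq coaction_eq act_eq sweedler_eq_tsum[of H H] sweedler_eq_tsum[of H M]
        del: equiv tsum_comul_twist)
    also have "\<dots> = ?\<Gamma> (tsum H H (H \<boxtimes> M) (comul (twist H h)) (\<lambda>g k. tsum H M (H \<boxtimes> M) (co M (ac M g m)) (\<lambda>a n. pure K H M (mul a k) n)))"
      using hm by (simp add: hmul_eq co_twist del: equiv tsum_comul_twist)
    also have "\<dots> = ?\<Gamma> (tsum H H (H \<boxtimes> M) (comul (twist H h)) (\<lambda>g k. tsum H M (H \<boxtimes> M) (co M m) (\<lambda>a n. pure K H M (mul g a) (ac M k n))))"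
      using hm by (subst yd) simp_all
    also have "\<dots> = ?r"
      using hm
      by (simp add: comult_eq coaction_eq act_eq sweedler_eq_tsum[of H H] sweedler_eq_tsum[of H M]
        hmul_eq co_twist)
    finally show ?thesis .
  qed
  ultimately show ?thesis
    by (simp add: yd_Ob_def yetter_drinfeld_module_def yd_dataD[OF data])
qed

end

section \<open>The tensor product of Yetter-Drinfeld modules\<close>

context scalars
begin

text \<open>The object \<open>yd_tensor\<close> and the plain tensor product beneath it are records
  of different types and cannot be equated. Agreement of the fields that linear maps and tensor
  products read lets facts pass between them.\<close>

definition same_space :: "('k, 'v, 's) module_scheme \<Rightarrow> ('k, 'v, 't) module_scheme \<Rightarrow> bool" where
  "same_space V W \<longleftrightarrow> carrier V = carrier W \<and> \<zero>\<^bsub>V\<^esub> = \<zero>\<^bsub>W\<^esub> \<and> add V = add W \<and> smult V = smult W"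

lemma same_space_module: "same_space V W \<Longrightarrow> module K V = module K W"
  by (simp add: same_space_def module_def abelian_group_def abelian_monoid_def
      abelian_group_axioms_def module_axioms_def comm_group_def group_def group_axioms_def
      comm_monoid_def comm_monoid_axioms_def monoid_def Units_def)

lemma same_space_lin: "same_space V W \<Longrightarrow> lin V A f = lin W A f" "same_space V W \<Longrightarrow> lin B V g = lin B W g"
  by (auto simp: lin_def same_space_module) (auto simp: same_space_def)

lemma same_space_linear_maps:
  "same_space V W \<Longrightarrow> linear_maps K V A = linear_maps K W A"
  "same_space V W \<Longrightarrow> linear_maps K B V = linear_maps K B W"
  by (auto simp: linear_maps_def same_space_def)

text \<open>One inclusion, to which symmetry of \<open>same_space\<close> adds the other. The two
  relations then coincide and with them the chosen representatives, so that the tensor products are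
  equal and not merely isomorphic.\<close>

lemma same_space_tensor_rel_mono:
  assumes "tensor_rel K V W s t" "same_space V V'" "same_space W W'"
  shows "tensor_rel K V' W' s t"
  using assms(1)
proof induction
  case (trans s t u)
  then show ?case by (rule_tac tensor_rel.trans)
qed (use assms(2,3) in \<open>auto simp: same_space_def intro: tensor_rel.intros\<close>)

lemma same_space_sym: "same_space V W \<Longrightarrow> same_space W V"
  by (simp add: same_space_def)

lemma same_space_refl: "same_space V V"
  by (simp add: same_space_def)

lemma same_space_tensor_rel:
  "same_space V W \<Longrightarrow> tensor_rel K V U = tensor_rel K W U"
  "same_space V W \<Longrightarrow> tensor_rel K U V = tensor_rel K U W"
  by (intro ext iffI; blast intro: same_space_tensor_rel_mono same_space_sym same_space_refl)+

lemma same_space_tensor_class: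
  "same_space V W \<Longrightarrow> tensor_class K V U = tensor_class K W U"
  "same_space V W \<Longrightarrow> tensor_class K U V = tensor_class K U W"
  by (simp_all add: fun_eq_iff tensor_class_def same_space_tensor_rel)

lemma same_space_tensor:
  "same_space V W \<Longrightarrow> V \<boxtimes> U = W \<boxtimes> U"
  "same_space V W \<Longrightarrow> U \<boxtimes> V = U \<boxtimes> W"
  by (simp_all add: tensor_def same_space_tensor_class) (simp_all add: same_space_def)

lemma same_space_pure:
  "same_space V W \<Longrightarrow> pure K V U = pure K W U"
  "same_space V W \<Longrightarrow> pure K U V = pure K U W"
  by (simp_all add: fun_eq_iff pure_def same_space_tensor_class)

lemma same_space_sweedler: "same_space V W \<Longrightarrow> sweedler V = sweedler W"
  by (simp add: fun_eq_iff sweedler_def same_space_def)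

lemma same_space_tsum:
  "same_space V W \<Longrightarrow> tsum V U X t \<beta> = tsum W U X t \<beta>"
  "same_space V W \<Longrightarrow> tsum U V X t \<beta> = tsum U W X t \<beta>"
  "same_space Y Z \<Longrightarrow> tsum A B Y t \<gamma> = tsum A B Z t \<gamma>"
  by (simp_all add: tsum_def same_space_tensor same_space_module same_space_sweedler)
    (auto simp: same_space_def)

lemma same_space_bilin:
  "same_space V W \<Longrightarrow> bilin V A B \<beta> = bilin W A B \<beta>"
  "same_space V W \<Longrightarrow> bilin C V D \<gamma> = bilin C W D \<gamma>"
  "same_space V W \<Longrightarrow> bilin E F V \<epsilon> = bilin E F W \<epsilon>"
  by (simp_all add: bilin_def same_space_module same_space_lin) (simp_all add: same_space_def)

lemma same_space_tensor_map:
  "same_space V W \<Longrightarrow> tensor_map K V = tensor_map K W"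
  "same_space V W \<Longrightarrow> tensor_map K U V = tensor_map K U W"
  "same_space V W \<Longrightarrow> tensor_map K U X V = tensor_map K U X W"
  "same_space V W \<Longrightarrow> tensor_map K U X Y V = tensor_map K U X Y W"
  by (simp_all add: fun_eq_iff tensor_map_def same_space_tensor same_space_tensor_class)

lemma same_space_lin_ext:
  "same_space V W \<Longrightarrow> lin_ext K V = lin_ext K W"
  "same_space V W \<Longrightarrow> lin_ext K U V = lin_ext K U W"
  "same_space Y Z \<Longrightarrow> lin_ext K A B Y = lin_ext K A B Z"
  by (simp_all add: fun_eq_iff lin_ext_def same_space_tensor same_space_sweedler)

lemma same_space_yd_tensor: "same_space (yd_tensor K H M N) (M \<boxtimes> N)"
  by (simp add: same_space_def yd_tensor_def Let_def)

lemma yd_tensor_carrier [simp]: "carrier (yd_tensor K H M N) = carrier (M \<boxtimes> N)"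
  using same_space_yd_tensor[of H M N] by (simp add: same_space_def)

text \<open>As rewrite rules these replace \<open>yd_tensor\<close> by the plain tensor product
  wherever only the underlying space matters, which gives spaces a normal form.\<close>

lemmas yd_tensor_space [simp] =
  same_space_module[OF same_space_yd_tensor]
  same_space_lin[OF same_space_yd_tensor]
  same_space_linear_maps[OF same_space_yd_tensor]
  same_space_tensor[OF same_space_yd_tensor]
  same_space_pure[OF same_space_yd_tensor]
  same_space_sweedler[OF same_space_yd_tensor]
  same_space_tsum[OF same_space_yd_tensor]
  same_space_bilin[OF same_space_yd_tensor]
  same_space_tensor_map[OF same_space_yd_tensor]
  same_space_lin_ext[OF same_space_yd_tensor]

lemma bilin_cong [cong]:
  assumes "\<And>x y. x \<in> carrier U \<Longrightarrow> y \<in> carrier V \<Longrightarrow> \<beta> x y = \<gamma> x y"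
  shows "bilin U V W \<beta> = bilin U V W \<gamma>"
  using assms lin_cong[of U "\<lambda>x. \<beta> x y" "\<lambda>x. \<gamma> x y" W for y] lin_cong[of V "\<beta> x" "\<gamma> x" W for x]
  by (auto simp: bilin_def)

section \<open>Linear extensions and tensor products of maps\<close>

lemma lin_ext_linear:
  assumes "bilin V W X \<beta>"
  shows "lin_ext K V W X \<beta> \<in> linear_maps K (V \<boxtimes> W) X"
proof -
  have mods: "module K V" "module K W" "module K X"
    using assms by (simp_all add: bilin_def)
  have "lin (V \<boxtimes> W) X (\<lambda>t. tsum V W X t \<beta>)"
    using assms mods by simp
  moreover have "lin (V \<boxtimes> W) X (lin_ext K V W X \<beta>) = lin (V \<boxtimes> W) X (\<lambda>t. tsum V W X t \<beta>)"
    using mods by (intro lin_cong) (simp add: lin_ext_eq_tsum)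
  ultimately show ?thesis
    using mods by (simp add: linear_maps_iff lin_ext_def)
qed

lemma tensor_map_linear:
  assumes "lin V V' f" "lin W W' g"
  shows "tensor_map K V W V' W' f g \<in> linear_maps K (V \<boxtimes> W) (V' \<boxtimes> W')"
proof -
  have mods: "module K V" "module K W" "module K V'" "module K W'"
    using assms by (simp_all add: lin_def)
  note closed = lin_closed[OF assms(1)] lin_closed[OF assms(2)]
  have "lin (V \<boxtimes> W) (V' \<boxtimes> W') (\<lambda>t. tsum V W (V' \<boxtimes> W') t (\<lambda>x y. pure K V' W' (f x) (g y)))"
    using assms mods by (simp add: closed)
  moreover have "lin (V \<boxtimes> W) (V' \<boxtimes> W') (tensor_map K V W V' W' f g) =
      lin (V \<boxtimes> W) (V' \<boxtimes> W') (\<lambda>t. tsum V W (V' \<boxtimes> W') t (\<lambda>x y. pure K V' W' (f x) (g y)))"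
    using mods by (intro lin_cong) (simp add: tensor_map_eq_tsum closed)
  ultimately show ?thesis
    using mods by (simp add: linear_maps_iff tensor_map_def)
qed

lemma tensor_map_pure:
  assumes "lin V V' f" "lin W W' g" "x \<in> carrier V" "y \<in> carrier W"
  shows "tensor_map K V W V' W' f g (pure K V W x y) = pure K V' W' (f x) (g y)"
  using assms lin_module[OF assms(1)] lin_module[OF assms(2)]
    lin_closed[OF assms(1)] lin_closed[OF assms(2)]
  by (simp add: tensor_map_eq_tsum)

lemma lin_ext_pure:
  assumes "bilin V W X \<beta>" "x \<in> carrier V" "y \<in> carrier W"
  shows "lin_ext K V W X \<beta> (pure K V W x y) = \<beta> x y"
  using assms by (simp add: lin_ext_eq_tsum bilin_def)

lemma tensor_endo_eq_id:
  assumes "lin (V \<boxtimes> W) (V \<boxtimes> W) f" "module K V" "module K W"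
    "\<And>x y. x \<in> carrier V \<Longrightarrow> y \<in> carrier W \<Longrightarrow> f (pure K V W x y) = pure K V W x y"
    "t \<in> carrier (V \<boxtimes> W)"
  shows "f t = t"
  using tensor_ext[of V W "V \<boxtimes> W" f "\<lambda>t. t"] assms by simp

end

context bijective_hom_bialgebra
begin

section \<open>Twist, action and coaction of a tensor product\<close>

lemma yd_tensor_twist: "twist (yd_tensor K H M N) = tensor_map K M N M N (twist M) (twist N)"
  by (simp add: yd_tensor_def Let_def)

lemma yd_tensor_twist_pure [simp]:
  assumes "twisted M" "twisted N" "m \<in> carrier M" "n \<in> carrier N"
  shows "twist (yd_tensor K H M N) (pure K M N m n) = pure K M N (twist M m) (twist N n)"
  using assms by (simp add: yd_tensor_twist tensor_map_pure lin_twist_aux)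

text \<open>The tensor product of the two inverse twists is the inverse: both composites are linear
  and fix pure tensors.\<close>

lemma twisted_yd_tensor [simp]:
  assumes "twisted M" "twisted N"
  shows "twisted (yd_tensor K H M N)"
proof -
  have mods [simp]: "module K M" "module K N" using assms by (simp_all add: twisted_module)
  let ?t = "tensor_map K M N M N (twist M) (twist N)"
  let ?u = "tensor_map K M N M N (untwist M) (untwist N)"
  have t: "?t \<in> linear_maps K (M \<boxtimes> N) (M \<boxtimes> N)" and u: "?u \<in> linear_maps K (M \<boxtimes> N) (M \<boxtimes> N)"
    using assms by (simp_all add: tensor_map_linear lin_twist_aux lin_untwist_aux)
  then have lt: "lin (M \<boxtimes> N) (M \<boxtimes> N) ?t" and lu: "lin (M \<boxtimes> N) (M \<boxtimes> N) ?u"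
    by (simp_all add: linear_maps_iff)
  note pure = tensor_map_pure lin_twist_aux lin_untwist_aux
  have "?u (?t x) = x" if "x \<in> carrier (M \<boxtimes> N)" for x
    by (rule tensor_endo_eq_id[OF lin_compose[OF lu lt] mods _ that]) (simp add: pure assms)
  moreover have "?t (?u x) = x" if "x \<in> carrier (M \<boxtimes> N)" for x
    by (rule tensor_endo_eq_id[OF lin_compose[OF lt lu] mods _ that]) (simp add: pure assms)
  ultimately have "bij_betw ?t (carrier (M \<boxtimes> N)) (carrier (M \<boxtimes> N))"
    by (intro bij_betw_byWitness[where f'="?u"]) (auto simp: lin_closed[OF lt] lin_closed[OF lu])
  with t show ?thesis
    by (simp add: twisted_def yd_tensor_twist)
qed

lemma yd_tensor_untwist_pure [simp]:
  assumes "twisted M" "twisted N" "m \<in> carrier M" "n \<in> carrier N"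
  shows "untwist (yd_tensor K H M N) (pure K M N m n) = pure K M N (untwist M m) (untwist N n)"
  using assms by (intro untwist_eqI) simp_all

lemma yd_tensor_action:
  "action (yd_tensor K H M N) = lin_ext K H (M \<boxtimes> N) (M \<boxtimes> N) (\<lambda>h t.
     sweedler (M \<boxtimes> N) t (\<lambda>m n.
       sweedler (M \<boxtimes> N) (\<Delta>\<^bsub>H\<^esub> h) (\<lambda>h1 h2.
         pure K M N (act K H M h1 m) (act K H N h2 n))))"
  by (simp add: yd_tensor_def Let_def)

lemma yd_tensor_coaction:
  "\<lambda>c\<^bsub>yd_tensor K H M N\<^esub> = lin_ext K M N (H \<boxtimes> M \<boxtimes> N) (\<lambda>m n.
     sweedler (H \<boxtimes> M \<boxtimes> N) (\<lambda>c\<^bsub>M\<^esub> m) (\<lambda>m' m0.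
       sweedler (H \<boxtimes> M \<boxtimes> N) (\<lambda>c\<^bsub>N\<^esub> n) (\<lambda>n' n0.
         pure K H (M \<boxtimes> N) (untwist H (untwist H (hmul K H m' n'))) (pure K M N m0 n0))))"
  by (simp add: yd_tensor_def Let_def untwist_def)

lemma yd_tensor_data [simp]:
  assumes [simp]: "yd_data M" "yd_data N"
  shows "yd_data (yd_tensor K H M N)"
  unfolding yd_data_def
proof (intro conjI)
  show "action (yd_tensor K H M N) \<in> linear_maps K (H \<boxtimes> yd_tensor K H M N) (yd_tensor K H M N)"
    unfolding yd_tensor_action yd_tensor_space
    by (rule lin_ext_linear)
      (simp add: comult_eq act_eq sweedler_eq_tsum[of M N] sweedler_eq_tsum[of H H])
  show "\<lambda>c\<^bsub>yd_tensor K H M N\<^esub> \<in> linear_maps K (yd_tensor K H M N) (H \<boxtimes> yd_tensor K H M N)"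
    unfolding yd_tensor_coaction yd_tensor_space
    by (rule lin_ext_linear)
      (simp add: coaction_eq hmul_eq sweedler_eq_tsum[of H M] sweedler_eq_tsum[of H N])
qed simp

text \<open>Instances of the general rules with their spaces already in normal form. Once
  \<open>yd_tensor_space\<close> has rewritten a goal, the general statements no longer match
  it.\<close>

lemmas yd_tensor_rules [simp] =
  lin_twist[of "yd_tensor K H M N" for M N, unfolded yd_tensor_space]
  lin_untwist[of "yd_tensor K H M N" for M N, unfolded yd_tensor_space]
  twist_closed[of "yd_tensor K H M N" for M N, unfolded yd_tensor_carrier]
  untwist_closed[of "yd_tensor K H M N" for M N, unfolded yd_tensor_carrier]
  twist_untwist[of "yd_tensor K H M N" for M N, unfolded yd_tensor_carrier]
  untwist_twist[of "yd_tensor K H M N" for M N, unfolded yd_tensor_carrier]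
  twist_tsum[of "yd_tensor K H M N" for M N, unfolded yd_tensor_space yd_tensor_carrier]
  untwist_tsum[of "yd_tensor K H M N" for M N, unfolded yd_tensor_space yd_tensor_carrier]
  lin_ac_left[of "yd_tensor K H M N" for M N, unfolded yd_tensor_space yd_tensor_carrier]
  lin_ac_right[of "yd_tensor K H M N" for M N, unfolded yd_tensor_space yd_tensor_carrier]
  ac_closed[of "yd_tensor K H M N" for M N, unfolded yd_tensor_carrier]
  lin_co[of "yd_tensor K H M N" for M N, unfolded yd_tensor_space yd_tensor_carrier]
  co_closed[of "yd_tensor K H M N" for M N, unfolded yd_tensor_space yd_tensor_carrier]
  ac_tsum_right[of "yd_tensor K H M N" for M N, unfolded yd_tensor_space yd_tensor_carrier]
  co_tsum[of "yd_tensor K H M N" for M N, unfolded yd_tensor_space yd_tensor_carrier]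

lemma ac_yd_tensor_pure [simp]:
  assumes [simp]: "M \<in> Ob" "N \<in> Ob" "h \<in> carrier H" "m \<in> carrier M" "n \<in> carrier N"
  shows "ac (yd_tensor K H M N) h (pure K M N m n) =
    tsum H H (M \<boxtimes> N) (comul h) (\<lambda>g k. pure K M N (ac M (twist H g) m) (ac N (twist H k) n))"
proof -
  \<comment> \<open>The twist of \<open>h\<close> is kept inside \<open>comul\<close> and the other
    twists outside \<open>ac\<close>, so that untwisting the tensor product cancels the latter
    before the former is distributed over the legs.\<close>
  have "act K H (yd_tensor K H M N) h (pure K M N m n) =
    tsum H H (M \<boxtimes> N) (comul (twist H h)) (\<lambda>g k. pure K M N (twist M (ac M g m)) (twist N (ac N k n)))"
    unfolding act_def[of K H "yd_tensor K H M N"] yd_tensor_action yd_tensor_space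
    by (subst lin_ext_pure)
      (simp_all add: comult_eq act_eq sweedler_eq_tsum[of M N] sweedler_eq_tsum[of H H]
        del: twist_ac tsum_comul_twist)
  then have "ac (yd_tensor K H M N) h (pure K M N m n) = untwist (yd_tensor K H M N) \<dots>"
    by (simp only: ac_def)
  also have "\<dots> = tsum H H (M \<boxtimes> N) (comul (twist H h)) (\<lambda>g k. pure K M N (ac M g m) (ac N k n))"
    by (simp del: twist_ac tsum_comul_twist)
  finally show ?thesis by simp
qed

text \<open>Since \<open>hmul\<close> contributes one twist, a single inverse twist remains of the
  \<alpha>^-2 in the definition, and it spreads over the two factors.\<close>

lemma co_yd_tensor_pure [simp]:
  assumes [simp]: "M \<in> Ob" "N \<in> Ob" "m \<in> carrier M" "n \<in> carrier N"
  shows "co (yd_tensor K H M N) (pure K M N m n) =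
    tsum H M (H \<boxtimes> M \<boxtimes> N) (co M m) (\<lambda>a p. tsum H N (H \<boxtimes> M \<boxtimes> N) (co N n) (\<lambda>b q.
      pure K H (M \<boxtimes> N) (mul (untwist H a) (untwist H b)) (pure K M N p q)))"
  unfolding co_def[of "yd_tensor K H M N"] yd_tensor_coaction
  by (subst yd_tensor_untwist_pure, simp_all, subst lin_ext_pure)
    (simp_all add: coaction_eq hmul_eq sweedler_eq_tsum[of H M] sweedler_eq_tsum[of H N])

section \<open>Yetter-Drinfeld axioms for a tensor product\<close>

lemma yd_tensor_twist_ac:
  assumes [simp]: "M \<in> Ob" "N \<in> Ob" and h [simp]: "h \<in> carrier H" and t: "t \<in> carrier (M \<boxtimes> N)"
  shows "twist (yd_tensor K H M N) (ac (yd_tensor K H M N) h t) =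
    ac (yd_tensor K H M N) (twist H h) (twist (yd_tensor K H M N) t)"
  by (rule tensor_ext[where V=M and W=N and X="M \<boxtimes> N" and f="\<lambda>t. twist (yd_tensor K H M N) (ac (yd_tensor K H M N) h t)"
        and g="\<lambda>t. ac (yd_tensor K H M N) (twist H h) (twist (yd_tensor K H M N) t)"]) (simp_all add: t)

text \<open>By multiplicativity of \<open>comul\<close> and the module axiom in each factor, both
  sides are double sums over the legs of \<open>g\<close> and \<open>h\<close>, taken in opposite
  orders.\<close>

lemma yd_tensor_ac_ac:
  assumes [simp]: "M \<in> Ob" "N \<in> Ob" "g \<in> carrier H" "h \<in> carrier H" and t: "t \<in> carrier (M \<boxtimes> N)"
  shows "ac (yd_tensor K H M N) g (ac (yd_tensor K H M N) h t) = ac (yd_tensor K H M N) (mul g h) t"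
proof (rule tensor_ext[where V=M and W=N and X="M \<boxtimes> N" and f="\<lambda>t. ac (yd_tensor K H M N) g (ac (yd_tensor K H M N) h t)"
        and g="\<lambda>t. ac (yd_tensor K H M N) (mul g h) t"])
  fix m n assume [simp]: "m \<in> carrier M" "n \<in> carrier N"
  show "ac (yd_tensor K H M N) g (ac (yd_tensor K H M N) h (pure K M N m n)) =
      ac (yd_tensor K H M N) (mul g h) (pure K M N m n)"
    by simp (rule tsum_swap, simp_all)
qed (simp_all add: t)

lemma yd_tensor_co_twist:
  assumes [simp]: "M \<in> Ob" "N \<in> Ob" and t: "t \<in> carrier (M \<boxtimes> N)"
  shows "co (yd_tensor K H M N) (twist (yd_tensor K H M N) t) =
    tsum H (M \<boxtimes> N) (H \<boxtimes> M \<boxtimes> N) (co (yd_tensor K H M N) t)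
      (\<lambda>a n. pure K H (M \<boxtimes> N) (twist H a) (twist (yd_tensor K H M N) n))"
  by (rule tensor_ext[where V=M and W=N and X="H \<boxtimes> M \<boxtimes> N" and f="\<lambda>t. co (yd_tensor K H M N) (twist (yd_tensor K H M N) t)"
        and g="\<lambda>t. tsum H (M \<boxtimes> N) (H \<boxtimes> M \<boxtimes> N) (co (yd_tensor K H M N) t)
      (\<lambda>a n. pure K H (M \<boxtimes> N) (twist H a) (twist (yd_tensor K H M N) n))"])
    (simp_all add: t)

text \<open>Multiplicativity of \<open>comul\<close> splits the comultiplied product of two coaction
  legs, after which coassociativity of \<open>M\<close> and of \<open>N\<close> applies. The
  exchanges bring each \<open>comul\<close> next to the coaction whose leg it splits.\<close>

lemma yd_tensor_coassoc:
  assumes [simp]: "M \<in> Ob" "N \<in> Ob" and t: "t \<in> carrier (M \<boxtimes> N)"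
  defines "T \<equiv> yd_tensor K H M N" and "X \<equiv> H \<boxtimes> H \<boxtimes> M \<boxtimes> N"
  shows "tsum H (M \<boxtimes> N) X (co T t) (\<lambda>a n. tsum H H X (comul a) (\<lambda>p q.
          pure K H (H \<boxtimes> M \<boxtimes> N) p (pure K H (M \<boxtimes> N) q n))) =
        tsum H (M \<boxtimes> N) X (co T t) (\<lambda>a n. tsum H (M \<boxtimes> N) X (co T n) (\<lambda>p q.
          pure K H (H \<boxtimes> M \<boxtimes> N) a (pure K H (M \<boxtimes> N) p q)))"
    (is "?f t = ?g t")
proof (rule tensor_ext[where V=M and W=N and X=X and f="?f" and g="?g"])
  show "lin (M \<boxtimes> N) X ?f" "lin (M \<boxtimes> N) X ?g" unfolding T_def X_def by simp_all
  fix m n assume [simp]: "m \<in> carrier M" "n \<in> carrier N"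
  let ?F = "\<lambda>a b c d p q. pure K H (H \<boxtimes> M \<boxtimes> N) (mul (untwist H a) (untwist H b))
    (pure K H (M \<boxtimes> N) (mul (untwist H c) (untwist H d)) (pure K M N p q))"
  have "?f (pure K M N m n) = tsum H M X (co M m) (\<lambda>a p. tsum H N X (co N n) (\<lambda>b q.
      tsum H H X (comul a) (\<lambda>a c. tsum H H X (comul b) (\<lambda>b d. ?F a b c d p q))))"
    unfolding T_def X_def by simp
  also have "\<dots> = tsum H M X (co M m) (\<lambda>a p. tsum H H X (comul a) (\<lambda>a c.
      tsum H N X (co N n) (\<lambda>b q. tsum H H X (comul b) (\<lambda>b d. ?F a b c d p q))))"
    unfolding X_def by (intro tsum_cong HOL.refl tsum_swap) simp_all
  also have "\<dots> = tsum H M X (co M m) (\<lambda>a p. tsum H M X (co M p) (\<lambda>x p.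
      tsum H N X (co N n) (\<lambda>b q. tsum H N X (co N q) (\<lambda>d q. ?F a b x d p q))))"
    unfolding X_def by (simp add: co_coassoc)
  also have "\<dots> = tsum H M X (co M m) (\<lambda>a p. tsum H N X (co N n) (\<lambda>b q.
      tsum H M X (co M p) (\<lambda>x p. tsum H N X (co N q) (\<lambda>d q. ?F a b x d p q))))"
    unfolding X_def by (intro tsum_cong HOL.refl tsum_swap) simp_all
  also have "\<dots> = ?g (pure K M N m n)"
    unfolding T_def X_def by simp
  finally show "?f (pure K M N m n) = ?g (pure K M N m n)" .
qed (simp_all add: t)

text \<open>Coassociativity regroups the three legs of \<open>h\<close> so that the last two feed
  the condition in \<open>N\<close>, and then so that the first two feed the condition in
  \<open>M\<close>. The exchanges of sums place each condition where it can be applied.\<close>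

lemma yd_tensor_yd:
  assumes [simp]: "M \<in> Ob" "N \<in> Ob" and h [simp]: "h \<in> carrier H" and t: "t \<in> carrier (M \<boxtimes> N)"
  defines "T \<equiv> yd_tensor K H M N" and "X \<equiv> H \<boxtimes> M \<boxtimes> N"
  shows "tsum H H X (comul h) (\<lambda>g k. tsum H (M \<boxtimes> N) X (co T (ac T g t)) (\<lambda>a n. pure K H (M \<boxtimes> N) (mul a k) n)) =
    tsum H H X (comul h) (\<lambda>g k. tsum H (M \<boxtimes> N) X (co T t) (\<lambda>a n. pure K H (M \<boxtimes> N) (mul g a) (ac T k n)))"
    (is "?f t = ?g t")
proof (rule tensor_ext[where V=M and W=N and X=X and f="?f" and g="?g"])
  show "lin (M \<boxtimes> N) X ?f" "lin (M \<boxtimes> N) X ?g" unfolding T_def X_def by simp_all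
  fix m n assume [simp]: "m \<in> carrier M" "n \<in> carrier N"
  \<comment> \<open>The action on a tensor product twists the legs of the acting element; writing
    \<open>h\<close> as an untwisted element cancels these twists.\<close>
  define l where "l = twist H h"
  have l [simp]: "l \<in> carrier H" and hl: "h = untwist H l" by (simp_all add: l_def)
  let ?F = "\<lambda>a b c p q. pure K H (M \<boxtimes> N) (mul (untwist H a) (mul (untwist H b) (untwist H c))) (pure K M N p q)"
  have "?f (pure K M N m n) = tsum H H X (comul l) (\<lambda>g k. tsum H H X (comul g) (\<lambda>g1 g2.
      tsum H M X (co M (ac M g1 m)) (\<lambda>a p. tsum H N X (co N (ac N g2 n)) (\<lambda>b q. ?F a b k p q))))"
    unfolding hl T_def X_def by simp
  also have "\<dots> = tsum H H X (comul l) (\<lambda>g1 r. tsum H H X (comul r) (\<lambda>g2 k.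
      tsum H M X (co M (ac M g1 m)) (\<lambda>a p. tsum H N X (co N (ac N g2 n)) (\<lambda>b q. ?F a b k p q))))"
    unfolding X_def by (rule comul_coassoc) simp_all
  also have "\<dots> = tsum H H X (comul l) (\<lambda>g1 r. tsum H M X (co M (ac M g1 m)) (\<lambda>a p.
      tsum H H X (comul r) (\<lambda>g2 k. tsum H N X (co N (ac N g2 n)) (\<lambda>b q. ?F a b k p q))))"
    unfolding X_def by (intro tsum_cong HOL.refl tsum_swap) simp_all
  \<comment> \<open>The condition in \<open>N\<close> for the legs of \<open>r\<close>, with the
    contribution of \<open>M\<close> as a parameter: \<open>k\<close> stops multiplying the coaction
    and acts on \<open>q\<close> instead.\<close>
  also have "\<dots> = tsum H H X (comul l) (\<lambda>g1 r. tsum H M X (co M (ac M g1 m)) (\<lambda>a p.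
      tsum H H X (comul r) (\<lambda>g2 k. tsum H N X (co N n) (\<lambda>b q. ?F a g2 b p (ac N k q)))))"
    (is "tsum _ _ _ _ (\<lambda>g1 r. tsum _ _ _ (?c g1 r) (\<lambda>a p. ?l a p r)) =
      tsum _ _ _ _ (\<lambda>g1 r. tsum _ _ _ _ (\<lambda>a p. ?r a p r))")
  proof (rule tsum_cong[OF HOL.refl], rule tsum_cong[OF HOL.refl])
    fix r a p assume [simp]: "r \<in> carrier H" "a \<in> carrier H" "p \<in> carrier M"
    have "bilin H N X (\<lambda>x q. pure K H (M \<boxtimes> N) (mul (untwist H a) (untwist H x)) (pure K M N p q))"
      unfolding X_def by simp
    from yd_condition[OF _ _ _ this, of r n] show "?l a p r = ?r a p r"
      unfolding X_def by simp
  qed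
  also have "\<dots> = tsum H H X (comul l) (\<lambda>g1 r. tsum H H X (comul r) (\<lambda>g2 k.
      tsum H M X (co M (ac M g1 m)) (\<lambda>a p. tsum H N X (co N n) (\<lambda>b q. ?F a g2 b p (ac N k q)))))"
    unfolding X_def by (intro tsum_cong HOL.refl tsum_swap) simp_all
  also have "\<dots> = tsum H H X (comul l) (\<lambda>g1 r. tsum H H X (comul r) (\<lambda>g2 k.
      tsum H N X (co N n) (\<lambda>b q. tsum H M X (co M (ac M g1 m)) (\<lambda>a p. ?F a g2 b p (ac N k q)))))"
    unfolding X_def by (intro tsum_cong HOL.refl tsum_swap) simp_all
  also have "\<dots> = tsum H H X (comul l) (\<lambda>g k. tsum H H X (comul g) (\<lambda>g1 g2.
      tsum H N X (co N n) (\<lambda>b q. tsum H M X (co M (ac M g1 m)) (\<lambda>a p. ?F a g2 b p (ac N k q)))))"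
    unfolding X_def by (rule comul_coassoc[symmetric]) simp_all
  also have "\<dots> = tsum H H X (comul l) (\<lambda>g k. tsum H N X (co N n) (\<lambda>b q.
      tsum H H X (comul g) (\<lambda>g1 g2. tsum H M X (co M (ac M g1 m)) (\<lambda>a p. ?F a g2 b p (ac N k q)))))"
    unfolding X_def by (intro tsum_cong HOL.refl tsum_swap) simp_all
  \<comment> \<open>The condition in \<open>M\<close> for the legs of \<open>g\<close>, with the
    coaction of \<open>n\<close> and the action of \<open>k\<close> as parameters.\<close>
  also have "\<dots> = tsum H H X (comul l) (\<lambda>g k. tsum H N X (co N n) (\<lambda>b q.
      tsum H H X (comul g) (\<lambda>g1 g2. tsum H M X (co M m) (\<lambda>a p. ?F g1 a b (ac M g2 p) (ac N k q)))))"
    (is "tsum _ _ _ _ (\<lambda>g k. tsum _ _ _ _ (\<lambda>b q. ?l g k b q)) =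
      tsum _ _ _ _ (\<lambda>g k. tsum _ _ _ _ (\<lambda>b q. ?r g k b q))")
  proof (rule tsum_cong[OF HOL.refl], rule tsum_cong[OF HOL.refl])
    fix g k b q assume [simp]: "g \<in> carrier H" "k \<in> carrier H" "b \<in> carrier H" "q \<in> carrier N"
    have "bilin H M X (\<lambda>x p. pure K H (M \<boxtimes> N) (mul (untwist H x) (untwist H b)) (pure K M N p (ac N k q)))"
      unfolding X_def by simp
    from yd_condition[OF _ _ _ this, of g m] show "?l g k b q = ?r g k b q"
      unfolding X_def by simp
  qed
  also have "\<dots> = tsum H H X (comul l) (\<lambda>g k. tsum H H X (comul g) (\<lambda>g1 g2. tsum H N X (co N n) (\<lambda>b q.
       tsum H M X (co M m) (\<lambda>a p. ?F g1 a b (ac M g2 p) (ac N k q)))))"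
    unfolding X_def by (intro tsum_cong HOL.refl tsum_swap) simp_all
  also have "\<dots> = tsum H H X (comul l) (\<lambda>g1 r. tsum H H X (comul r) (\<lambda>g2 k. tsum H N X (co N n) (\<lambda>b q.
       tsum H M X (co M m) (\<lambda>a p. ?F g1 a b (ac M g2 p) (ac N k q)))))"
    unfolding X_def by (rule comul_coassoc) simp_all
  also have "\<dots> = tsum H H X (comul l) (\<lambda>g1 r. tsum H H X (comul r) (\<lambda>g2 k. tsum H M X (co M m) (\<lambda>a p.
       tsum H N X (co N n) (\<lambda>b q. ?F g1 a b (ac M g2 p) (ac N k q)))))"
    unfolding X_def by (intro tsum_cong HOL.refl tsum_swap) simp_all
  also have "\<dots> = ?g (pure K M N m n)"
    unfolding hl T_def X_def
    by (simp add: tsum_swap[of "H \<boxtimes> M \<boxtimes> N" H M H H] tsum_swap[of "H \<boxtimes> M \<boxtimes> N" H N H H])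
  finally show "?f (pure K M N m n) = ?g (pure K M N m n)" .
qed (simp_all add: t)

lemma yd_tensor_Ob [simp]: "M \<in> Ob \<Longrightarrow> N \<in> Ob \<Longrightarrow> yd_tensor K H M N \<in> Ob"
  by (rule ObI)
    (unfold yd_tensor_space yd_tensor_carrier,
      simp_all add: yd_tensor_twist_ac yd_tensor_ac_ac yd_tensor_co_twist yd_tensor_coassoc yd_tensor_yd)

end

section \<open>Morphisms\<close>

context scalars
begin

section \<open>Linear maps on iterated tensor products\<close>

lemma tensor_ext3_left:
  assumes f: "lin ((U \<boxtimes> V) \<boxtimes> W) X f" and g: "lin ((U \<boxtimes> V) \<boxtimes> W) X g"
    and mods [simp]: "module K U" "module K V" "module K W"
    and eq: "\<And>x y z. x \<in> carrier U \<Longrightarrow> y \<in> carrier V \<Longrightarrow> z \<in> carrier W \<Longrightarrow>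
      f (pure K (U \<boxtimes> V) W (pure K U V x y) z) = g (pure K (U \<boxtimes> V) W (pure K U V x y) z)"
    and t: "t \<in> carrier ((U \<boxtimes> V) \<boxtimes> W)"
  shows "f t = g t"
proof (rule tensor_ext[OF f g _ _ _ t])
  fix s z assume s: "s \<in> carrier (U \<boxtimes> V)" and z: "z \<in> carrier W"
  have "lin (U \<boxtimes> V) X (\<lambda>s. f (pure K (U \<boxtimes> V) W s z))" "lin (U \<boxtimes> V) X (\<lambda>s. g (pure K (U \<boxtimes> V) W s z))"
    by (rule lin_compose[OF f] lin_compose[OF g], simp add: z)+
  then show "f (pure K (U \<boxtimes> V) W s z) = g (pure K (U \<boxtimes> V) W s z)"
    by (rule tensor_ext) (simp_all add: eq s z)
qed simp_all

lemma tensor_ext3_right: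
  assumes f: "lin (U \<boxtimes> V \<boxtimes> W) X f" and g: "lin (U \<boxtimes> V \<boxtimes> W) X g"
    and mods [simp]: "module K U" "module K V" "module K W"
    and eq: "\<And>x y z. x \<in> carrier U \<Longrightarrow> y \<in> carrier V \<Longrightarrow> z \<in> carrier W \<Longrightarrow>
      f (pure K U (V \<boxtimes> W) x (pure K V W y z)) = g (pure K U (V \<boxtimes> W) x (pure K V W y z))"
    and t: "t \<in> carrier (U \<boxtimes> V \<boxtimes> W)"
  shows "f t = g t"
proof (rule tensor_ext[OF f g _ _ _ t])
  fix x s assume x: "x \<in> carrier U" and s: "s \<in> carrier (V \<boxtimes> W)"
  have "lin (V \<boxtimes> W) X (\<lambda>s. f (pure K U (V \<boxtimes> W) x s))" "lin (V \<boxtimes> W) X (\<lambda>s. g (pure K U (V \<boxtimes> W) x s))"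
    by (rule lin_compose[OF f] lin_compose[OF g], simp add: x)+
  then show "f (pure K U (V \<boxtimes> W) x s) = g (pure K U (V \<boxtimes> W) x s)"
    by (rule tensor_ext) (simp_all add: eq s x)
qed simp_all

lemma tensor_ext4:
  assumes f: "lin (((U \<boxtimes> V) \<boxtimes> W) \<boxtimes> Z) X f" and g: "lin (((U \<boxtimes> V) \<boxtimes> W) \<boxtimes> Z) X g"
    and mods [simp]: "module K U" "module K V" "module K W" "module K Z"
    and eq: "\<And>x y z w. x \<in> carrier U \<Longrightarrow> y \<in> carrier V \<Longrightarrow> z \<in> carrier W \<Longrightarrow> w \<in> carrier Z \<Longrightarrow>
      f (pure K ((U \<boxtimes> V) \<boxtimes> W) Z (pure K (U \<boxtimes> V) W (pure K U V x y) z) w) =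
      g (pure K ((U \<boxtimes> V) \<boxtimes> W) Z (pure K (U \<boxtimes> V) W (pure K U V x y) z) w)"
    and t: "t \<in> carrier (((U \<boxtimes> V) \<boxtimes> W) \<boxtimes> Z)"
  shows "f t = g t"
proof (rule tensor_ext[OF f g _ _ _ t])
  fix s w assume s: "s \<in> carrier ((U \<boxtimes> V) \<boxtimes> W)" and w: "w \<in> carrier Z"
  have "lin ((U \<boxtimes> V) \<boxtimes> W) X (\<lambda>s. f (pure K ((U \<boxtimes> V) \<boxtimes> W) Z s w))"
    "lin ((U \<boxtimes> V) \<boxtimes> W) X (\<lambda>s. g (pure K ((U \<boxtimes> V) \<boxtimes> W) Z s w))"
    by (rule lin_compose[OF f] lin_compose[OF g], simp add: w)+
  then show "f (pure K ((U \<boxtimes> V) \<boxtimes> W) Z s w) = g (pure K ((U \<boxtimes> V) \<boxtimes> W) Z s w)"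
    by (rule tensor_ext3_left) (simp_all add: eq s w)
qed simp_all

lemma lin_tensor_map [simp]:
  assumes "lin V V' f" "lin W W' g" "lin U (V \<boxtimes> W) h"
  shows "lin U (V' \<boxtimes> W') (\<lambda>x. tensor_map K V W V' W' f g (h x))"
proof -
  have "lin (V \<boxtimes> W) (V' \<boxtimes> W') (tensor_map K V W V' W' f g)"
    using tensor_map_linear[OF assms(1,2)] lin_module[OF assms(1)] lin_module[OF assms(2)]
    by (simp add: linear_maps_iff)
  then show ?thesis using assms(3) by (rule lin_compose)
qed

lemma tensor_map_tsum [simp]:
  assumes "lin V V' f" "lin W W' g"
    "\<And>x y. x \<in> carrier A \<Longrightarrow> y \<in> carrier B \<Longrightarrow> \<beta> x y \<in> carrier (V \<boxtimes> W)"
  shows "tensor_map K V W V' W' f g (tsum A B (V \<boxtimes> W) t \<beta>) =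
    tsum A B (V' \<boxtimes> W') t (\<lambda>x y. tensor_map K V W V' W' f g (\<beta> x y))"
  using lin_module[OF assms(1)] lin_module[OF assms(2)]
  by (intro lin_tsum lin_tensor_map assms lin_id module_tensor)

lemma tensor_map_closed [simp]:
  assumes "lin V V' f" "lin W W' g" "t \<in> carrier (V \<boxtimes> W)"
  shows "tensor_map K V W V' W' f g t \<in> carrier (V' \<boxtimes> W')"
  using lin_closed[OF lin_tensor_map[OF assms(1,2) lin_id] assms(3)]
    lin_module[OF assms(1)] lin_module[OF assms(2)] by simp

end

context bijective_hom_bialgebra
begin

section \<open>Morphisms in untwisted form\<close>

definition mor :: "('k, 'a) yd \<Rightarrow> ('k, 'a) yd \<Rightarrow> ('a univ \<Rightarrow> 'a univ) \<Rightarrow> bool" where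
  "mor M N f \<longleftrightarrow> module_morphism K H M N f \<and> comodule_morphism K H M N f"

lemma mor_linear: "mor M N f \<Longrightarrow> f \<in> linear_maps K M N"
  by (simp add: mor_def module_morphism_def)

lemma mor_lin: "M \<in> Ob \<Longrightarrow> N \<in> Ob \<Longrightarrow> mor M N f \<Longrightarrow> lin M N f"
  using mor_linear[of M N f] by (simp add: linear_maps_iff)

lemma mor_twist: "mor M N f \<Longrightarrow> m \<in> carrier M \<Longrightarrow> f (twist M m) = twist N (f m)"
  by (simp add: mor_def module_morphism_def)

lemma mor_untwist:
  assumes "M \<in> Ob" "N \<in> Ob" "mor M N f" "m \<in> carrier M"
  shows "f (untwist M m) = untwist N (f m)"
  using assms mor_twist[OF assms(3), of "untwist M m"] lin_closed[OF mor_lin[OF assms(1-3)]]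
  by (intro untwist_eqI[symmetric]) simp_all

lemma mor_ac:
  assumes "M \<in> Ob" "N \<in> Ob" "mor M N f" "h \<in> carrier H" "m \<in> carrier M"
  shows "f (ac M h m) = ac N h (f m)"
proof -
  have "f (act K H M h m) = act K H N h (f m)"
    using assms by (simp add: mor_def module_morphism_def)
  then have "untwist N (f (twist M (ac M h m))) = untwist N (twist N (ac N h (f m)))"
    using assms lin_closed[OF mor_lin[OF assms(1-3)]] by (simp add: act_eq del: twist_ac)
  then show ?thesis
    using assms lin_closed[OF mor_lin[OF assms(1-3)]] by (simp add: mor_twist del: twist_ac)
qed

text \<open>Colinearity of \<open>f\<close>, composed with an arbitrary bilinear summand so that it
  can be used inside other sums.\<close>

lemma mor_tsum_co:
  assumes "M \<in> Ob" "N \<in> Ob" "mor M N f" "m \<in> carrier M" "bilin H N X \<beta>"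
  shows "tsum H N X (co N (f m)) \<beta> = tsum H M X (co M m) (\<lambda>a p. \<beta> a (f p))"
proof -
  note [simp] = lin_closed[OF mor_lin[OF assms(1-3)]]
  have "tensor_map K H M H N id f (\<lambda>c\<^bsub>M\<^esub> (untwist M m)) = \<lambda>c\<^bsub>N\<^esub> (f (untwist M m))"
    using assms by (simp add: mor_def comodule_morphism_def)
  then have "tsum H M (H \<boxtimes> N) (co M m) (\<lambda>a p. pure K H N a (f p)) = co N (f m)"
    using assms by (simp add: coaction_eq tensor_map_eq_tsum flip: mor_twist[OF assms(3)])
  then show ?thesis
    using assms by (simp flip: \<open>_ = co N (f m)\<close>)
qed

lemma morI:
  assumes M [simp]: "M \<in> Ob" and N [simp]: "N \<in> Ob" and f: "f \<in> linear_maps K M N"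
    and twist: "\<And>m. m \<in> carrier M \<Longrightarrow> f (twist M m) = twist N (f m)"
    and ac: "\<And>h m. h \<in> carrier H \<Longrightarrow> m \<in> carrier M \<Longrightarrow> f (ac M h m) = ac N h (f m)"
    and co: "\<And>m. m \<in> carrier M \<Longrightarrow> co N (f m) = tsum H M (H \<boxtimes> N) (co M m) (\<lambda>a p. pure K H N a (f p))"
  shows "mor M N f"
proof -
  have "lin M N f" using f by (simp add: linear_maps_iff)
  note [simp] = lin_closed[OF this]
  have "f (act K H M h m) = act K H N h (f m)" if "h \<in> carrier H" "m \<in> carrier M" for h m
    using that by (simp add: act_eq twist ac del: twist_ac)
  moreover have "tensor_map K H M H N id f (\<lambda>c\<^bsub>M\<^esub> m) = \<lambda>c\<^bsub>N\<^esub> (f m)" if "m \<in> carrier M" for m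
    using that by (simp add: coaction_eq tensor_map_eq_tsum co twist[symmetric] del: tsum_co_twist)
  ultimately show ?thesis
    using f by (simp add: mor_def module_morphism_def comodule_morphism_def twist)
qed

section \<open>Identities, composites, inverses and tensor products of morphisms\<close>

lemma mor_id: "M \<in> Ob \<Longrightarrow> mor M M (\<lambda>m\<in>carrier M. m)"
  by (rule morI) (simp_all add: linear_maps_iff tsum_eta)

lemma linear_maps_compose:
  assumes "lin M N f" "lin N P g"
  shows "compose (carrier M) g f \<in> linear_maps K M P"
proof -
  have "lin M P (compose (carrier M) g f) = lin M P (\<lambda>x. g (f x))"
    by (rule lin_cong) (simp add: compose_eq)
  then show ?thesis
    using lin_compose[OF assms(2,1)] lin_module[OF assms(1)] lin_module[OF assms(2)]
    by (simp add: linear_maps_iff)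
qed

lemma mor_compose:
  assumes [simp]: "M \<in> Ob" "N \<in> Ob" "P \<in> Ob" and f: "mor M N f" and g: "mor N P g"
  shows "mor M P (compose (carrier M) g f)"
proof -
  have lf: "lin M N f" and lg: "lin N P g" using f g by (simp_all add: mor_lin)
  note [simp] = lin_closed[OF lf] lin_closed[OF lg] lin_compose[OF lf] lin_compose[OF lg]
    mor_twist[OF f] mor_twist[OF g] mor_ac[OF _ _ f] mor_ac[OF _ _ g]
  show ?thesis
  proof (rule morI)
    fix m assume [simp]: "m \<in> carrier M"
    \<comment> \<open>The bare coaction is written as a sum so that \<open>mor_tsum_co\<close>
      becomes applicable, once for each morphism.\<close>
    have "co P (g (f m)) = tsum H P (H \<boxtimes> P) (co P (g (f m))) (pure K H P)"
      by (simp add: tsum_eta)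
    also have "\<dots> = tsum H M (H \<boxtimes> P) (co M m) (\<lambda>a p. pure K H P a (g (f p)))"
      by (simp add: mor_tsum_co[OF _ _ f] mor_tsum_co[OF _ _ g])
    finally show "co P (compose (carrier M) g f m) =
        tsum H M (H \<boxtimes> P) (co M m) (\<lambda>a p. pure K H P a (compose (carrier M) g f p))"
      by (simp add: compose_eq)
  qed (simp_all add: linear_maps_compose[OF lf lg] compose_eq)
qed

text \<open>Each condition on \<open>g\<close> at \<open>n\<close> comes from the one on
  \<open>f\<close> at \<open>g n\<close>. For twist and action \<open>g\<close> is applied to the
  equation; for the coaction it enters through the summand.\<close>

lemma mor_inverse:
  assumes [simp]: "M \<in> Ob" "N \<in> Ob" and f: "mor M N f" and g: "g \<in> linear_maps K N M"
    and gf: "\<And>m. m \<in> carrier M \<Longrightarrow> g (f m) = m" and fg: "\<And>n. n \<in> carrier N \<Longrightarrow> f (g n) = n"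
  shows "mor N M g"
proof -
  have lf: "lin M N f" using f by (simp add: mor_lin)
  have lg: "lin N M g" using g by (simp add: linear_maps_iff)
  note [simp] = lin_closed[OF lf] lin_closed[OF lg] lin_compose[OF lf] lin_compose[OF lg] gf fg
  show ?thesis
  proof (rule morI[OF _ _ g])
    fix n assume [simp]: "n \<in> carrier N"
    show "g (twist N n) = twist M (g n)"
      using arg_cong[OF mor_twist[OF f, of "g n"], of g] by simp
    show "co M (g n) = tsum H N (H \<boxtimes> M) (co N n) (\<lambda>a p. pure K H M a (g p))"
      using mor_tsum_co[OF _ _ f, of "g n" "H \<boxtimes> M" "\<lambda>a p. pure K H M a (g p)"]
      by (simp add: tsum_eta)
    fix h assume [simp]: "h \<in> carrier H"
    show "g (ac N h n) = ac M h (g n)"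
      using arg_cong[OF mor_ac[OF _ _ f, of h "g n"], of g] by simp
  qed simp_all
qed

lemma mor_tensor:
  assumes [simp]: "M \<in> Ob" "N \<in> Ob" "M' \<in> Ob" "N' \<in> Ob" and f: "mor M M' f" and g: "mor N N' g"
  shows "mor (yd_tensor K H M N) (yd_tensor K H M' N') (tensor_map K M N M' N' f g)"
proof -
  have lf: "lin M M' f" and lg: "lin N N' g" using f g by (simp_all add: mor_lin)
  note [simp] = lf lg lin_closed[OF lf] lin_closed[OF lg] lin_compose[OF lf] lin_compose[OF lg]
    mor_twist[OF f] mor_twist[OF g] mor_ac[OF _ _ f] mor_ac[OF _ _ g]
    mor_tsum_co[OF _ _ f] mor_tsum_co[OF _ _ g] tensor_map_pure
  show ?thesis
  proof (rule morI, unfold yd_tensor_space yd_tensor_carrier)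
    show "tensor_map K M N M' N' f g \<in> linear_maps K (M \<boxtimes> N) (M' \<boxtimes> N')"
      by (rule tensor_map_linear[OF lf lg])
    let ?t = "tensor_map K M N M' N' f g"
    let ?T = "yd_tensor K H M N" and ?T' = "yd_tensor K H M' N'"
    fix t assume t: "t \<in> carrier (M \<boxtimes> N)"
    show "?t (twist ?T t) = twist ?T' (?t t)"
      by (rule tensor_ext[where V=M and W=N and X="M' \<boxtimes> N'" and f="\<lambda>t. ?t (twist ?T t)"]) (simp_all add: t)
    show "co ?T' (?t t) = tsum H (M \<boxtimes> N) (H \<boxtimes> M' \<boxtimes> N') (co ?T t) (\<lambda>a p. pure K H (M' \<boxtimes> N') a (?t p))"
      by (rule tensor_ext[where V=M and W=N and X="H \<boxtimes> M' \<boxtimes> N'" and f="\<lambda>t. co ?T' (?t t)"]) (simp_all add: t)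
    fix h assume [simp]: "h \<in> carrier H"
    show "?t (ac ?T h t) = ac ?T' h (?t t)"
      by (rule tensor_ext[where V=M and W=N and X="M' \<boxtimes> N'" and f="\<lambda>t. ?t (ac ?T h t)"]) (simp_all add: t)
  qed simp_all
qed

section \<open>Associativity constraint and quasi-braiding\<close>

lemmas yd_tensor_pure_rules =
  yd_tensor_twist_pure yd_tensor_untwist_pure ac_yd_tensor_pure co_yd_tensor_pure

text \<open>Nested tensor products are normalised to tensor products of the underlying spaces, so that
  the rules above no longer match them syntactically.\<close>

lemmas nested_yd_tensor_rules [simp] =
  yd_tensor_rules[of "yd_tensor K H M N" P for M N P, unfolded yd_tensor_space yd_tensor_carrier]
  yd_tensor_rules[of M "yd_tensor K H N P" for M N P, unfolded yd_tensor_space yd_tensor_carrier]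
  yd_tensor_pure_rules[of "yd_tensor K H M N" P for M N P, unfolded yd_tensor_space yd_tensor_carrier]
  yd_tensor_pure_rules[of M "yd_tensor K H N P" for M N P, unfolded yd_tensor_space yd_tensor_carrier]

section \<open>The associativity constraint and its inverse\<close>

lemma fn_yd_assoc:
  "fn (yd_assoc K H M N P) = lin_ext K (M \<boxtimes> N) P (M \<boxtimes> N \<boxtimes> P) (\<lambda>t p.
     sweedler (M \<boxtimes> N \<boxtimes> P) t (\<lambda>m n. pure K M (N \<boxtimes> P) (untwist M m) (pure K N P n (twist P p))))"
  by (simp add: yd_assoc_def Let_def untwist_def)

lemma src_yd_assoc [simp]: "src (yd_assoc K H M N P) = yd_tensor K H (yd_tensor K H M N) P"
  and tgt_yd_assoc [simp]: "tgt (yd_assoc K H M N P) = yd_tensor K H M (yd_tensor K H N P)"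
  by (simp_all add: yd_assoc_def Let_def)

lemma fn_yd_assoc_linear:
  assumes [simp]: "M \<in> Ob" "N \<in> Ob" "P \<in> Ob"
  shows "fn (yd_assoc K H M N P) \<in> linear_maps K ((M \<boxtimes> N) \<boxtimes> P) (M \<boxtimes> N \<boxtimes> P)"
  unfolding fn_yd_assoc by (rule lin_ext_linear) (simp add: sweedler_eq_tsum[of M N])

lemma fn_yd_assoc_pure:
  assumes [simp]: "M \<in> Ob" "N \<in> Ob" "P \<in> Ob" "m \<in> carrier M" "n \<in> carrier N" "p \<in> carrier P"
  shows "fn (yd_assoc K H M N P) (pure K (M \<boxtimes> N) P (pure K M N m n) p) =
    pure K M (N \<boxtimes> P) (untwist M m) (pure K N P n (twist P p))"
  unfolding fn_yd_assoc by (subst lin_ext_pure) (simp_all add: sweedler_eq_tsum[of M N])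

lemma lin_fn_yd_assoc:
  assumes [simp]: "M \<in> Ob" "N \<in> Ob" "P \<in> Ob" and "lin U ((M \<boxtimes> N) \<boxtimes> P) f"
  shows "lin U (M \<boxtimes> N \<boxtimes> P) (\<lambda>x. fn (yd_assoc K H M N P) (f x))"
  by (rule lin_compose[OF _ assms(4)]) (use fn_yd_assoc_linear[OF assms(1-3)] in \<open>simp add: linear_maps_iff\<close>)

lemma fn_yd_assoc_closed:
  assumes [simp]: "M \<in> Ob" "N \<in> Ob" "P \<in> Ob" and "t \<in> carrier ((M \<boxtimes> N) \<boxtimes> P)"
  shows "fn (yd_assoc K H M N P) t \<in> carrier (M \<boxtimes> N \<boxtimes> P)"
  by (rule lin_closed[OF lin_fn_yd_assoc[OF assms(1-3), of _ "\<lambda>x. x"] assms(4)]) simp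

lemma fn_yd_assoc_tsum:
  assumes [simp]: "M \<in> Ob" "N \<in> Ob" "P \<in> Ob"
    and "\<And>x y. x \<in> carrier V \<Longrightarrow> y \<in> carrier W \<Longrightarrow> \<beta> x y \<in> carrier ((M \<boxtimes> N) \<boxtimes> P)"
  shows "fn (yd_assoc K H M N P) (tsum V W ((M \<boxtimes> N) \<boxtimes> P) t \<beta>) =
    tsum V W (M \<boxtimes> N \<boxtimes> P) t (\<lambda>x y. fn (yd_assoc K H M N P) (\<beta> x y))"
  by (rule lin_tsum) (simp_all add: lin_fn_yd_assoc assms(4))

lemmas fn_yd_assoc_rules [simp] = fn_yd_assoc_pure lin_fn_yd_assoc fn_yd_assoc_closed fn_yd_assoc_tsum

text \<open>An explicit inverse of the constraint, by which the \<open>inverse_arrow\<close> in the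
  second hexagon is evaluated.\<close>

definition yd_assoc_inv :: "('k, 'a) yd \<Rightarrow> ('k, 'a) yd \<Rightarrow> ('k, 'a) yd \<Rightarrow> ('k, 'a) yd_arrow" where
  "yd_assoc_inv M N P = Arrow (yd_tensor K H M (yd_tensor K H N P))
     (lin_ext K M (N \<boxtimes> P) ((M \<boxtimes> N) \<boxtimes> P) (\<lambda>m t. tsum N P ((M \<boxtimes> N) \<boxtimes> P) t (\<lambda>n p.
        pure K (M \<boxtimes> N) P (pure K M N (twist M m) n) (untwist P p))))
     (yd_tensor K H (yd_tensor K H M N) P)"

lemma src_yd_assoc_inv [simp]: "src (yd_assoc_inv M N P) = yd_tensor K H M (yd_tensor K H N P)"
  and tgt_yd_assoc_inv [simp]: "tgt (yd_assoc_inv M N P) = yd_tensor K H (yd_tensor K H M N) P"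
  by (simp_all add: yd_assoc_inv_def)

lemma fn_yd_assoc_inv_linear:
  assumes [simp]: "M \<in> Ob" "N \<in> Ob" "P \<in> Ob"
  shows "fn (yd_assoc_inv M N P) \<in> linear_maps K (M \<boxtimes> N \<boxtimes> P) ((M \<boxtimes> N) \<boxtimes> P)"
  unfolding yd_assoc_inv_def arrow.sel by (rule lin_ext_linear) simp

lemma fn_yd_assoc_inv_pure:
  assumes [simp]: "M \<in> Ob" "N \<in> Ob" "P \<in> Ob" "m \<in> carrier M" "n \<in> carrier N" "p \<in> carrier P"
  shows "fn (yd_assoc_inv M N P) (pure K M (N \<boxtimes> P) m (pure K N P n p)) =
    pure K (M \<boxtimes> N) P (pure K M N (twist M m) n) (untwist P p)"
  unfolding yd_assoc_inv_def arrow.sel by (subst lin_ext_pure) simp_all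

lemma lin_fn_yd_assoc_inv:
  assumes [simp]: "M \<in> Ob" "N \<in> Ob" "P \<in> Ob" and "lin U (M \<boxtimes> N \<boxtimes> P) f"
  shows "lin U ((M \<boxtimes> N) \<boxtimes> P) (\<lambda>x. fn (yd_assoc_inv M N P) (f x))"
  by (rule lin_compose[OF _ assms(4)])
    (use fn_yd_assoc_inv_linear[OF assms(1-3)] in \<open>simp add: linear_maps_iff\<close>)

lemma fn_yd_assoc_inv_tsum:
  assumes [simp]: "M \<in> Ob" "N \<in> Ob" "P \<in> Ob"
    and "\<And>x y. x \<in> carrier V \<Longrightarrow> y \<in> carrier W \<Longrightarrow> \<beta> x y \<in> carrier (M \<boxtimes> N \<boxtimes> P)"
  shows "fn (yd_assoc_inv M N P) (tsum V W (M \<boxtimes> N \<boxtimes> P) t \<beta>) =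
    tsum V W ((M \<boxtimes> N) \<boxtimes> P) t (\<lambda>x y. fn (yd_assoc_inv M N P) (\<beta> x y))"
  by (rule lin_tsum) (simp_all add: lin_fn_yd_assoc_inv assms(4))

lemmas fn_yd_assoc_inv_rules [simp] =
  fn_yd_assoc_inv_pure lin_fn_yd_assoc_inv fn_yd_assoc_inv_tsum

text \<open>On the left bracketing \<open>h\<close> acts through three legs twisted by \<alpha>^2,
  \<alpha>^2, \<alpha>, on the right one through legs twisted by \<alpha>, \<alpha>^2, \<alpha>^2;
  coassociativity matches the legs. The maps \<alpha>^-1 on \<open>M\<close> and \<alpha> on
  \<open>P\<close> convert one pattern into the other by equivariance. Coactions show the same
  patterns with inverse powers.\<close>

lemma mor_assoc:
  assumes [simp]: "M \<in> Ob" "N \<in> Ob" "P \<in> Ob"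
  shows "mor (yd_tensor K H (yd_tensor K H M N) P) (yd_tensor K H M (yd_tensor K H N P)) (fn (yd_assoc K H M N P))"
    (is "mor ?S ?T ?f")
proof (rule morI, unfold yd_tensor_space yd_tensor_carrier)
  show "?f \<in> linear_maps K ((M \<boxtimes> N) \<boxtimes> P) (M \<boxtimes> N \<boxtimes> P)" by (rule fn_yd_assoc_linear) simp_all
  fix t assume t: "t \<in> carrier ((M \<boxtimes> N) \<boxtimes> P)"
  show "?f (twist ?S t) = twist ?T (?f t)"
    by (rule tensor_ext3_left[where U=M and V=N and W=P and X="M \<boxtimes> N \<boxtimes> P" and f="\<lambda>t. ?f (twist ?S t)"])
      (simp_all add: t)
  show "co ?T (?f t) = tsum H ((M \<boxtimes> N) \<boxtimes> P) (H \<boxtimes> M \<boxtimes> N \<boxtimes> P) (co ?S t)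
      (\<lambda>a p. pure K H (M \<boxtimes> N \<boxtimes> P) a (?f p))"
    by (rule tensor_ext3_left[where U=M and V=N and W=P and X="H \<boxtimes> M \<boxtimes> N \<boxtimes> P" and f="\<lambda>t. co ?T (?f t)"])
      (simp_all add: t)
  fix h assume [simp]: "h \<in> carrier H"
  show "?f (ac ?S h t) = ac ?T h (?f t)"
    by (rule tensor_ext3_left[where U=M and V=N and W=P and X="M \<boxtimes> N \<boxtimes> P" and f="\<lambda>t. ?f (ac ?S h t)"])
      (simp_all add: t comul_coassoc)
qed simp_all

lemma yd_assoc_inv_assoc:
  assumes [simp]: "M \<in> Ob" "N \<in> Ob" "P \<in> Ob" and t: "t \<in> carrier ((M \<boxtimes> N) \<boxtimes> P)"
  shows "fn (yd_assoc_inv M N P) (fn (yd_assoc K H M N P) t) = t"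
  by (rule tensor_ext3_left[where U=M and V=N and W=P and X="(M \<boxtimes> N) \<boxtimes> P" and g="\<lambda>t. t"])
    (simp_all add: t)

lemma yd_assoc_assoc_inv:
  assumes [simp]: "M \<in> Ob" "N \<in> Ob" "P \<in> Ob" and t: "t \<in> carrier (M \<boxtimes> N \<boxtimes> P)"
  shows "fn (yd_assoc K H M N P) (fn (yd_assoc_inv M N P) t) = t"
  by (rule tensor_ext3_right[where U=M and V=N and W=P and X="M \<boxtimes> N \<boxtimes> P" and g="\<lambda>t. t"])
    (simp_all add: t)

lemma mor_assoc_inv:
  assumes [simp]: "M \<in> Ob" "N \<in> Ob" "P \<in> Ob"
  shows "mor (yd_tensor K H M (yd_tensor K H N P)) (yd_tensor K H (yd_tensor K H M N) P) (fn (yd_assoc_inv M N P))"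
  by (rule mor_inverse[OF _ _ mor_assoc])
    (simp_all add: yd_assoc_inv_assoc yd_assoc_assoc_inv fn_yd_assoc_inv_linear)

section \<open>The quasi-braiding\<close>

lemma fn_yd_braid:
  "fn (yd_braid K H M N) = lin_ext K M N (N \<boxtimes> M) (\<lambda>m n.
     sweedler (N \<boxtimes> M) (\<lambda>c\<^bsub>M\<^esub> m) (\<lambda>m' m0.
       pure K N M (untwist N (act K H N (untwist H m') n)) (untwist M m0)))"
  by (simp add: yd_braid_def Let_def untwist_def)

lemma src_yd_braid [simp]: "src (yd_braid K H M N) = yd_tensor K H M N"
  and tgt_yd_braid [simp]: "tgt (yd_braid K H M N) = yd_tensor K H N M"
  by (simp_all add: yd_braid_def Let_def)

lemma fn_yd_braid_linear:
  assumes [simp]: "M \<in> Ob" "N \<in> Ob"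
  shows "fn (yd_braid K H M N) \<in> linear_maps K (M \<boxtimes> N) (N \<boxtimes> M)"
  unfolding fn_yd_braid
  by (rule lin_ext_linear) (simp add: coaction_eq act_eq sweedler_eq_tsum[of H M])

lemma fn_yd_braid_pure:
  assumes [simp]: "M \<in> Ob" "N \<in> Ob" "m \<in> carrier M" "n \<in> carrier N"
  shows "fn (yd_braid K H M N) (pure K M N m n) =
    tsum H M (N \<boxtimes> M) (co M m) (\<lambda>a p. pure K N M (ac N a n) p)"
  unfolding fn_yd_braid
  by (subst lin_ext_pure) (simp_all add: coaction_eq act_eq sweedler_eq_tsum[of H M])

lemma lin_fn_yd_braid:
  assumes [simp]: "M \<in> Ob" "N \<in> Ob" and "lin U (M \<boxtimes> N) f"
  shows "lin U (N \<boxtimes> M) (\<lambda>x. fn (yd_braid K H M N) (f x))"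
  by (rule lin_compose[OF _ assms(3)]) (use fn_yd_braid_linear[OF assms(1-2)] in \<open>simp add: linear_maps_iff\<close>)

lemma fn_yd_braid_closed:
  assumes [simp]: "M \<in> Ob" "N \<in> Ob" and "t \<in> carrier (M \<boxtimes> N)"
  shows "fn (yd_braid K H M N) t \<in> carrier (N \<boxtimes> M)"
  by (rule lin_closed[OF lin_fn_yd_braid[OF assms(1-2), of _ "\<lambda>x. x"] assms(3)]) simp

lemma fn_yd_braid_tsum:
  assumes [simp]: "M \<in> Ob" "N \<in> Ob"
    and "\<And>x y. x \<in> carrier V \<Longrightarrow> y \<in> carrier W \<Longrightarrow> \<beta> x y \<in> carrier (M \<boxtimes> N)"
  shows "fn (yd_braid K H M N) (tsum V W (M \<boxtimes> N) t \<beta>) =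
    tsum V W (N \<boxtimes> M) t (\<lambda>x y. fn (yd_braid K H M N) (\<beta> x y))"
  by (rule lin_tsum) (simp_all add: lin_fn_yd_braid assms(3))

lemmas fn_yd_braid_rules [simp] = fn_yd_braid_pure lin_fn_yd_braid fn_yd_braid_closed fn_yd_braid_tsum

text \<open>H-linearity of the quasi-braiding is the Yetter-Drinfeld condition of \<open>M\<close>,
  evaluated by letting the leg in \<open>H\<close> act on \<open>n\<close>; the fact
  \<open>b\<close> records this choice of bilinear map.\<close>

lemma braid_ac:
  assumes [simp]: "M \<in> Ob" "N \<in> Ob" "h \<in> carrier H" "m \<in> carrier M" "n \<in> carrier N"
  shows "fn (yd_braid K H M N) (ac (yd_tensor K H M N) h (pure K M N m n)) =
    ac (yd_tensor K H N M) h (fn (yd_braid K H M N) (pure K M N m n))"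
proof -
  define l where "l = twist H h"
  have l [simp]: "l \<in> carrier H" and hl: "h = untwist H l" by (simp_all add: l_def)
  have b: "bilin H M (N \<boxtimes> M) (\<lambda>x p. pure K N M (ac N x n) p)" by simp
  have "fn (yd_braid K H M N) (ac (yd_tensor K H M N) h (pure K M N m n)) =
    tsum H H (N \<boxtimes> M) (comul l) (\<lambda>g k. tsum H M (N \<boxtimes> M) (co M (ac M g m)) (\<lambda>a p. pure K N M (ac N (mul a k) n) p))"
    unfolding hl by simp
  also have "\<dots> = tsum H H (N \<boxtimes> M) (comul l) (\<lambda>g k. tsum H M (N \<boxtimes> M) (co M m) (\<lambda>a p. pure K N M (ac N (mul g a) n) (ac M k p)))"
    by (rule yd_condition[OF _ _ _ b]) simp_all
  also have "\<dots> = tsum H M (N \<boxtimes> M) (co M m) (\<lambda>a p. tsum H H (N \<boxtimes> M) (comul l) (\<lambda>g k. pure K N M (ac N (mul g a) n) (ac M k p)))"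
    by (rule tsum_swap) simp_all
  also have "\<dots> = ac (yd_tensor K H N M) h (fn (yd_braid K H M N) (pure K M N m n))"
    unfolding hl by simp
  finally show ?thesis .
qed

text \<open>Colinearity rests on the condition of \<open>N\<close> for the element m_(-1).
  Coassociativity of the coaction of \<open>M\<close> turns the iterated coaction into a
  comultiplication of this element, as the condition demands, and is used in reverse
  afterwards.\<close>

lemma braid_co:
  assumes [simp]: "M \<in> Ob" "N \<in> Ob" "m \<in> carrier M" "n \<in> carrier N"
  shows "co (yd_tensor K H N M) (fn (yd_braid K H M N) (pure K M N m n)) =
    tsum H (M \<boxtimes> N) (H \<boxtimes> N \<boxtimes> M) (co (yd_tensor K H M N) (pure K M N m n))
      (\<lambda>a p. pure K H (N \<boxtimes> M) a (fn (yd_braid K H M N) p))"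
    (is "?lhs = ?rhs")
proof -
  let ?X = "H \<boxtimes> N \<boxtimes> M"
  let ?F = "\<lambda>a b q r. pure K H (N \<boxtimes> M) (mul (untwist H a) (untwist H b)) (pure K N M q r)"
  have "?lhs = tsum H M ?X (co M m) (\<lambda>a p. tsum H N ?X (co N (ac N a n)) (\<lambda>x q.
      tsum H M ?X (co M p) (\<lambda>b r. ?F x b q r)))"
    by simp
  also have "\<dots> = tsum H M ?X (co M m) (\<lambda>a p. tsum H M ?X (co M p) (\<lambda>b r.
      tsum H N ?X (co N (ac N a n)) (\<lambda>x q. ?F x b q r)))"
    by (intro tsum_cong HOL.refl tsum_swap) simp_all
  also have "\<dots> = tsum H M ?X (co M m) (\<lambda>y r. tsum H H ?X (comul y) (\<lambda>a b.
      tsum H N ?X (co N (ac N a n)) (\<lambda>x q. ?F x b q r)))"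
    by (rule co_coassoc[symmetric]) simp_all
  also have "\<dots> = tsum H M ?X (co M m) (\<lambda>y r. tsum H H ?X (comul y) (\<lambda>a b.
      tsum H N ?X (co N n) (\<lambda>x q. ?F a x (ac N b q) r)))"
    (is "tsum _ _ _ _ ?l = tsum _ _ _ _ ?r")
  proof (rule tsum_cong[OF HOL.refl])
    fix y r assume [simp]: "y \<in> carrier H" "r \<in> carrier M"
    have "bilin H N ?X (\<lambda>x q. pure K H (N \<boxtimes> M) (untwist H x) (pure K N M q r))"
      by simp
    from yd_condition[OF _ _ _ this, of y n] show "?l y r = ?r y r" by simp
  qed
  also have "\<dots> = tsum H M ?X (co M m) (\<lambda>a p. tsum H M ?X (co M p) (\<lambda>b r.
      tsum H N ?X (co N n) (\<lambda>x q. ?F a x (ac N b q) r)))"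
    by (rule co_coassoc) simp_all
  also have "\<dots> = tsum H M ?X (co M m) (\<lambda>a p. tsum H N ?X (co N n) (\<lambda>x q.
      tsum H M ?X (co M p) (\<lambda>b r. ?F a x (ac N b q) r)))"
    by (intro tsum_cong HOL.refl tsum_swap) simp_all
  also have "\<dots> = ?rhs" by simp
  finally show ?thesis .
qed

lemma mor_braid:
  assumes [simp]: "M \<in> Ob" "N \<in> Ob"
  shows "mor (yd_tensor K H M N) (yd_tensor K H N M) (fn (yd_braid K H M N))"
    (is "mor ?S ?T ?f")
proof (rule morI, unfold yd_tensor_space yd_tensor_carrier)
  show "?f \<in> linear_maps K (M \<boxtimes> N) (N \<boxtimes> M)" by (rule fn_yd_braid_linear) simp_all
  fix t assume t: "t \<in> carrier (M \<boxtimes> N)"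
  show "?f (twist ?S t) = twist ?T (?f t)"
    by (rule tensor_ext[where V=M and W=N and X="N \<boxtimes> M" and f="\<lambda>t. ?f (twist ?S t)"]) (simp_all add: t)
  \<comment> \<open>On pure tensors \<open>braid_co\<close> has to be applied while both sides are
    unexpanded, since the general rules for pure tensors would rewrite its left-hand side.\<close>
  show "co ?T (?f t) = tsum H (M \<boxtimes> N) (H \<boxtimes> N \<boxtimes> M) (co ?S t) (\<lambda>a p. pure K H (N \<boxtimes> M) a (?f p))"
    by (rule tensor_ext[where V=M and W=N and X="H \<boxtimes> N \<boxtimes> M" and f="\<lambda>t. co ?T (?f t)"])
      (simp_all only: braid_co assms, simp_all add: t)
  fix h assume [simp]: "h \<in> carrier H"
  show "?f (ac ?S h t) = ac ?T h (?f t)"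
    by (rule tensor_ext[where V=M and W=N and X="N \<boxtimes> M" and f="\<lambda>t. ?f (ac ?S h t)"])
      (simp_all only: braid_ac assms \<open>h \<in> carrier H\<close>, simp_all add: t)
qed simp_all

end

section \<open>The category of Yetter-Drinfeld modules\<close>

text \<open>The description in \<open>inverse_arrow\<close> leaves source and target open.
  \<open>Hom_disjoint\<close> determines them from \<open>f\<close>, and then the usual uniqueness
  of a two-sided inverse applies.\<close>

lemma (in category) inverse_arrow_eq:
  assumes "A \<in> Ob" "B \<in> Ob" "inverse_arrows A B f g"
  shows "inverse_arrow f = g"
  unfolding inverse_arrow_def
proof (rule the_equality)
  show "\<exists>A\<in>Ob. \<exists>B\<in>Ob. inverse_arrows A B f g" using assms by blast
  fix g' assume "\<exists>A\<in>Ob. \<exists>B\<in>Ob. inverse_arrows A B f g'"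
  then obtain A' B' where *: "A' \<in> Ob" "B' \<in> Ob" "inverse_arrows A' B' f g'" by blast
  have "A' = A" "B' = B"
    using Hom_disjoint[OF assms(1,2) *(1,2)] assms(3) *(3) by (auto simp: inverse_arrows_def)
  then have g: "f \<in> Hom A B" "g \<in> Hom B A" "comp f g = ident B"
    and g': "g' \<in> Hom B A" "comp g' f = ident A"
    using assms(3) *(3) by (simp_all add: inverse_arrows_def)
  have "g' = comp g' (comp f g)"
    using comp_ident[OF assms(2,1) g'(1)] g(3) by simp
  also have "\<dots> = comp (comp g' f) g"
    by (rule comp_assoc[OF assms(2,1,2,1) g(2,1) g'(1), symmetric])
  also have "\<dots> = g"
    using ident_comp[OF assms(2,1) g(2)] g'(2) by simp
  finally show "g' = g" .
qed

context bijective_hom_bialgebra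
begin

abbreviation (input) Hom where
  "Hom \<equiv> yd_Hom K H"

section \<open>Arrows and tests for their equality\<close>

lemma Hom_iff: "F \<in> Hom M N \<longleftrightarrow> src F = M \<and> tgt F = N \<and> mor M N (fn F)"
  by (cases F) (auto simp: yd_Hom_def mor_def)

lemma arrow_eqI:
  assumes "F \<in> Hom M N" "G \<in> Hom M N" "M \<in> Ob" "N \<in> Ob"
    and eq: "\<And>x. x \<in> carrier M \<Longrightarrow> fn F x = fn G x"
  shows "F = G"
proof -
  have "fn F \<in> extensional (carrier M)" "fn G \<in> extensional (carrier M)"
    using assms by (auto simp: Hom_iff dest!: mor_linear simp: linear_maps_iff)
  then have "fn F = fn G" using eq by (rule extensionalityI)
  with assms show ?thesis by (auto simp: Hom_iff intro: arrow.expand)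
qed

lemma Hom_lin: "F \<in> Hom M N \<Longrightarrow> M \<in> Ob \<Longrightarrow> N \<in> Ob \<Longrightarrow> lin M N (fn F)"
  by (auto simp: Hom_iff intro: mor_lin)

lemma arrow_ext2:
  assumes "F \<in> Hom (yd_tensor K H M N) P" "G \<in> Hom (yd_tensor K H M N) P"
    and [simp]: "M \<in> Ob" "N \<in> Ob" and P: "P \<in> Ob"
    and eq: "\<And>x y. x \<in> carrier M \<Longrightarrow> y \<in> carrier N \<Longrightarrow> fn F (pure K M N x y) = fn G (pure K M N x y)"
  shows "F = G"
proof (rule arrow_eqI[OF assms(1,2) _ P])
  have "lin (M \<boxtimes> N) P (fn F)" "lin (M \<boxtimes> N) P (fn G)"
    using Hom_lin[OF assms(1)] Hom_lin[OF assms(2)] P unfolding yd_tensor_space by simp_all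
  then show "fn F t = fn G t" if "t \<in> carrier (yd_tensor K H M N)" for t
    by (rule tensor_ext) (use that eq in simp_all)
qed simp

lemma arrow_ext3_left:
  assumes "F \<in> Hom (yd_tensor K H (yd_tensor K H U V) W) P" "G \<in> Hom (yd_tensor K H (yd_tensor K H U V) W) P"
    and [simp]: "U \<in> Ob" "V \<in> Ob" "W \<in> Ob" and P: "P \<in> Ob"
    and eq: "\<And>x y z. x \<in> carrier U \<Longrightarrow> y \<in> carrier V \<Longrightarrow> z \<in> carrier W \<Longrightarrow>
      fn F (pure K (U \<boxtimes> V) W (pure K U V x y) z) = fn G (pure K (U \<boxtimes> V) W (pure K U V x y) z)"
  shows "F = G"
proof (rule arrow_eqI[OF assms(1,2) _ P])
  have "lin ((U \<boxtimes> V) \<boxtimes> W) P (fn F)" "lin ((U \<boxtimes> V) \<boxtimes> W) P (fn G)"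
    using Hom_lin[OF assms(1)] Hom_lin[OF assms(2)] P unfolding yd_tensor_space by simp_all
  then show "fn F t = fn G t" if "t \<in> carrier (yd_tensor K H (yd_tensor K H U V) W)" for t
    by (rule tensor_ext3_left) (use that eq in simp_all)
qed simp

lemma arrow_ext3_right:
  assumes "F \<in> Hom (yd_tensor K H U (yd_tensor K H V W)) P" "G \<in> Hom (yd_tensor K H U (yd_tensor K H V W)) P"
    and [simp]: "U \<in> Ob" "V \<in> Ob" "W \<in> Ob" and P: "P \<in> Ob"
    and eq: "\<And>x y z. x \<in> carrier U \<Longrightarrow> y \<in> carrier V \<Longrightarrow> z \<in> carrier W \<Longrightarrow>
      fn F (pure K U (V \<boxtimes> W) x (pure K V W y z)) = fn G (pure K U (V \<boxtimes> W) x (pure K V W y z))"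
  shows "F = G"
proof (rule arrow_eqI[OF assms(1,2) _ P])
  have "lin (U \<boxtimes> V \<boxtimes> W) P (fn F)" "lin (U \<boxtimes> V \<boxtimes> W) P (fn G)"
    using Hom_lin[OF assms(1)] Hom_lin[OF assms(2)] P unfolding yd_tensor_space by simp_all
  then show "fn F t = fn G t" if "t \<in> carrier (yd_tensor K H U (yd_tensor K H V W))" for t
    by (rule tensor_ext3_right) (use that eq in simp_all)
qed simp

lemma arrow_ext4:
  assumes "F \<in> Hom (yd_tensor K H (yd_tensor K H (yd_tensor K H U V) W) X) P"
    "G \<in> Hom (yd_tensor K H (yd_tensor K H (yd_tensor K H U V) W) X) P"
    and [simp]: "U \<in> Ob" "V \<in> Ob" "W \<in> Ob" "X \<in> Ob" and P: "P \<in> Ob"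
    and eq: "\<And>x y z w. x \<in> carrier U \<Longrightarrow> y \<in> carrier V \<Longrightarrow> z \<in> carrier W \<Longrightarrow> w \<in> carrier X \<Longrightarrow>
      fn F (pure K ((U \<boxtimes> V) \<boxtimes> W) X (pure K (U \<boxtimes> V) W (pure K U V x y) z) w) =
      fn G (pure K ((U \<boxtimes> V) \<boxtimes> W) X (pure K (U \<boxtimes> V) W (pure K U V x y) z) w)"
  shows "F = G"
proof (rule arrow_eqI[OF assms(1,2) _ P])
  have "lin (((U \<boxtimes> V) \<boxtimes> W) \<boxtimes> X) P (fn F)" "lin (((U \<boxtimes> V) \<boxtimes> W) \<boxtimes> X) P (fn G)"
    using Hom_lin[OF assms(1)] Hom_lin[OF assms(2)] P unfolding yd_tensor_space by simp_all
  then show "fn F t = fn G t" if "t \<in> carrier (yd_tensor K H (yd_tensor K H (yd_tensor K H U V) W) X)" for t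
    by (rule tensor_ext4) (use that eq in simp_all)
qed simp

lemma comp_Hom: "F \<in> Hom M N \<Longrightarrow> G \<in> Hom N P \<Longrightarrow> M \<in> Ob \<Longrightarrow> N \<in> Ob \<Longrightarrow> P \<in> Ob \<Longrightarrow> yd_comp G F \<in> Hom M P"
  by (auto simp: Hom_iff yd_comp_def intro: mor_compose)

lemma id_Hom: "M \<in> Ob \<Longrightarrow> yd_id M \<in> Hom M M"
  by (simp add: Hom_iff yd_id_def mor_id)

lemma tensor_Hom:
  "F \<in> Hom M M' \<Longrightarrow> G \<in> Hom N N' \<Longrightarrow> M \<in> Ob \<Longrightarrow> N \<in> Ob \<Longrightarrow> M' \<in> Ob \<Longrightarrow> N' \<in> Ob \<Longrightarrow>
    yd_tensor_arrow K H F G \<in> Hom (yd_tensor K H M N) (yd_tensor K H M' N')"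
  by (auto simp: Hom_iff yd_tensor_arrow_def intro: mor_tensor)

lemma assoc_Hom:
  "M \<in> Ob \<Longrightarrow> N \<in> Ob \<Longrightarrow> P \<in> Ob \<Longrightarrow>
    yd_assoc K H M N P \<in> Hom (yd_tensor K H (yd_tensor K H M N) P) (yd_tensor K H M (yd_tensor K H N P))"
  by (simp add: Hom_iff mor_assoc)

lemma assoc_inv_Hom:
  "M \<in> Ob \<Longrightarrow> N \<in> Ob \<Longrightarrow> P \<in> Ob \<Longrightarrow>
    yd_assoc_inv M N P \<in> Hom (yd_tensor K H M (yd_tensor K H N P)) (yd_tensor K H (yd_tensor K H M N) P)"
  by (simp add: Hom_iff mor_assoc_inv)

lemma braid_Hom:
  "M \<in> Ob \<Longrightarrow> N \<in> Ob \<Longrightarrow> yd_braid K H M N \<in> Hom (yd_tensor K H M N) (yd_tensor K H N M)"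
  by (simp add: Hom_iff mor_braid)

text \<open>Applied repeatedly, these rules type a composite and at the same time instantiate the
  open sources and targets in the equality tests above.\<close>

lemmas Hom_intros = comp_Hom id_Hom tensor_Hom assoc_Hom assoc_inv_Hom braid_Hom yd_tensor_Ob

lemma fn_comp [simp]: "x \<in> carrier (src F) \<Longrightarrow> fn (yd_comp G F) x = fn G (fn F x)"
  by (simp add: yd_comp_def compose_eq)

lemma src_comp [simp]: "src (yd_comp G F) = src F" and tgt_comp [simp]: "tgt (yd_comp G F) = tgt G"
  by (simp_all add: yd_comp_def)

lemma fn_id [simp]: "x \<in> carrier M \<Longrightarrow> fn (yd_id M) x = x"
  by (simp add: yd_id_def)

lemma src_id [simp]: "src (yd_id M) = M" and tgt_id [simp]: "tgt (yd_id M) = M"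
  by (simp_all add: yd_id_def)

lemma fn_tensor_arrow [simp]:
  "fn (yd_tensor_arrow K H F G) = tensor_map K (src F) (src G) (tgt F) (tgt G) (fn F) (fn G)"
  and src_tensor_arrow [simp]: "src (yd_tensor_arrow K H F G) = yd_tensor K H (src F) (src G)"
  and tgt_tensor_arrow [simp]: "tgt (yd_tensor_arrow K H F G) = yd_tensor K H (tgt F) (tgt G)"
  by (simp_all add: yd_tensor_arrow_def)

declare tensor_map_pure [simp]

section \<open>Category axioms and invertibility of the associativity constraint\<close>

lemma category: "category Ob Hom yd_comp yd_id"
proof
  fix A B A' B' f assume "f \<in> Hom A B" "f \<in> Hom A' B'"
  then show "A = A' \<and> B = B'" by (auto simp: Hom_iff)
next
  fix A B C D f g h
  assume *: "A \<in> Ob" "B \<in> Ob" "C \<in> Ob" "D \<in> Ob" "f \<in> Hom A B" "g \<in> Hom B C" "h \<in> Hom C D"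
  note [simp] = lin_closed[OF Hom_lin[OF *(5,1,2)]] lin_closed[OF Hom_lin[OF *(6,2,3)]]
  have [simp]: "src f = A" "src g = B" using * by (auto simp: Hom_iff)
  show "yd_comp (yd_comp h g) f = yd_comp h (yd_comp g f)"
    by (rule arrow_eqI[of _ A D]) (use * in \<open>auto intro: comp_Hom\<close>)
next
  fix A B f assume *: "A \<in> Ob" "B \<in> Ob" "f \<in> Hom A B"
  note [simp] = lin_closed[OF Hom_lin[OF *(3,1,2)]]
  have [simp]: "src f = A" using * by (auto simp: Hom_iff)
  show "yd_comp f (yd_id A) = f" "yd_comp (yd_id B) f = f"
    by (rule arrow_eqI[of _ A B]; use * in \<open>auto intro: comp_Hom id_Hom\<close>)+
qed (auto intro: comp_Hom id_Hom)

interpretation category Ob Hom yd_comp yd_id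
  by (rule category)

lemma inverse_arrows_assoc:
  assumes [simp]: "M \<in> Ob" "N \<in> Ob" "P \<in> Ob"
  shows "inverse_arrows (yd_tensor K H (yd_tensor K H M N) P) (yd_tensor K H M (yd_tensor K H N P))
    (yd_assoc K H M N P) (yd_assoc_inv M N P)"
  unfolding inverse_arrows_def
proof (intro conjI)
  show "yd_comp (yd_assoc_inv M N P) (yd_assoc K H M N P) = yd_id (yd_tensor K H (yd_tensor K H M N) P)"
    by (rule arrow_eqI, (rule Hom_intros assms)+) (simp add: yd_assoc_inv_assoc)
  show "yd_comp (yd_assoc K H M N P) (yd_assoc_inv M N P) = yd_id (yd_tensor K H M (yd_tensor K H N P))"
    by (rule arrow_eqI, (rule Hom_intros assms)+) (simp add: yd_assoc_assoc_inv)
qed (rule Hom_intros assms)+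

section \<open>Naturality, pentagon and hexagons\<close>

lemmas nested_assoc_rules [simp] =
  fn_yd_assoc_rules[of "yd_tensor K H L M" N P for L M N P, unfolded yd_tensor_space yd_tensor_carrier]
  fn_yd_assoc_rules[of L "yd_tensor K H M N" P for L M N P, unfolded yd_tensor_space yd_tensor_carrier]
  fn_yd_assoc_rules[of L M "yd_tensor K H N P" for L M N P, unfolded yd_tensor_space yd_tensor_carrier]

lemmas nested_braid_rules [simp] =
  fn_yd_braid_rules[of "yd_tensor K H M N" P for M N P, unfolded yd_tensor_space yd_tensor_carrier]
  fn_yd_braid_rules[of M "yd_tensor K H N P" for M N P, unfolded yd_tensor_space yd_tensor_carrier]

lemma assoc_natural:
  assumes [simp]: "U \<in> Ob" "V \<in> Ob" "W \<in> Ob" "U' \<in> Ob" "V' \<in> Ob" "W' \<in> Ob"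
    and f: "f \<in> Hom U U'" and g: "g \<in> Hom V V'" and h: "h \<in> Hom W W'"
  shows "yd_comp (yd_assoc K H U' V' W') (yd_tensor_arrow K H (yd_tensor_arrow K H f g) h) =
    yd_comp (yd_tensor_arrow K H f (yd_tensor_arrow K H g h)) (yd_assoc K H U V W)"
proof (rule arrow_ext3_left, (rule Hom_intros assms)+)
  have [simp]: "src f = U" "src g = V" "src h = W" "tgt f = U'" "tgt g = V'" "tgt h = W'"
    and mor: "mor U U' (fn f)" "mor V V' (fn g)" "mor W W' (fn h)"
    using f g h by (auto simp: Hom_iff)
  note [simp] = mor_lin[OF _ _ mor(1)] mor_lin[OF _ _ mor(2)] mor_lin[OF _ _ mor(3)]
  note [simp] = lin_closed[OF mor_lin[OF _ _ mor(1)]] lin_closed[OF mor_lin[OF _ _ mor(2)]]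
    lin_closed[OF mor_lin[OF _ _ mor(3)]] lin_compose[OF mor_lin[OF _ _ mor(1)]]
    lin_compose[OF mor_lin[OF _ _ mor(2)]] lin_compose[OF mor_lin[OF _ _ mor(3)]]
    mor_untwist[OF _ _ mor(1)] mor_twist[OF mor(3)]
  fix u v w assume [simp]: "u \<in> carrier U" "v \<in> carrier V" "w \<in> carrier W"
  show "fn (yd_comp (yd_assoc K H U' V' W') (yd_tensor_arrow K H (yd_tensor_arrow K H f g) h))
      (pure K (U \<boxtimes> V) W (pure K U V u v) w) =
    fn (yd_comp (yd_tensor_arrow K H f (yd_tensor_arrow K H g h)) (yd_assoc K H U V W))
      (pure K (U \<boxtimes> V) W (pure K U V u v) w)"
    by simp
qed

text \<open>Both sides send u, v, w, x to \<alpha>^-2(u), \<alpha>^-1(v), \<alpha>(w),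
  \<alpha>^2(x), bracketed to the right.\<close>

lemma pentagon:
  assumes [simp]: "U \<in> Ob" "V \<in> Ob" "W \<in> Ob" "X \<in> Ob"
  shows "yd_comp (yd_assoc K H U V (yd_tensor K H W X)) (yd_assoc K H (yd_tensor K H U V) W X) =
    yd_comp (yd_tensor_arrow K H (yd_id U) (yd_assoc K H V W X))
      (yd_comp (yd_assoc K H U (yd_tensor K H V W) X) (yd_tensor_arrow K H (yd_assoc K H U V W) (yd_id X)))"
  by (rule arrow_ext4, (rule Hom_intros assms)+) simp

text \<open>The map \<open>f\<close> passes through the coaction by colinearity, and
  \<open>g\<close> passes through the action by H-linearity.\<close>

lemma braid_natural:
  assumes [simp]: "V \<in> Ob" "W \<in> Ob" "V' \<in> Ob" "W' \<in> Ob" and f: "f \<in> Hom V V'" and g: "g \<in> Hom W W'"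
  shows "yd_comp (yd_braid K H V' W') (yd_tensor_arrow K H f g) =
    yd_comp (yd_tensor_arrow K H g f) (yd_braid K H V W)"
proof (rule arrow_ext2, (rule Hom_intros assms)+)
  have [simp]: "src f = V" "src g = W" "tgt f = V'" "tgt g = W'"
    and mor: "mor V V' (fn f)" "mor W W' (fn g)"
    using f g by (auto simp: Hom_iff)
  note [simp] = mor_lin[OF _ _ mor(1)] mor_lin[OF _ _ mor(2)]
  note [simp] = lin_closed[OF mor_lin[OF _ _ mor(1)]] lin_closed[OF mor_lin[OF _ _ mor(2)]]
    lin_compose[OF mor_lin[OF _ _ mor(1)]] lin_compose[OF mor_lin[OF _ _ mor(2)]]
    mor_tsum_co[OF _ _ mor(1)] mor_ac[OF _ _ mor(2)]
  fix v w assume [simp]: "v \<in> carrier V" "w \<in> carrier W"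
  show "fn (yd_comp (yd_braid K H V' W') (yd_tensor_arrow K H f g)) (pure K V W v w) =
    fn (yd_comp (yd_tensor_arrow K H g f) (yd_braid K H V W)) (pure K V W v w)"
    by simp
qed

text \<open>On the left u_(-1) acts on v and w through its two legs; on the right u_(-1) acts on v
  and the leg of a second coaction acts on w. Coassociativity of the coaction of \<open>U\<close>
  identifies the two, and the twists in the constraints cancel those of the tensor action.\<close>

lemma hexagon1:
  assumes [simp]: "U \<in> Ob" "V \<in> Ob" "W \<in> Ob"
  shows "yd_comp (yd_assoc K H V W U) (yd_comp (yd_braid K H U (yd_tensor K H V W)) (yd_assoc K H U V W)) =
    yd_comp (yd_tensor_arrow K H (yd_id V) (yd_braid K H U W))
      (yd_comp (yd_assoc K H V U W) (yd_tensor_arrow K H (yd_braid K H U V) (yd_id W)))"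
  by (rule arrow_ext3_left, (rule Hom_intros assms)+) (simp add: co_coassoc)

text \<open>The coaction of the product of \<open>U\<close> and \<open>V\<close> multiplies their
  legs in \<open>H\<close>, and by the module axiom for \<open>W\<close> this product acts as the
  two legs in succession. The sums over the two coactions are then brought into the same
  order.\<close>

lemma hexagon2:
  assumes [simp]: "U \<in> Ob" "V \<in> Ob" "W \<in> Ob"
  shows "yd_comp (yd_assoc_inv W U V) (yd_comp (yd_braid K H (yd_tensor K H U V) W) (yd_assoc_inv U V W)) =
    yd_comp (yd_tensor_arrow K H (yd_braid K H U W) (yd_id V))
      (yd_comp (yd_assoc_inv U W V) (yd_tensor_arrow K H (yd_id U) (yd_braid K H V W)))"
  by (rule arrow_ext3_right, (rule Hom_intros assms)+) (simp add: tsum_swap[of "(W \<boxtimes> U) \<boxtimes> V" H V H U])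

lemma inverse_arrow_assoc:
  assumes "M \<in> Ob" "N \<in> Ob" "P \<in> Ob"
  shows "category.inverse_arrow Ob Hom yd_comp yd_id (yd_assoc K H M N P) = yd_assoc_inv M N P"
  by (rule category.inverse_arrow_eq[OF category _ _ inverse_arrows_assoc]) (simp_all add: assms)

section \<open>Assembly of the categorical structure\<close>

lemma pre_tensor_category:
  "pre_tensor_category Ob Hom yd_comp yd_id (yd_tensor K H) (yd_tensor_arrow K H) (yd_assoc K H)"
proof (intro pre_tensor_category.intro category pre_tensor_category_axioms.intro)
  fix U V assume *: "U \<in> Ob" "V \<in> Ob"
  note [simp] = *
  show "yd_tensor K H U V \<in> Ob" by simp
  show "yd_tensor_arrow K H (yd_id U) (yd_id V) = yd_id (yd_tensor K H U V)"
    by (rule arrow_ext2, (rule Hom_intros *)+) simp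
next
  fix U U' U'' V V' V'' f f' g g'
  assume *: "U \<in> Ob" "U' \<in> Ob" "U'' \<in> Ob" "V \<in> Ob" "V' \<in> Ob" "V'' \<in> Ob"
    "f \<in> Hom U U'" "f' \<in> Hom U' U''" "g \<in> Hom V V'" "g' \<in> Hom V' V''"
  have [simp]: "src f = U" "src g = V" "tgt f = U'" "tgt g = V'"
    "src f' = U'" "src g' = V'" "tgt f' = U''" "tgt g' = V''"
    using * by (auto simp: Hom_iff)
  note lin = Hom_lin[OF *(7,1,2)] Hom_lin[OF *(8,2,3)] Hom_lin[OF *(9,4,5)] Hom_lin[OF *(10,5,6)]
  note [simp] = * lin lin[THEN lin_closed] lin[THEN lin_compose]
  show "yd_tensor_arrow K H (yd_comp f' f) (yd_comp g' g) =
      yd_comp (yd_tensor_arrow K H f' g') (yd_tensor_arrow K H f g)"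
    by (rule arrow_ext2, (rule Hom_intros *)+) simp
qed (auto intro: tensor_Hom assoc_natural pentagon inverse_arrows_assoc
      simp: category.isomorphism_def[OF category])

lemma quasi_braided_pre_tensor_category:
  "quasi_braided_pre_tensor_category Ob Hom yd_comp yd_id
     (yd_tensor K H) (yd_tensor_arrow K H) (yd_assoc K H) (yd_braid K H)"
  by (intro quasi_braided_pre_tensor_category.intro pre_tensor_category
      quasi_braided_pre_tensor_category_axioms.intro)
    (auto intro: braid_Hom braid_natural hexagon1 simp: inverse_arrow_assoc hexagon2)

end

theorem theorem3p4:
  fixes K :: "('k, 'r) ring_scheme" and H :: "('k, 'a) hom_bialg"
  assumes "field K"
    and "hom_bialgebra K H"
    and "bij_betw \<alpha>\<^bsub>H\<^esub> (carrier H) (carrier H)"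
  shows "quasi_braided_pre_tensor_category
           (yd_Ob K H) (yd_Hom K H) yd_comp yd_id
           (yd_tensor K H) (yd_tensor_arrow K H) (yd_assoc K H) (yd_braid K H)"
proof -
  interpret bijective_hom_bialgebra K H
    using assms(2,3) by unfold_locales
  show ?thesis by (rule quasi_braided_pre_tensor_category)
qed

end
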